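(* Let $K$ be an infinite field of arbitrary characteristic, $R = K[x,y,z]$, and let $I = (x^a, y^b, z^c, x^\alpha y^\beta z^\gamma)$ with $0<\alpha<a$, $0<\beta<b$, $0<\gamma<c$. Put $d := \frac13(a+b+c+\alpha+\beta+\gamma)$ and assume that (1) $\max\{a,b,c,\alpha+\beta+\gamma\} \leq d$; (2) $\min\{\alpha+\beta+c,\ \alpha+b+\gamma,\ a+\beta+\gamma\} \geq d$; (3) $\min\{a+b,a+c,b+c\}\geq d$; and (4) $d$ is an integer. Then the following conditions are equivalent: (i) The algebra $R/I$ has the weak Lefschetz property. (ii) The determinant of $Z(T_d(I))$ is not zero in $K$. (iii) The generic splitting type of $\widetilde{\mathrm{syz}}\, I$ is $(-d,-d,-d)$.
   Context: A standard graded Artinian $K$-algebra $A$ has the weak Lefschetz property if there is a linear form $\ell$ such that $\times\ell: [A]_i\to[A]_{i+1}$ has maximal rank for all $i$. $Z(T_d(I))$ is the zero-one matrix whose rows are indexed by the monomials of degree $d-2$ not in $I$ and whose columns are indexed by the monomials of degree $d-1$ not in $I$ (both in graded reverse-lexicographic order), with entry $1$ in position $(m,n)$ if $n \in \{xm, ym, zm\}$ and $0$ otherwise. It is the bi-adjacency matrix of the bipartite graph associated to the triangular region $T_d(I)$, and is the transpose of the matrix of $\times(x+y+z): [R/I]_{d-2}\to[R/I]_{d-1}$ in the monomial bases. Under the stated hypotheses it is a square matrix; its integer determinant is the enumeration of signed perfect matchings of that bipartite graph, viewed in $K$. $\mathrm{syz}\, I$ is the kernel of $R(-\alpha-\beta-\gamma)\oplus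 R(-a)\oplus R(-b)\oplus R(-c)\to I$ and the syzygy bundle $\widetilde{\mathrm{syz}}\, I$ is its sheafification on $\mathbb{P}^2$, a vector bundle of rank $3$. Its restriction to a line $H$ of $\mathbb{P}^2$ splits as $\mathcal{O}_H(p)\oplus\mathcal{O}_H(q)\oplus\mathcal{O}_H(r)$; the triple $(p,q,r)$ is the same for all general lines $H$ and is called the generic splitting type. *)

theory Defs
  imports
    "HOL-Library.Poly_Mapping"
    "HOL-Computational_Algebra.Fraction_Field"
    "Jordan_Normal_Form.Determinant"
begin

section \<open>The polynomial ring in three variables\<close>

datatype var = VX | VY | VZ

text \<open>
  The order on variables only serves to make the ring of polynomials an instance of
  \<^class>\<open>idom\<close> (through the library's lexicographic order on exponents), so that its
  field of fractions is available. The monomial order used below is \<open>grevlex_less\<close>.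
\<close>

fun var_index :: "var \<Rightarrow> nat" where
  "var_index VX = 0"
| "var_index VY = 1"
| "var_index VZ = 2"

lemma var_index_inject: "var_index u = var_index v \<longleftrightarrow> u = v"
  by (cases u; cases v) simp_all

instantiation var :: linorder
begin

definition less_eq_var :: "var \<Rightarrow> var \<Rightarrow> bool" where
  "u \<le> v \<longleftrightarrow> var_index u \<le> var_index v"

definition less_var :: "var \<Rightarrow> var \<Rightarrow> bool" where
  "u < v \<longleftrightarrow> var_index u < var_index v"

instance
  by standard (auto simp: less_eq_var_def less_var_def var_index_inject)

end

type_synonym monom3 = "var \<Rightarrow>\<^sub>0 nat"
type_synonym 'k poly3 = "monom3 \<Rightarrow>\<^sub>0 'k"

definition Var :: "var \<Rightarrow> 'k::field poly3" where
  "Var v = Poly_Mapping.single (Poly_Mapping.single v 1) 1"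

definition tdeg :: "monom3 \<Rightarrow> nat" where
  "tdeg m = Poly_Mapping.lookup m VX + Poly_Mapping.lookup m VY + Poly_Mapping.lookup m VZ"

text \<open>The graded component \<open>[R]\<^sub>j\<close>; it is zero for negative \<open>j\<close>.\<close>

definition homog :: "int \<Rightarrow> 'k::field poly3 set" where
  "homog j = {p. \<forall>m\<in>Poly_Mapping.keys p. int (tdeg m) = j}"

definition poly3_eval :: "'k::field poly3 \<Rightarrow> (var \<Rightarrow> 'k) \<Rightarrow> 'k" where
  "poly3_eval p u =
     (\<Sum>m\<in>Poly_Mapping.keys p.
        Poly_Mapping.lookup p m *
        (u VX ^ Poly_Mapping.lookup m VX * u VY ^ Poly_Mapping.lookup m VY *
         u VZ ^ Poly_Mapping.lookup m VZ))"

definition ideal_gen :: "'k::field poly3 set \<Rightarrow> 'k poly3 set" where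
  "ideal_gen B = module.span (*) B"


section \<open>The weak Lefschetz property\<close>

text \<open>Elements of \<open>A = R/I\<close> are residue classes, that is, subsets of \<open>R\<close>.\<close>

definition residue :: "'k::field poly3 set \<Rightarrow> 'k poly3 \<Rightarrow> 'k poly3 set" where
  "residue I p = {q. q - p \<in> I}"

definition quot_piece :: "'k::field poly3 set \<Rightarrow> int \<Rightarrow> 'k poly3 set set" where
  "quot_piece I j = residue I ` homog j"

text \<open>
  Multiplication by (the class of) \<open>l\<close> on \<open>R/I\<close>. For an ideal \<open>I\<close>, all the classes in the union
  are equal.
\<close>

definition quot_mult :: "'k::field poly3 set \<Rightarrow> 'k poly3 \<Rightarrow> 'k poly3 set \<Rightarrow> 'k poly3 set" where
  "quot_mult I l C = (\<Union>p\<in>C. residue I (l * p))"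

text \<open>
  A linear map of finite-dimensional spaces has maximal rank iff it is injective or surjective.
\<close>

definition weak_lefschetz :: "'k::field poly3 set \<Rightarrow> bool" where
  "weak_lefschetz I \<longleftrightarrow>
     (\<exists>l\<in>homog 1. \<forall>i.
        inj_on (quot_mult I l) (quot_piece I i) \<or>
        quot_mult I l ` quot_piece I i = quot_piece I (i + 1))"


section \<open>The bi-adjacency matrix of a triangular region\<close>

text \<open>Graded reverse-lexicographic order with \<open>x > y > z\<close>.\<close>

definition grevlex_less :: "monom3 \<Rightarrow> monom3 \<Rightarrow> bool" where
  "grevlex_less m n \<longleftrightarrow>
     tdeg m < tdeg n \<or>
     tdeg m = tdeg n \<and>
       (Poly_Mapping.lookup n VZ < Poly_Mapping.lookup m VZ \<or>
        Poly_Mapping.lookup n VZ = Poly_Mapping.lookup m VZ \<and>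
        Poly_Mapping.lookup n VY < Poly_Mapping.lookup m VY)"

definition std_monoms :: "'k::field poly3 set \<Rightarrow> int \<Rightarrow> monom3 set" where
  "std_monoms I j = {m. int (tdeg m) = j \<and> Poly_Mapping.single m 1 \<notin> I}"

text \<open>
  The unique enumeration of a finite set of monomials from largest to smallest. (Using the
  opposite convention for both rows and columns does not affect the determinant of a square
  matrix.)
\<close>

definition monom_list :: "monom3 set \<Rightarrow> monom3 list" where
  "monom_list S = (THE ms. set ms = S \<and> sorted_wrt (\<lambda>m n. grevlex_less n m) ms)"

definition Zmat :: "nat \<Rightarrow> 'k::field poly3 set \<Rightarrow> int mat" where
  "Zmat d I =
     (let ms = monom_list (std_monoms I (int d - 2));
          ns = monom_list (std_monoms I (int d - 1))
      in mat (length ms) (length ns)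
           (\<lambda>(i, j). if \<exists>v. ns ! j = Poly_Mapping.single v 1 + ms ! i then 1 else 0))"


section \<open>Sheaves on the projective plane and their restrictions to lines\<close>

text \<open>
  A finitely generated torsion-free graded module is given as a graded submodule
  \<open>M = elems\<close> of the free module \<open>F = R(n\<^sub>1) \<oplus> \<dots> \<oplus> R(n\<^sub>r)\<close>, where \<open>shifts = [n\<^sub>1, \<dots>, n\<^sub>r]\<close>.
\<close>

record (overloaded) 'k graded_mod =
  shifts :: "int list"
  elems :: "(monom3 \<Rightarrow>\<^sub>0 'k) vec set"

definition rk :: "('k::field) graded_mod \<Rightarrow> nat" where
  "rk M = length (shifts M)"

text \<open>\<open>[R(n)]\<^sub>j = [R]\<^bsub>n+j\<^esub>\<close>.\<close>

definition piece :: "('k::field) graded_mod \<Rightarrow> int \<Rightarrow> 'k poly3 vec set" where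
  "piece M j =
     {v \<in> elems M. dim_vec v = rk M \<and> (\<forall>i<rk M. v $ i \<in> homog (j + shifts M ! i))}"

definition free_mod :: "int list \<Rightarrow> ('k::field) graded_mod" where
  "free_mod ns = \<lparr>shifts = ns, elems = carrier_vec (length ns)\<rparr>"

text \<open>
  The kernel of \<open>R(-e\<^sub>1) \<oplus> \<dots> \<oplus> R(-e\<^sub>r) \<rightarrow> R\<close> given by polynomials \<open>g\<^sub>1, \<dots>, g\<^sub>r\<close>, homogeneous of
  degrees \<open>e\<^sub>1, \<dots>, e\<^sub>r\<close>; the argument lists the pairs \<open>(e\<^sub>i, g\<^sub>i)\<close>.
\<close>

definition syz :: "(nat \<times> 'k::field poly3) list \<Rightarrow> 'k graded_mod" where
  "syz gs =
     \<lparr>shifts = map (\<lambda>(e, g). - int e) gs,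
      elems = {v \<in> carrier_vec (length gs). v \<bullet> vec_of_list (map snd gs) = 0}\<rparr>"

text \<open>
  The basic open sets of the projective plane are the sets \<open>D\<^sub>+(f)\<close> with \<open>f\<close> homogeneous of
  positive degree. All sheaves are described by their sections over them, which for the sheaf
  associated with \<open>M\<close> are the elements of degree zero of the localization of \<open>M\<close> at \<open>f\<close>. Since
  \<open>M\<close> is torsion-free, these are vectors over the field of fractions of \<open>R\<close>, and the restriction
  maps are inclusions.
\<close>

definition basic :: "'k::field poly3 \<Rightarrow> bool" where
  "basic f \<longleftrightarrow> f \<noteq> 0 \<and> (\<exists>e>0. f \<in> homog e)"

definition regular_fun :: "'k::field poly3 \<Rightarrow> 'k poly3 fract set" where
  "regular_fun f = {Fract g (f ^ k) | g k e. f \<in> homog e \<and> g \<in> homog (int k * e)}"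

definition sections :: "('k::field) graded_mod \<Rightarrow> 'k poly3 \<Rightarrow> 'k poly3 fract vec set" where
  "sections M f =
     {map_vec (\<lambda>g. Fract g (f ^ k)) v | v k e. f \<in> homog e \<and> v \<in> piece M (int k * e)}"

text \<open>Sections over \<open>D\<^sub>+(f)\<close> of the ideal sheaf of the line \<open>H = V(l)\<close>.\<close>

definition line_ideal :: "'k::field poly3 \<Rightarrow> 'k poly3 \<Rightarrow> 'k poly3 fract set" where
  "line_ideal l f =
     {Fract (l * g) (f ^ k) | g k e. f \<in> homog e \<and> l * g \<in> homog (int k * e)}"

text \<open>
  The restriction of a sheaf \<open>E\<close> to \<open>H\<close> is \<open>E / \<I>\<^sub>H E\<close> (identifying, as usual, sheaves of modules on
  \<open>H\<close> with sheaves on the plane killed by the ideal sheaf \<open>\<I>\<^sub>H\<close>), and its sections over the affine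
  set \<open>H \<inter> D\<^sub>+(f)\<close> are \<open>E(D\<^sub>+(f)) / \<I>\<^sub>H(D\<^sub>+(f)) E(D\<^sub>+(f))\<close>.
\<close>

inductive_set line_part ::
    "'k::field poly3 \<Rightarrow> 'k graded_mod \<Rightarrow> 'k poly3 \<Rightarrow> 'k poly3 fract vec set"
  for l M f where
  zero: "0\<^sub>v (rk M) \<in> line_part l M f"
| add: "r \<in> line_ideal l f \<Longrightarrow> s \<in> sections M f \<Longrightarrow> t \<in> line_part l M f
          \<Longrightarrow> r \<cdot>\<^sub>v s + t \<in> line_part l M f"

definition coset :: "'a::plus vec set \<Rightarrow> 'a vec \<Rightarrow> 'a vec set" where
  "coset N s = {s + t | t. t \<in> N}"

definition line_sections ::
    "'k::field poly3 \<Rightarrow> 'k graded_mod \<Rightarrow> 'k poly3 \<Rightarrow> 'k poly3 fract vec set set" where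
  "line_sections l M f = coset (line_part l M f) ` sections M f"

definition coset_add :: "'a::plus vec set \<Rightarrow> 'a vec set \<Rightarrow> 'a vec set" where
  "coset_add A B = {s + t | s t. s \<in> A \<and> t \<in> B}"

definition coset_smult ::
    "'a::semiring_0 vec set \<Rightarrow> 'a \<Rightarrow> 'a vec set \<Rightarrow> 'a vec set" where
  "coset_smult N r A = {r \<cdot>\<^sub>v s + t | s t. s \<in> A \<and> t \<in> N}"

text \<open>Restriction of sections to \<open>H \<inter> D\<^sub>+(h)\<close>.\<close>

definition line_res ::
    "'k::field poly3 \<Rightarrow> 'k graded_mod \<Rightarrow> 'k poly3
       \<Rightarrow> 'k poly3 fract vec set \<Rightarrow> 'k poly3 fract vec set" where
  "line_res l M h A = coset_add A (line_part l M h)"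

text \<open>
  Isomorphism of the restrictions to \<open>V(l)\<close> of the sheaves associated with \<open>M\<close> and \<open>M'\<close>: linear
  bijections over all basic open sets that are compatible with restriction from \<open>D\<^sub>+(f)\<close> to
  \<open>D\<^sub>+(h) \<subseteq> D\<^sub>+(f)\<close>, where this inclusion means that \<open>f\<close> divides a power of \<open>h\<close>.
\<close>

definition line_iso :: "'k::field poly3 \<Rightarrow> 'k graded_mod \<Rightarrow> 'k graded_mod \<Rightarrow> bool" where
  "line_iso l M M' \<longleftrightarrow>
     (\<exists>\<phi>.
        (\<forall>f. basic f \<longrightarrow>
           bij_betw (\<phi> f) (line_sections l M f) (line_sections l M' f) \<and>
           (\<forall>A\<in>line_sections l M f. \<forall>B\<in>line_sections l M f.
              \<phi> f (coset_add A B) = coset_add (\<phi> f A) (\<phi> f B)) \<and>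
           (\<forall>r\<in>regular_fun f. \<forall>A\<in>line_sections l M f.
              \<phi> f (coset_smult (line_part l M f) r A) =
              coset_smult (line_part l M' f) r (\<phi> f A))) \<and>
        (\<forall>f h. basic f \<and> basic h \<and> (\<exists>k. f dvd h ^ k) \<longrightarrow>
           (\<forall>A\<in>line_sections l M f.
              \<phi> h (line_res l M h A) = line_res l M' h (\<phi> f A))))"

text \<open>
  \<open>ps\<close> is the generic splitting type if \<open>\<O>\<^sub>H(p\<^sub>1) \<oplus> \<dots> \<oplus> \<O>\<^sub>H(p\<^sub>r)\<close> is isomorphic to the restriction
  to \<open>H\<close> for all lines \<open>H = V(l)\<close> in a nonempty open set, which may be taken to be a basic one
  \<open>D\<^sub>+(P)\<close>, of the dual plane, whose coordinates are the coefficients of \<open>l\<close>. This is meaningful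
  for infinite \<open>K\<close>.
\<close>

definition generic_splitting_type :: "('k::field) graded_mod \<Rightarrow> int list \<Rightarrow> bool" where
  "generic_splitting_type M ps \<longleftrightarrow>
     (\<exists>P e. P \<noteq> 0 \<and> P \<in> homog e \<and>
        (\<forall>l\<in>homog 1.
           l \<noteq> 0 \<and> poly3_eval P (\<lambda>v. Poly_Mapping.lookup l (Poly_Mapping.single v 1)) \<noteq> 0 \<longrightarrow>
           line_iso l M (free_mod ps)))"

end

theory Submission
  imports Defs
begin

text \<open>
  All three conditions say that multiplication by one linear form is bijective from degree
  \<open>d - 2\<close> to degree \<open>d - 1\<close> of \<open>A = R/I\<close>.

  The numerical hypotheses make the two pieces equally large: below degree \<open>d\<close> no two of the four
  monomial generators, of degrees \<open>e\<^sub>i\<close>, have a common multiple, so counting monomials gives the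
  difference \<open>d - \<Sum>(d - e\<^sub>i) = 0\<close> (\<open>card_std_monoms_eq\<close>). The matrix of multiplication by \<open>l = u x + v y + w z\<close>
  in the monomial bases is the transpose of \<open>Z\<close> with its ones weighted by \<open>u\<close>, \<open>v\<close>, \<open>w\<close>, and since
  all perfect matchings use each of the three directions equally often, its determinant is that of
  \<open>Z\<close> times a monomial in \<open>u\<close>, \<open>v\<close>, \<open>w\<close> (\<open>det_mult_coeff\<close>). So if any \<open>l\<close> is bijective there, then
  \<open>det Z\<close> is nonzero in \<open>K\<close>; conversely, if \<open>det Z\<close> is nonzero, then every \<open>l\<close> with nonzero
  coefficients is bijective there. Bijectivity in this one degree already gives the weak Lefschetz
  property: surjectivity passes to higher degrees because \<open>A\<close> is generated in degree one, and
  injectivity passes to lower degrees because the socle of \<open>A\<close> vanishes in degrees less than \<open>d - 2\<close>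
  (\<open>weak_lefschetz_iff_det\<close>).

  For the splitting type, let \<open>w \<noteq> 0\<close> and restrict to the line \<open>l = 0\<close>, whose coordinate ring \<open>S\<close> is a
  polynomial ring in two variables. Multiplication by \<open>l\<close> maps onto degree \<open>d - 1\<close> of \<open>A\<close> iff the
  restricted generators \<open>g\<^sub>i\<close> span \<open>S\<close> in degree \<open>d - 1\<close>; as \<open>\<Sum>(d - e\<^sub>i) = d\<close> is the dimension of that
  piece, this is the same as having no relation in degree \<open>d - 1\<close> (\<open>gens_inj_iff_surj\<close>). If it
  holds, the relations over \<open>S\<close> form a free module with three generators of degree \<open>d\<close>
  (\<open>syz_basis_generates\<close>, \<open>syz_basis_independent\<close>), which is the restricted bundle, so that
  this is \<open>\<O>(-d)\<^sup>3\<close> (\<open>line_iso_of_gens_bij\<close>). Conversely, a relation in degree \<open>d - 1\<close> is a global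
  section of the restricted bundle twisted by \<open>d - 1\<close>, and \<open>\<O>(-1)\<^sup>3\<close> has no nonzero one
  (\<open>gens_inj_of_line_iso\<close>). Finally, a nonempty open set of lines contains one with
  \<open>u v w \<noteq> 0\<close>, because \<open>K\<close> is infinite (\<open>poly3_eval_nonzero\<close>).
\<close>

section \<open>Graded pieces of the polynomial ring\<close>

lemma poly_mapping_sum_single:
  fixes p :: "'a \<Rightarrow>\<^sub>0 'b::comm_monoid_add"
  shows "p = (\<Sum>m\<in>Poly_Mapping.keys p. Poly_Mapping.single m (Poly_Mapping.lookup p m))"
  by (rule poly_mapping_eqI)
     (simp add: lookup_sum lookup_single when_def in_keys_iff)

lemma poly_mapping_induct [case_names zero single add]:
  fixes p :: "'a \<Rightarrow>\<^sub>0 'b::comm_monoid_add"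
  assumes "P 0" "\<And>m c. m \<in> Poly_Mapping.keys p \<Longrightarrow> P (Poly_Mapping.single m c)"
    and "\<And>p q. P p \<Longrightarrow> P q \<Longrightarrow> P (p + q)"
  shows "P p"
proof -
  have "P (\<Sum>m\<in>A. Poly_Mapping.single m (Poly_Mapping.lookup p m))"
    if "finite A" "A \<subseteq> Poly_Mapping.keys p" for A
    using that by (induction A rule: finite_induct) (auto simp: assms)
  from this[of "Poly_Mapping.keys p"] show ?thesis
    using poly_mapping_sum_single[of p] by simp
qed

lemma single_times_lookup:
  "Poly_Mapping.lookup (Poly_Mapping.single m (c :: 'k::field) * p) (m + n) =
     c * Poly_Mapping.lookup (p :: 'k poly3) n"
proof (induction p rule: poly_mapping_induct)
  case (single n' b)
  show ?case by (auto simp: mult_single lookup_single when_def)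
qed (auto simp: lookup_add algebra_simps)

lemma tdeg_zero [simp]: "tdeg 0 = 0"
  and tdeg_add [simp]: "tdeg (m + n) = tdeg m + tdeg n"
  and tdeg_var [simp]: "tdeg (Poly_Mapping.single v k) = k"
  by (cases v; auto simp: tdeg_def lookup_add lookup_single when_def)+

definition mon :: "nat \<Rightarrow> nat \<Rightarrow> nat \<Rightarrow> monom3" where
  "mon i j k = Poly_Mapping.single VX i + Poly_Mapping.single VY j + Poly_Mapping.single VZ k"

lemma lookup_mon [simp]:
  "Poly_Mapping.lookup (mon i j k) VX = i"
  "Poly_Mapping.lookup (mon i j k) VY = j"
  "Poly_Mapping.lookup (mon i j k) VZ = k"
  by (auto simp: mon_def lookup_add lookup_single when_def)

lemma monom3_eqI:
  assumes "Poly_Mapping.lookup m VX = Poly_Mapping.lookup n VX"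
    "Poly_Mapping.lookup m VY = Poly_Mapping.lookup n VY"
    "Poly_Mapping.lookup m VZ = Poly_Mapping.lookup n VZ"
  shows "m = (n :: monom3)"
proof (rule poly_mapping_eqI)
  fix v show "Poly_Mapping.lookup m v = Poly_Mapping.lookup n v"
    using assms by (cases v) auto
qed

lemma mon_lookup:
  "mon (Poly_Mapping.lookup m VX) (Poly_Mapping.lookup m VY) (Poly_Mapping.lookup m VZ) = m"
  by (rule monom3_eqI) auto

lemma monom3_cases: obtains i j k where "m = mon i j k"
  using mon_lookup[of m] by metis

lemma tdeg_mon [simp]: "tdeg (mon i j k) = i + j + k"
  by (simp add: tdeg_def)

lemma mon_add: "mon i j k + mon i' j' k' = mon (i + i') (j + j') (k + k')"
  by (rule monom3_eqI) (auto simp: lookup_add)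

lemma mon_eq_iff: "mon i j k = mon i' j' k' \<longleftrightarrow> i = i' \<and> j = j' \<and> k = k'"
  by (metis lookup_mon)

lemma single_var_mon:
  "Poly_Mapping.single VX n = mon n 0 0" "Poly_Mapping.single VY n = mon 0 n 0"
  "Poly_Mapping.single VZ n = mon 0 0 n"
  by (auto intro!: monom3_eqI simp: lookup_single when_def)

lemma Var_power: "Var v ^ n = (Poly_Mapping.single (Poly_Mapping.single v n) 1 :: 'k::field poly3)"
  by (induction n) (auto simp: Var_def mult_single single_add[symmetric])

lemma Var_power_mult:
  "Var VX ^ i * Var VY ^ j * Var VZ ^ k = (Poly_Mapping.single (mon i j k) 1 :: 'k::field poly3)"
  by (simp add: Var_power mult_single mon_def)

lemma UNIV_var: "(UNIV :: var set) = {VX, VY, VZ}"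
  using var.exhaust by auto

lemma finite_UNIV_var [simp]: "finite (UNIV :: var set)"
  by (simp add: UNIV_var)

lemma homog_induct [consumes 1, case_names zero single add]:
  assumes "p \<in> homog j" "P 0"
    "\<And>m c. int (tdeg m) = j \<Longrightarrow> P (Poly_Mapping.single m c)"
    "\<And>p q. P p \<Longrightarrow> P q \<Longrightarrow> P (p + q)"
  shows "P p"
proof -
  have "P (\<Sum>m\<in>A. Poly_Mapping.single m (Poly_Mapping.lookup p m))"
    if "finite A" "A \<subseteq> Poly_Mapping.keys p" for A
    using that assms(1) by (induction A rule: finite_induct) (auto simp: assms homog_def)
  from this[of "Poly_Mapping.keys p"] show ?thesis
    using poly_mapping_sum_single[of p] by simp
qed

lemma homog_zero [simp]: "0 \<in> homog j"
  by (simp add: homog_def)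

lemma homog_single: "Poly_Mapping.single m c \<in> homog j \<longleftrightarrow> c = 0 \<or> int (tdeg m) = j"
  by (simp add: homog_def)

lemma homog_singleI [simp]: "int (tdeg m) = j \<Longrightarrow> Poly_Mapping.single m c \<in> homog j"
  by (simp add: homog_single)

lemma homog_one: "1 \<in> homog 0"
  by (simp add: homog_def)

lemma homog_add: "p \<in> homog j \<Longrightarrow> q \<in> homog j \<Longrightarrow> p + q \<in> homog j"
  using keys_add[of p q] by (auto simp: homog_def)

lemma homog_uminus: "p \<in> homog j \<Longrightarrow> - p \<in> homog j"
  by (auto simp: homog_def in_keys_iff)

lemma homog_diff: "p \<in> homog j \<Longrightarrow> q \<in> homog j \<Longrightarrow> p - q \<in> homog j"
  using homog_add[of p j "- q"] homog_uminus[of q j] by simp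

lemma homog_sum: "(\<And>x. x \<in> A \<Longrightarrow> f x \<in> homog j) \<Longrightarrow> sum f A \<in> homog j"
  by (induction A rule: infinite_finite_induct) (auto simp: homog_add)

lemma homog_mult: "p \<in> homog i \<Longrightarrow> q \<in> homog j \<Longrightarrow> p * q \<in> homog (i + j)"
  using keys_mult[of p q] by (fastforce simp: homog_def)

lemma homog_mult': "p \<in> homog i \<Longrightarrow> q \<in> homog j \<Longrightarrow> n = i + j \<Longrightarrow> p * q \<in> homog n"
  using homog_mult by blast

lemma homog_power: "p \<in> homog i \<Longrightarrow> p ^ n \<in> homog (int n * i)"
  by (induction n) (auto simp: homog_one algebra_simps intro!: homog_mult')

lemma homog_Var [simp]: "Var v \<in> homog 1"
  by (simp add: Var_def)

lemma homog_neg: "j < 0 \<Longrightarrow> p \<in> homog j \<longleftrightarrow> p = 0"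
  by (auto simp: homog_def)

lemma homog_unique: "p \<in> homog i \<Longrightarrow> p \<in> homog j \<Longrightarrow> p \<noteq> 0 \<Longrightarrow> i = j"
  by (auto simp: homog_def)

text \<open>
  Homogeneous components are what turns a cofactor of a homogeneous polynomial into a homogeneous
  one.
\<close>

definition hcomp :: "int \<Rightarrow> 'k::field poly3 \<Rightarrow> 'k poly3" where
  "hcomp j p = (\<Sum>m\<in>{m\<in>Poly_Mapping.keys p. int (tdeg m) = j}.
     Poly_Mapping.single m (Poly_Mapping.lookup p m))"

lemma lookup_hcomp:
  "Poly_Mapping.lookup (hcomp j p) m = (if int (tdeg m) = j then Poly_Mapping.lookup p m else 0)"
  by (auto simp: hcomp_def lookup_sum lookup_single when_def in_keys_iff)

lemma hcomp_homog: "hcomp j p \<in> homog j"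
  by (auto simp: homog_def in_keys_iff lookup_hcomp split: if_splits)

lemma hcomp_add: "hcomp j (p + q) = hcomp j p + hcomp j q"
  by (rule poly_mapping_eqI) (auto simp: lookup_hcomp lookup_add)

lemma hcomp_zero [simp]: "hcomp j 0 = 0"
  by (simp add: hcomp_def)

lemma hcomp_id: "p \<in> homog j \<Longrightarrow> hcomp j p = p"
  by (rule poly_mapping_eqI) (auto simp: lookup_hcomp homog_def in_keys_iff)

lemma hcomp_single:
  "hcomp j (Poly_Mapping.single m c) = (if int (tdeg m) = j then Poly_Mapping.single m c else 0)"
  by (rule poly_mapping_eqI) (auto simp: lookup_hcomp lookup_single when_def)

lemma hcomp_mult:
  assumes "g \<in> homog i"
  shows "hcomp (i + j) (g * p) = g * hcomp j p"
  using assms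
proof (induction g rule: homog_induct)
  case (single m c)
  show ?case
  proof (induction p rule: poly_mapping_induct)
    case (single n b)
    then show ?case using \<open>int (tdeg m) = i\<close> by (auto simp: mult_single hcomp_single)
  qed (auto simp: algebra_simps hcomp_add)
qed (auto simp: algebra_simps hcomp_add)

lemma homog_Var_decomp:
  assumes "p \<in> homog j" "j > 0"
  shows "\<exists>q. (\<forall>v. q v \<in> homog (j - 1)) \<and> p = (\<Sum>v\<in>UNIV. Var v * q v)"
  using assms(1)
proof (induction p rule: homog_induct)
  case zero
  show ?case by (rule exI[of _ "\<lambda>_. 0"]) simp
next
  case (single m c)
  have "\<exists>v. Poly_Mapping.lookup m v > 0"
  proof (rule ccontr)
    assume "\<nexists>v. Poly_Mapping.lookup m v > 0"
    then have "tdeg m = 0" by (auto simp: tdeg_def)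
    then show False using single \<open>j > 0\<close> by simp
  qed
  then obtain v where v: "Poly_Mapping.lookup m v > 0" by blast
  define n where "n = m - Poly_Mapping.single v 1"
  have m: "m = Poly_Mapping.single v 1 + n"
    using v by (intro poly_mapping_eqI)
      (auto simp: n_def lookup_add lookup_minus lookup_single when_def)
  have "Poly_Mapping.single m c = Var v * Poly_Mapping.single n c"
    by (simp add: m Var_def mult_single)
  moreover have "int (tdeg n) = j - 1" using single m by simp
  ultimately show ?case
    by (intro exI[of _ "\<lambda>w. if w = v then Poly_Mapping.single n c else 0"])
       (auto simp: if_distrib sum.delta cong: if_cong)
next
  case (add p q)
  then obtain p' q' where "\<forall>v. p' v \<in> homog (j - 1)" "p = (\<Sum>v\<in>UNIV. Var v * p' v)"
    "\<forall>v. q' v \<in> homog (j - 1)" "q = (\<Sum>v\<in>UNIV. Var v * q' v)" by blast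
  then show ?case
    by (intro exI[of _ "\<lambda>v. p' v + q' v"]) (auto simp: homog_add algebra_simps sum.distrib)
qed

section \<open>Monomial ideals\<close>

lemma poly3_module: "Modules.module ((*) :: 'k::field poly3 \<Rightarrow> 'k poly3 \<Rightarrow> 'k poly3)"
  by standard (auto simp: algebra_simps)

definition divides :: "monom3 \<Rightarrow> monom3 \<Rightarrow> bool" where
  "divides g m \<longleftrightarrow> (\<exists>k. m = g + k)"

lemma divides_mon: "divides (mon i j k) (mon i' j' k') \<longleftrightarrow> i \<le> i' \<and> j \<le> j' \<and> k \<le> k'"
proof
  assume "divides (mon i j k) (mon i' j' k')"
  then obtain m where m: "mon i' j' k' = mon i j k + m" by (auto simp: divides_def)
  obtain i2 j2 k2 where "m = mon i2 j2 k2" by (rule monom3_cases)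
  then show "i \<le> i' \<and> j \<le> j' \<and> k \<le> k'" using m by (auto simp: mon_add mon_eq_iff)
next
  assume *: "i \<le> i' \<and> j \<le> j' \<and> k \<le> k'"
  then have "mon i' j' k' = mon i j k + mon (i' - i) (j' - j) (k' - k)"
    by (simp add: mon_add)
  then show "divides (mon i j k) (mon i' j' k')" by (auto simp: divides_def)
qed

text \<open>
  Membership in the ideal generated by the monomials of \<open>G\<close> can be read off term by term, and this
  is the description that all later arguments use.
\<close>

definition monomial_ideal :: "monom3 list \<Rightarrow> 'k::field poly3 set" where
  "monomial_ideal G = {p. \<forall>m\<in>Poly_Mapping.keys p. \<exists>g\<in>set G. divides g m}"

lemma monomial_ideal_zero [simp]: "0 \<in> monomial_ideal G"
  by (simp add: monomial_ideal_def)

lemma monomial_ideal_add: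
  "p \<in> monomial_ideal G \<Longrightarrow> q \<in> monomial_ideal G \<Longrightarrow> p + q \<in> monomial_ideal G"
  using keys_add[of p q] by (auto simp: monomial_ideal_def)

lemma monomial_ideal_uminus: "p \<in> monomial_ideal G \<Longrightarrow> - p \<in> monomial_ideal G"
  by (auto simp: monomial_ideal_def in_keys_iff)

lemma monomial_ideal_diff:
  "p \<in> monomial_ideal G \<Longrightarrow> q \<in> monomial_ideal G \<Longrightarrow> p - q \<in> monomial_ideal G"
  using monomial_ideal_add[of p G "- q"] monomial_ideal_uminus[of q G] by simp

lemma monomial_ideal_sum:
  "(\<And>x. x \<in> A \<Longrightarrow> f x \<in> monomial_ideal G) \<Longrightarrow> sum f A \<in> monomial_ideal G"
  by (induction A rule: infinite_finite_induct) (auto simp: monomial_ideal_add)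

lemma monomial_ideal_mult:
  assumes "p \<in> monomial_ideal G"
  shows "r * p \<in> monomial_ideal G"
  unfolding monomial_ideal_def
proof (intro CollectI ballI)
  fix m assume "m \<in> Poly_Mapping.keys (r * p)"
  then obtain k n where mn: "m = k + n" "n \<in> Poly_Mapping.keys p"
    using keys_mult[of r p] by blast
  then obtain g k' where "g \<in> set G" "n = g + k'"
    using assms by (auto simp: monomial_ideal_def divides_def)
  then show "\<exists>g\<in>set G. divides g m"
    by (auto simp: mn divides_def intro!: bexI[of _ g] exI[of _ "k + k'"] simp: ac_simps)
qed

lemma monomial_ideal_single:
  "Poly_Mapping.single m c \<in> monomial_ideal G \<longleftrightarrow> c = 0 \<or> (\<exists>g\<in>set G. divides g m)"
  by (simp add: monomial_ideal_def)

lemma ideal_gen_monomials: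
  "ideal_gen ((\<lambda>g. Poly_Mapping.single g 1) ` set G) = (monomial_ideal G :: 'k::field poly3 set)"
    (is "ideal_gen ?B = _")
proof
  show "ideal_gen ?B \<subseteq> (monomial_ideal G :: 'k poly3 set)"
    unfolding ideal_gen_def
  proof (rule Modules.module.span_minimal[OF poly3_module])
    show "?B \<subseteq> monomial_ideal G"
      by (auto simp: monomial_ideal_single divides_def intro!: bexI exI[of _ 0])
    show "Modules.module.subspace (*) (monomial_ideal G :: 'k poly3 set)"
      by (rule Modules.module.subspaceI[OF poly3_module]) (auto simp: monomial_ideal_add monomial_ideal_mult)
  qed
next
  show "(monomial_ideal G :: 'k poly3 set) \<subseteq> ideal_gen ?B"
  proof
    fix p :: "'k poly3" assume p: "p \<in> monomial_ideal G"
    have "Poly_Mapping.single m c \<in> module.span (*) ?B"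
      if m: "m \<in> Poly_Mapping.keys p" for m and c :: 'k
    proof -
      obtain g k where g: "g \<in> set G" "m = g + k"
        using p m by (auto simp: monomial_ideal_def divides_def)
      have "Poly_Mapping.single m c = Poly_Mapping.single k c * Poly_Mapping.single g 1"
        by (simp add: g mult_single ac_simps)
      also have "\<dots> \<in> module.span (*) ?B"
        using g by (intro Modules.module.span_scale[OF poly3_module] Modules.module.span_base[OF poly3_module]) auto
      finally show ?thesis .
    qed
    then have "(\<Sum>m\<in>Poly_Mapping.keys p. Poly_Mapping.single m (Poly_Mapping.lookup p m))
        \<in> module.span (*) ?B"
      by (intro Modules.module.span_sum[OF poly3_module])
    then show "p \<in> ideal_gen ?B"
      unfolding ideal_gen_def using poly_mapping_sum_single[of p] by simp
  qed
qed

lemma monomial_ideal_homog_decomp: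
  fixes p :: "'k::field poly3"
  assumes "p \<in> homog j" "p \<in> monomial_ideal G"
  shows "\<exists>k. (\<forall>i<length G. k i \<in> homog (j - int (tdeg (G ! i)))) \<and>
             p = (\<Sum>i<length G. k i * Poly_Mapping.single (G ! i) 1)"
    (is "?Q p")
proof -
  have Q_add: "?Q (p + q)" if pq: "?Q p" "?Q q" for p q :: "'k poly3"
  proof -
    obtain k k' where
      "\<forall>i<length G. k i \<in> homog (j - int (tdeg (G ! i)))"
      "p = (\<Sum>i<length G. k i * Poly_Mapping.single (G ! i) 1)"
      "\<forall>i<length G. k' i \<in> homog (j - int (tdeg (G ! i)))"
      "q = (\<Sum>i<length G. k' i * Poly_Mapping.single (G ! i) 1)"
      using pq by blast
    then show ?thesis
      by (intro exI[of _ "\<lambda>i. k i + k' i"]) (auto simp: homog_add algebra_simps sum.distrib)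
  qed
  show ?thesis
  proof (induction p rule: poly_mapping_induct)
    case zero
    show ?case by (rule exI[of _ "\<lambda>_. 0"]) simp
  next
    case (add p q)
    then show ?case by (rule Q_add)
  next
    case (single m c)
    obtain g where g: "g \<in> set G" "divides g m"
      using assms(2) single by (auto simp: monomial_ideal_def)
    then obtain i n where i: "i < length G" "m = G ! i + n"
      by (auto simp: divides_def in_set_conv_nth)
    have "int (tdeg m) = j" using assms(1) single by (auto simp: homog_def)
    with i show ?case
      by (intro exI[of _ "\<lambda>i'. if i' = i then Poly_Mapping.single n c else 0"])
         (auto simp: if_distrib if_distribR sum.delta mult_single ac_simps cong: if_cong)
  qed
qed

section \<open>Restriction to a line\<close>

text \<open>
  The degree \<open>j\<close> piece of the coordinate ring of a line, a polynomial ring in two variables. A form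
  in \<open>x\<close>, \<open>y\<close> is represented by its dehomogenization at \<open>y = 1\<close>, so that multiplication by \<open>y\<close> becomes
  the inclusion of \<open>Sdeg j\<close> into \<open>Sdeg (j + 1)\<close>.
\<close>

definition Sdeg :: "int \<Rightarrow> 'k::field poly set" where
  "Sdeg j = {s. \<forall>k. j < int k \<longrightarrow> coeff s k = 0}"

lemma Sdeg_zero [simp]: "0 \<in> Sdeg j"
  by (simp add: Sdeg_def)

lemma Sdeg_add: "p \<in> Sdeg j \<Longrightarrow> q \<in> Sdeg j \<Longrightarrow> p + q \<in> Sdeg j"
  by (simp add: Sdeg_def)

lemma Sdeg_diff: "p \<in> Sdeg j \<Longrightarrow> q \<in> Sdeg j \<Longrightarrow> p - q \<in> Sdeg j"
  by (simp add: Sdeg_def)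

lemma Sdeg_smult: "p \<in> Sdeg j \<Longrightarrow> smult c p \<in> Sdeg j"
  by (simp add: Sdeg_def)

lemma Sdeg_sum: "(\<And>x. x \<in> A \<Longrightarrow> f x \<in> Sdeg j) \<Longrightarrow> sum f A \<in> Sdeg j"
  by (induction A rule: infinite_finite_induct) (auto simp: Sdeg_add)

lemma Sdeg_mono: "p \<in> Sdeg i \<Longrightarrow> i \<le> j \<Longrightarrow> p \<in> Sdeg j"
  by (auto simp: Sdeg_def)

lemma Sdeg_mult:
  assumes "p \<in> Sdeg i" "q \<in> Sdeg j"
  shows "p * q \<in> Sdeg (i + j)"
proof -
  have "coeff p k * coeff q (n - k) = 0" if "i + j < int n" "k \<le> n" for n k
  proof (cases "i < int k")
    case False
    then have "j < int (n - k)" using that by (simp add: of_nat_diff)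
    then show ?thesis using assms by (auto simp: Sdeg_def)
  qed (use assms in \<open>auto simp: Sdeg_def\<close>)
  then show ?thesis by (auto simp: Sdeg_def coeff_mult intro!: sum.neutral)
qed

lemma Sdeg_one: "1 \<in> Sdeg 0"
  by (simp add: Sdeg_def)

lemma Sdeg_power: "p \<in> Sdeg 1 \<Longrightarrow> p ^ n \<in> Sdeg (int n)"
proof (induction n)
  case (Suc n)
  then show ?case using Sdeg_mult[of p 1 "p ^ n" "int n"] by simp
qed (simp add: Sdeg_one)

lemma Sdeg_monom: "int n \<le> j \<Longrightarrow> monom c n \<in> Sdeg j"
  by (auto simp: Sdeg_def)

lemma Sdeg_const: "0 \<le> j \<Longrightarrow> [:c:] \<in> Sdeg j"
  by (auto simp: Sdeg_def coeff_pCons split: nat.splits)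

lemma Sdeg_pCons_iff: "pCons c p \<in> Sdeg j \<longleftrightarrow> (0 \<le> j \<or> c = 0) \<and> p \<in> Sdeg (j - 1)"
proof
  assume *: "pCons c p \<in> Sdeg j"
  have "c = 0" if "j < 0" using that * by (auto simp: Sdeg_def dest!: spec[of _ 0])
  moreover have "coeff p k = 0" if "j - 1 < int k" for k
    using that * by (auto simp: Sdeg_def coeff_pCons dest!: spec[of _ "Suc k"])
  ultimately show "(0 \<le> j \<or> c = 0) \<and> p \<in> Sdeg (j - 1)"
    by (cases "0 \<le> j") (auto simp: Sdeg_def)
next
  assume "(0 \<le> j \<or> c = 0) \<and> p \<in> Sdeg (j - 1)"
  then show "pCons c p \<in> Sdeg j" by (auto simp: Sdeg_def coeff_pCons split: nat.splits)
qed

text \<open>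
  The rehomogenization in \<open>x\<close> and \<open>y\<close>, a section of the restriction to the line.
\<close>

definition lift :: "int \<Rightarrow> 'k::field poly \<Rightarrow> 'k poly3" where
  "lift j s = (\<Sum>k\<in>{k. int k \<le> j}. Poly_Mapping.single (mon k (nat j - k) 0) (coeff s k))"

lemma finite_int_le [simp]: "finite {k. int k \<le> j}"
  by (rule finite_subset[of _ "{..nat j}"]) auto

lemma lift_homog: "lift j s \<in> homog j"
  unfolding lift_def by (rule homog_sum) (auto simp: homog_single)

lemma lift_zero [simp]: "lift j 0 = 0"
  by (simp add: lift_def)

lemma lift_add: "lift j (p + q) = lift j p + lift j q"
  by (simp add: lift_def single_add sum.distrib)

lemma lift_monom: "int i \<le> j \<Longrightarrow> lift j (monom c i) = Poly_Mapping.single (mon i (nat j - i) 0) c"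
proof -
  assume i: "int i \<le> j"
  have "lift j (monom c i) = (\<Sum>k\<in>{k. int k \<le> j}.
      if k = i then Poly_Mapping.single (mon i (nat j - i) 0) c else 0)"
    unfolding lift_def by (rule sum.cong) auto
  then show ?thesis using i by (simp add: sum.delta)
qed

definition lin :: "'k \<Rightarrow> 'k \<Rightarrow> 'k \<Rightarrow> 'k::field poly3" where
  "lin u v w = Poly_Mapping.single (mon 1 0 0) u + Poly_Mapping.single (mon 0 1 0) v
     + Poly_Mapping.single (mon 0 0 1) w"

lemma lin_homog: "lin u v w \<in> homog 1"
  by (auto simp: lin_def intro!: homog_add)

text \<open>
  Since \<open>w \<noteq> 0\<close>, the equation \<open>u x + v y + w z = 0\<close> can be solved for \<open>z\<close>, and \<open>x\<close>, \<open>y\<close> are coordinates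
  on the line. Restricting a polynomial to the line and setting \<open>y = 1\<close> is the ring homomorphism \<open>rho\<close>
  with \<open>x \<mapsto> X\<close>, \<open>y \<mapsto> 1\<close>, \<open>z \<mapsto> zeta\<close>.
\<close>

locale line_coordinates =
  fixes u v w :: "'k::field"
  assumes w_nonzero: "w \<noteq> 0"
begin

definition zeta :: "'k poly" where
  "zeta = [: - v / w, - u / w :]"

definition rho_monom :: "monom3 \<Rightarrow> 'k poly" where
  "rho_monom m = monom 1 (Poly_Mapping.lookup m VX) * zeta ^ Poly_Mapping.lookup m VZ"

definition rho :: "'k poly3 \<Rightarrow> 'k poly" where
  "rho p = (\<Sum>m\<in>Poly_Mapping.keys p. smult (Poly_Mapping.lookup p m) (rho_monom m))"

abbreviation l :: "'k poly3" where "l \<equiv> lin u v w"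

lemma rho_add: "rho (p + q) = rho p + rho q"
  unfolding rho_def by (rule setsum_keys_plus_distrib) (auto simp: smult_add_left)

lemma rho_zero [simp]: "rho 0 = 0"
  by (simp add: rho_def)

lemma rho_single: "rho (Poly_Mapping.single m c) = smult c (rho_monom m)"
  by (simp add: rho_def)

lemma rho_uminus: "rho (- p) = - rho p"
  using rho_add[of p "- p"] by (simp add: eq_neg_iff_add_eq_0 add.commute)

lemma rho_diff: "rho (p - q) = rho p - rho q"
  using rho_add[of p "- q"] by (simp add: rho_uminus)

lemma rho_sum: "rho (sum f A) = (\<Sum>x\<in>A. rho (f x))"
  by (induction A rule: infinite_finite_induct) (auto simp: rho_add)

lemma rho_monom_add: "rho_monom (m + n) = rho_monom m * rho_monom n"
  by (simp add: rho_monom_def lookup_add power_add mult_monom[symmetric] ac_simps)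
     (metis mult.right_neutral mult_monom)

lemma rho_mult: "rho (p * q) = rho p * rho q"
proof (induction p rule: poly_mapping_induct)
  case (single m c)
  show ?case
    by (induction q rule: poly_mapping_induct)
       (auto simp: mult_single rho_single rho_monom_add rho_add algebra_simps)
qed (auto simp: rho_add algebra_simps)

lemma rho_one [simp]: "rho 1 = 1"
  using rho_single[of 0 1] by (simp add: rho_monom_def)

lemma rho_power: "rho (p ^ n) = rho p ^ n"
  by (induction n) (auto simp: rho_mult)

lemma rho_mon: "rho_monom (mon i j k) = monom 1 i * zeta ^ k"
  by (simp add: rho_monom_def)

lemma rho_Var [simp]: "rho (Var VX) = monom 1 1" "rho (Var VY) = 1" "rho (Var VZ) = zeta"
  by (simp_all add: Var_def rho_single rho_monom_def lookup_single)

lemma rho_l [simp]: "rho l = 0"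
  using w_nonzero by (simp add: lin_def rho_add rho_single rho_mon zeta_def monom_altdef)

lemma zeta_Sdeg: "zeta \<in> Sdeg 1"
  by (auto simp: zeta_def Sdeg_def coeff_pCons split: nat.splits)

lemma rho_monom_Sdeg: "rho_monom m \<in> Sdeg (int (tdeg m))"
proof -
  have "rho_monom m \<in>
      Sdeg (int (Poly_Mapping.lookup m VX) + int (Poly_Mapping.lookup m VZ))"
    unfolding rho_monom_def
    by (intro Sdeg_mult Sdeg_monom Sdeg_power zeta_Sdeg) auto
  then show ?thesis by (rule Sdeg_mono) (simp add: tdeg_def)
qed

lemma rho_homog: "p \<in> homog j \<Longrightarrow> rho p \<in> Sdeg j"
  by (induction p rule: homog_induct)
     (auto simp: rho_single rho_add intro!: Sdeg_smult Sdeg_add rho_monom_Sdeg)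

lemma rho_lift: "s \<in> Sdeg j \<Longrightarrow> rho (lift j s) = s"
proof (rule poly_eqI)
  fix n assume s: "s \<in> Sdeg j"
  have "rho (lift j s) = (\<Sum>k\<in>{k. int k \<le> j}. monom (coeff s k) k)"
    by (simp add: lift_def rho_sum rho_single rho_mon smult_monom)
  then have "coeff (rho (lift j s)) n = (\<Sum>k\<in>{k. int k \<le> j}. if k = n then coeff s k else 0)"
    by (simp add: coeff_sum)
  also have "\<dots> = coeff s n"
    using s by (auto simp: sum.delta' Sdeg_def)
  finally show "coeff (rho (lift j s)) n = coeff s n" .
qed

text \<open>
  Modulo \<open>l\<close>, the variable \<open>z\<close> is a combination of \<open>x\<close> and \<open>y\<close>, so the exponent of \<open>z\<close> in a term can be
  lowered until only \<open>x\<close> and \<open>y\<close> remain.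
\<close>

lemma homog_eq_lift_plus_l_times:
  assumes "p \<in> homog j"
  shows "\<exists>g\<in>homog (j - 1). p = lift j (rho p) + l * g"
  using assms
proof (induction p rule: homog_induct)
  case zero
  show ?case by (rule bexI[of _ 0]) auto
next
  case (add p q)
  then obtain g h where "g \<in> homog (j - 1)" "p = lift j (rho p) + l * g"
    "h \<in> homog (j - 1)" "q = lift j (rho q) + l * h" by blast
  then show ?case
    by (intro bexI[of _ "g + h"]) (auto simp: rho_add lift_add homog_add algebra_simps)
next
  case (single m c)
  obtain i1 i2 i3 where m: "m = mon i1 i2 i3" by (rule monom3_cases)
  have "\<exists>g\<in>homog (j - 1). Poly_Mapping.single (mon i1 i2 i3) c =
      lift j (rho (Poly_Mapping.single (mon i1 i2 i3) c)) + l * g"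
    if "int (i1 + i2 + i3) = j"
    using that
  proof (induction i3 arbitrary: i1 i2 c)
    case 0
    have "nat j - i1 = i2" using 0 by auto
    then show ?case
      using 0 by (intro bexI[of _ 0])
        (auto simp: rho_single rho_mon smult_monom lift_monom)
  next
    case (Suc i3)
    let ?p = "Poly_Mapping.single (mon i1 i2 (Suc i3)) c"
    let ?q = "Poly_Mapping.single (mon (Suc i1) i2 i3) (- u / w * c)"
    let ?r = "Poly_Mapping.single (mon i1 (Suc i2) i3) (- v / w * c)"
    let ?g = "Poly_Mapping.single (mon i1 i2 i3) (c / w)"
    have "?p = ?q + ?r + l * ?g"
      using w_nonzero
      by (simp add: lin_def algebra_simps mult_single mon_add single_add[symmetric])
    note p = this
    have rho_p: "rho ?p = rho ?q + rho ?r"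
      unfolding p by (simp add: rho_add rho_mult)
    obtain g1 where g1: "g1 \<in> homog (j - 1)" and q: "?q = lift j (rho ?q) + l * g1"
      using Suc.IH[of "Suc i1" i2 "- u / w * c"] Suc.prems by auto
    obtain g2 where g2: "g2 \<in> homog (j - 1)" and r: "?r = lift j (rho ?r) + l * g2"
      using Suc.IH[of i1 "Suc i2" "- v / w * c"] Suc.prems by auto
    have "?g \<in> homog (j - 1)" using Suc.prems by auto
    have arith: "p' = (lq + lr) + l * (g1 + g2 + g)"
      if "p' = q' + r' + l * g" "q' = lq + l * g1" "r' = lr + l * g2" for p' q' r' lq lr g
      using that by (simp add: algebra_simps)
    have "?p = lift j (rho ?p) + l * (g1 + g2 + ?g)"
      unfolding rho_p lift_add by (rule arith[OF p q r])
    then show ?case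
      using g1 g2 \<open>?g \<in> homog (j - 1)\<close>
      by (intro bexI[of _ "g1 + g2 + ?g"] homog_add)
  qed
  then show ?case using single by (simp add: m)
qed

lemma rho_kernel:
  assumes "p \<in> homog j" "rho p = 0"
  shows "\<exists>g\<in>homog (j - 1). p = l * g"
  using homog_eq_lift_plus_l_times[OF assms(1)] assms(2) by simp

end

section \<open>Syzygies on a line\<close>

lemma sum4: "(\<Sum>i<4::nat. f i) = f 0 + f 1 + f 2 + (f 3 :: 'a::comm_monoid_add)"
  by (simp add: eval_nat_numeral)

lemma sum3: "(\<Sum>i<3::nat. f i) = f 0 + f 1 + (f 2 :: 'a::comm_monoid_add)"
  by (simp add: eval_nat_numeral)

lemma all4: "(\<forall>i<4::nat. P i) \<longleftrightarrow> P 0 \<and> P 1 \<and> P 2 \<and> P 3"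
  by (auto simp: less_Suc_eq numeral_eq_Suc)

text \<open>
  Enumerates the generators other than number 2. A relation evaluated at \<open>X = 0\<close> is determined by
  its entries at these three, because generator number 2 is the constant 1.
\<close>

definition tau :: "nat \<Rightarrow> nat" where
  "tau k = (if k = 2 then 3 else k)"

text \<open>
  Four forms on the line, dehomogenized at \<open>y = 1\<close>. The one with value 1 is a power of \<open>y\<close>.
\<close>

locale line_generators =
  fixes g :: "nat \<Rightarrow> 'k::field poly" and e :: "nat \<Rightarrow> nat" and d :: nat
  assumes g_Sdeg: "i < 4 \<Longrightarrow> g i \<in> Sdeg (int (e i))"
    and e_le: "i < 4 \<Longrightarrow> e i \<le> d"
    and g2: "g 2 = 1"
begin

definition line_syz :: "int \<Rightarrow> (nat \<Rightarrow> 'k poly) set" where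
  "line_syz j = {n. (\<forall>i<4. n i \<in> Sdeg (j - int (e i))) \<and> (\<Sum>i<4. n i * g i) = 0}"

definition gens_surj :: "int \<Rightarrow> bool" where
  "gens_surj j \<longleftrightarrow>
     (\<forall>s\<in>Sdeg j. \<exists>k. (\<forall>i<4. k i \<in> Sdeg (j - int (e i))) \<and> (\<Sum>i<4. k i * g i) = s)"

definition gens_inj :: "int \<Rightarrow> bool" where
  "gens_inj j \<longleftrightarrow> (\<forall>n\<in>line_syz j. \<forall>i<4. n i = 0)"

definition syz_basis :: "(nat \<Rightarrow> nat \<Rightarrow> 'k poly) \<Rightarrow> bool" where
  "syz_basis U \<longleftrightarrow> (\<forall>k<3. U k \<in> line_syz (int d) \<and>
     (\<forall>j<3. coeff (U k (tau j)) 0 = (if j = k then 1 else 0)))"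

lemma line_syz_mono:
  assumes "n \<in> line_syz i" "i \<le> j"
  shows "n \<in> line_syz j"
proof -
  have "n k \<in> Sdeg (j - int (e k))" if "k < 4" for k
    using assms that by - (rule Sdeg_mono[of "n k" "i - int (e k)"], auto simp: line_syz_def)
  then show ?thesis using assms by (simp add: line_syz_def)
qed

text \<open>
  The constant tuple with entry 1 at \<open>tau k\<close>, corrected at the generator 1, is a relation at \<open>X = 0\<close>.
  Its value on the generators is thus divisible by \<open>X\<close>, and the quotient, of degree \<open>d - 1\<close>, can be
  written in terms of the generators and subtracted.
\<close>

lemma syz_basis_exists:
  assumes "gens_surj (int d - 1)"
  shows "\<exists>U. syz_basis U"
proof -
  have "\<exists>U. U \<in> line_syz (int d) \<and> (\<forall>j<3. coeff (U (tau j)) 0 = (if j = k then 1 else 0))"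
    if k: "k < 3" for k
  proof -
    have tk: "tau k < 4" "tau k \<noteq> 2" using k by (auto simp: tau_def)
    define n where
      "n = (\<lambda>i::nat. if i = tau k then 1 else if i = 2 then [:- coeff (g (tau k)) 0:] else 0)"
    define s where "s = (\<Sum>i<4. n i * g i)"
    have n_Sdeg: "n i \<in> Sdeg (int d - int (e i))" if "i < 4" for i
      using e_le[OF that] Sdeg_const[of "int d - int (e i)" 1]
      by (auto simp: n_def one_pCons intro: Sdeg_const)
    have s: "s = g (tau k) - [:coeff (g (tau k)) 0:]"
    proof -
      consider "tau k = 0" | "tau k = 1" | "tau k = 3" 
        using k by (auto simp: tau_def less_Suc_eq numeral_3_eq_3 numeral_2_eq_2)
      then show ?thesis by cases (simp_all add: s_def n_def sum4 g2)
    qed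
    have "s \<in> Sdeg (int d)"
      unfolding s_def
    proof (rule Sdeg_sum)
      fix i :: nat assume "i \<in> {..<4}"
      then show "n i * g i \<in> Sdeg (int d)"
        using Sdeg_mult[OF n_Sdeg g_Sdeg, of i i] by simp
    qed
    moreover obtain s' where s': "s = pCons 0 s'"
      using s by (metis coeff_diff coeff_pCons_0 pCons_cases right_minus_eq)
    ultimately have "s' \<in> Sdeg (int d - 1)" by (simp add: Sdeg_pCons_iff)
    then obtain m where m: "\<And>i. i < 4 \<Longrightarrow> m i \<in> Sdeg (int d - 1 - int (e i))"
      "(\<Sum>i<4. m i * g i) = s'"
      using assms unfolding gens_surj_def by blast
    define U where "U = (\<lambda>i. n i - pCons 0 (m i))"
    have "(\<Sum>i<4. U i * g i) = 0"
      using m(2) s' unfolding s_def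
      by (simp add: U_def algebra_simps sum_subtractf mult_pCons_left flip: m(2))
         (simp add: sum4)
    moreover have "U i \<in> Sdeg (int d - int (e i))" if "i < 4" for i
      unfolding U_def using m(1)[OF that] n_Sdeg[OF that]
      by (intro Sdeg_diff) (auto simp: Sdeg_pCons_iff algebra_simps)
    ultimately have "U \<in> line_syz (int d)" by (simp add: line_syz_def)
    moreover have "coeff (U (tau j)) 0 = (if j = k then 1 else 0)" if "j < 3" for j
      using that k by (auto simp: U_def n_def tau_def)
    ultimately show ?thesis by blast
  qed
  then obtain U where "\<forall>k<3. U k \<in> line_syz (int d) \<and>
     (\<forall>j<3. coeff (U k (tau j)) 0 = (if j = k then 1 else 0))" by metis
  then show ?thesis by (auto simp: syz_basis_def)
qed

text \<open>
  Evaluating at \<open>X = 0\<close> kills the constant coefficients; divide by \<open>X\<close> and repeat.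
\<close>

lemma syz_basis_independent:
  assumes U: "syz_basis U" and p: "\<And>i. i < 4 \<Longrightarrow> (\<Sum>k<3. p k * U k i) = 0" and "k < 3"
  shows "p k = 0"
proof (rule poly_eqI)
  fix n
  have "\<forall>k<3. coeff (p k) n = 0" using p
  proof (induction n arbitrary: p)
    have at_zero: "\<forall>k<3. coeff (p k) 0 = 0" if "\<And>i. i < 4 \<Longrightarrow> (\<Sum>k<3. p k * U k i) = 0" for p
    proof (intro allI impI)
      fix j :: nat assume j: "j < 3"
      then have "tau j < 4" by (simp add: tau_def)
      from that[OF this] have "coeff (\<Sum>k<3. p k * U k (tau j)) 0 = 0" by simp
      then have "(\<Sum>k<3. coeff (p k) 0 * coeff (U k (tau j)) 0) = 0"
        by (simp add: coeff_sum coeff_mult_0)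
      also have "(\<Sum>k<3. coeff (p k) 0 * coeff (U k (tau j)) 0) =
          (\<Sum>k<3. if k = j then coeff (p k) 0 else 0)"
        using U j by (intro sum.cong) (auto simp: syz_basis_def)
      finally show "coeff (p j) 0 = 0" using j by (simp add: sum.delta)
    qed
    case 0
    then show ?case by (rule at_zero)
    case (Suc n)
    define q where "q = (\<lambda>k. poly_shift 1 (p k))"
    have pq: "p k = pCons 0 (q k)" if "k < 3" for k
    proof -
      have "coeff (p k) 0 = 0" using at_zero[OF Suc.prems] that by blast
      then show ?thesis
        by (intro poly_eqI) (auto simp: q_def coeff_poly_shift coeff_pCons split: nat.splits)
    qed
    have "(\<Sum>k<3. q k * U k i) = 0" if "i < 4" for i
    proof -
      have "(\<Sum>k<3. p k * U k i) = pCons 0 (\<Sum>k<3. q k * U k i)"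
        by (simp add: sum3 pq)
      then show ?thesis using Suc.prems[OF that] by simp
    qed
    then have "\<forall>k<3. coeff (q k) n = 0" by (rule Suc.IH)
    then show ?case using pq by simp
  qed
  then show "coeff (p k) n = coeff 0 n" using \<open>k < 3\<close> by simp
qed

text \<open>
  Subtracting the combination of the basis with the same value at \<open>X = 0\<close> makes a relation divisible
  by \<open>X\<close>, and the quotient is a relation of smaller degree. The descent ends in degree \<open>d - 1\<close>, where
  there is no relation left.
\<close>

lemma syz_basis_generates:
  assumes U: "syz_basis U" and inj: "gens_inj (int d - 1)" and n: "n \<in> line_syz j"
  shows "\<exists>p. (\<forall>k<3. p k \<in> Sdeg (j - int d)) \<and> (\<forall>i<4. n i = (\<Sum>k<3. p k * U k i))"
proof -
  have "n \<in> line_syz j \<Longrightarrow> j \<le> int d - 1 + int m \<Longrightarrow>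
    \<exists>p. (\<forall>k<3. p k \<in> Sdeg (j - int d)) \<and> (\<forall>i<4. n i = (\<Sum>k<3. p k * U k i))"
    for m
  proof (induction m arbitrary: n j)
    case 0
    then have "n \<in> line_syz (int d - 1)" by (auto intro: line_syz_mono)
    then have "\<forall>i<4. n i = 0" using inj by (auto simp: gens_inj_def)
    then show ?case by (intro exI[of _ "\<lambda>_. 0"]) auto
  next
    case (Suc m)
    show ?case
    proof (cases "j \<le> int d - 1 + int m")
      case True
      then show ?thesis using Suc by blast
    next
      case False
      then have jd: "int d \<le> j" by simp
      define c where "c = (\<lambda>k. coeff (n (tau k)) 0)"
      define n' where "n' = (\<lambda>i. n i - (\<Sum>k<3. [:c k:] * U k i))"
      have n'_deg: "n' i \<in> Sdeg (j - int (e i))" if "i < 4" for i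
        unfolding n'_def
      proof (intro Sdeg_diff Sdeg_sum)
        show "n i \<in> Sdeg (j - int (e i))" using Suc.prems that by (auto simp: line_syz_def)
        fix k :: nat assume "k \<in> {..<3}"
        then have "U k i \<in> Sdeg (int d - int (e i))"
          using U that by (auto simp: syz_basis_def line_syz_def)
        then show "[:c k:] * U k i \<in> Sdeg (j - int (e i))"
          using jd by (auto intro!: Sdeg_smult elim: Sdeg_mono)
      qed
      have n'_rel: "(\<Sum>i<4. n' i * g i) = 0"
      proof -
        have "(\<Sum>i<4. n' i * g i) =
            (\<Sum>i<4. n i * g i) - (\<Sum>i<4. \<Sum>k<3. [:c k:] * U k i * g i)"
          by (simp add: n'_def left_diff_distrib sum_subtractf sum_distrib_right)
        also have "(\<Sum>i<4. \<Sum>k<3. [:c k:] * U k i * g i) =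
            (\<Sum>k<3. [:c k:] * (\<Sum>i<4. U k i * g i))"
          by (subst sum.swap) (simp add: sum_distrib_left mult.assoc)
        also have "\<dots> = 0"
          using U by (auto simp: syz_basis_def line_syz_def intro!: sum.neutral)
        finally show ?thesis using Suc.prems by (simp add: line_syz_def)
      qed
      have c0_tau: "coeff (n' (tau k)) 0 = 0" if "k < 3" for k
      proof -
        have "coeff (n' (tau k)) 0 = c k - (\<Sum>k'<3. c k' * coeff (U k' (tau k)) 0)"
          by (simp add: n'_def coeff_sum c_def)
        also have "(\<Sum>k'<3. c k' * coeff (U k' (tau k)) 0) = (\<Sum>k'<3. if k' = k then c k' else 0)"
          using U that by (intro sum.cong) (auto simp: syz_basis_def)
        finally show ?thesis using that by (simp add: sum.delta)
      qed
      have c0_1: "coeff (n' 0) 0 = 0" "coeff (n' 1) 0 = 0" "coeff (n' 3) 0 = 0"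
        using c0_tau[of 0] c0_tau[of 1] c0_tau[of 2] by (auto simp: tau_def)
      have "coeff (\<Sum>i<4. n' i * g i) 0 = 0" using n'_rel by simp
      then have "coeff (n' 2) 0 = 0"
        using c0_1 by (simp add: sum4 g2 coeff_mult_0)
      then have c0: "\<forall>i<4. coeff (n' i) 0 = 0" using c0_1 by (simp add: all4)
      define n2 where "n2 = (\<lambda>i. poly_shift 1 (n' i))"
      have n2: "n' i = pCons 0 (n2 i)" if "i < 4" for i
        using c0 that
        by (intro poly_eqI) (auto simp: n2_def coeff_poly_shift coeff_pCons split: nat.splits)
      have "n2 \<in> line_syz (j - 1)"
        unfolding line_syz_def
      proof (intro CollectI conjI allI impI)
        fix i :: nat assume "i < 4"
        then show "n2 i \<in> Sdeg (j - 1 - int (e i))"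
          using n'_deg[of i] n2[of i] by (simp add: Sdeg_pCons_iff algebra_simps)
      next
        have "(\<Sum>i<4. n' i * g i) = pCons 0 (\<Sum>i<4. n2 i * g i)"
          by (simp add: sum4 n2)
        then show "(\<Sum>i<4. n2 i * g i) = 0" using n'_rel by simp
      qed
      moreover have "j - 1 \<le> int d - 1 + int m" using Suc.prems by simp
      ultimately obtain p where p: "\<forall>k<3. p k \<in> Sdeg (j - 1 - int d)"
        "\<forall>i<4. n2 i = (\<Sum>k<3. p k * U k i)"
        using Suc.IH by blast
      have "n i = (\<Sum>k<3. pCons (c k) (p k) * U k i)" if "i < 4" for i
      proof -
        have "n i = pCons 0 (n2 i) + (\<Sum>k<3. [:c k:] * U k i)"
          using n2[OF that] by (simp add: n'_def algebra_simps)
        then show ?thesis using p(2) that by (simp add: sum3)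
      qed
      moreover have "\<forall>k<3. pCons (c k) (p k) \<in> Sdeg (j - int d)"
        using p(1) jd by (simp add: Sdeg_pCons_iff algebra_simps)
      ultimately show ?thesis by (intro exI[of _ "\<lambda>k. pCons (c k) (p k)"]) blast
    qed
  qed
  from this[of "nat (j - int d + 1)"] show ?thesis using n by simp
qed

end

section \<open>Square systems of linear equations\<close>

text \<open>
  Injectivity and surjectivity of a square matrix over arbitrary finite index sets, with the
  determinant taken along chosen enumerations.
\<close>

lemma square_system_det:
  fixes T :: "'a \<Rightarrow> 'b \<Rightarrow> 'k::field"
  assumes fa: "bij_betw fa {..<n} A" and fb: "bij_betw fb {..<n} B"
  defines "M \<equiv> mat n n (\<lambda>(i, j). T (fa i) (fb j))"
  shows
      "det M \<noteq> 0 \<longleftrightarrow>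
        (\<forall>v. (\<forall>b\<in>B. (\<Sum>a\<in>A. v a * T a b) = 0) \<longrightarrow> (\<forall>a\<in>A. v a = 0))" (is ?inj)
    and
      "det M \<noteq> 0 \<longleftrightarrow> (\<forall>w. \<exists>v. \<forall>b\<in>B. (\<Sum>a\<in>A. v a * T a b) = w b)" (is ?surj)
proof -
  define N where "N = transpose_mat M"
  have M: "M \<in> carrier_mat n n" and N: "N \<in> carrier_mat n n" by (auto simp: M_def N_def)
  have det: "det N = det M" using det_transpose[OF M] by (simp add: N_def)
  have Nv: "(N *\<^sub>v v) $ j = (\<Sum>i<n. v $ i * T (fa i) (fb j))"
    if "j < n" "v \<in> carrier_vec n" for v j
    using that by (auto simp: N_def M_def scalar_prod_def lessThan_atLeast0 mult.commute)
  have sumA: "(\<Sum>a\<in>A. h a) = (\<Sum>i<n. h (fa i))" for h :: "'a \<Rightarrow> 'k"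
    using sum.reindex_bij_betw[OF fa, of h] by simp
  have A: "A = fa ` {..<n}" and B: "B = fb ` {..<n}"
    using fa fb by (auto simp: bij_betw_def)
  have inj_fa: "inj_on fa {..<n}" and inj_fb: "inj_on fb {..<n}"
    using fa fb by (auto simp: bij_betw_def)
  show ?inj
  proof (rule iffI; clarify)
    fix v a assume det0: "det M \<noteq> 0" and v: "\<forall>b\<in>B. (\<Sum>a\<in>A. v a * T a b) = 0" and a: "a \<in> A"
    let ?v = "vec n (\<lambda>i. v (fa i))"
    have "N *\<^sub>v ?v = 0\<^sub>v n"
      using v N by (intro eq_vecI) (auto simp: Nv sumA B simp del: index_mult_mat_vec)
    then have "?v = 0\<^sub>v n"
      using det0 det_0_iff_vec_prod_zero_field[OF N] vec_carrier[of n "\<lambda>i. v (fa i)"]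
      unfolding det by blast
    moreover obtain i where "i < n" "a = fa i" using a by (auto simp: A)
    ultimately show "v a = 0" by (metis index_vec index_zero_vec(1))
  next
    assume inj: "\<forall>v. (\<forall>b\<in>B. (\<Sum>a\<in>A. v a * T a b) = 0) \<longrightarrow> (\<forall>a\<in>A. v a = 0)"
      and "det M = 0"
    then obtain x where x: "x \<in> carrier_vec n" "x \<noteq> 0\<^sub>v n" "N *\<^sub>v x = 0\<^sub>v n"
      using det_0_iff_vec_prod_zero_field[OF N] by (auto simp: det)
    define v where "v = (\<lambda>a. x $ the_inv_into {..<n} fa a)"
    have v: "v (fa i) = x $ i" if "i < n" for i
      using that inj_fa by (simp add: v_def the_inv_into_f_f)
    have "(\<Sum>a\<in>A. v a * T a b) = 0" if b: "b \<in> B" for b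
    proof -
      obtain j where j: "j < n" "b = fb j" using b by (auto simp: B)
      have "(N *\<^sub>v x) $ j = 0" using x j by simp
      then show ?thesis using Nv[OF j(1) x(1)] by (simp add: sumA v j)
    qed
    then have "\<forall>a\<in>A. v a = 0" using inj by blast
    then have "x = 0\<^sub>v n" using x(1) v by (intro eq_vecI) (auto simp: A)
    then show False using x by simp
  qed
  show ?surj
  proof (rule iffI; clarify)
    fix w :: "'b \<Rightarrow> 'k" assume det0: "det M \<noteq> 0"
    let ?w = "vec n (\<lambda>j. w (fb j))"
    define x where "x = (1 / det N) \<cdot>\<^sub>v (adj_mat N *\<^sub>v ?w)"
    have x: "x \<in> carrier_vec n" using adj_mat(1)[OF N] by (auto simp: x_def)
    have "N *\<^sub>v (adj_mat N *\<^sub>v ?w) = (N * adj_mat N) *\<^sub>v ?w"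
      using N adj_mat(1)[OF N] by (simp add: assoc_mult_mat_vec)
    also have "\<dots> = det N \<cdot>\<^sub>v ?w"
      by (intro eq_vecI) (auto simp: adj_mat(2)[OF N] scalar_prod_def one_mat_def if_distrib
          if_distribR sum.delta cong: if_cong)
    finally have "N *\<^sub>v x = ?w"
      using det0 N adj_mat(1)[OF N]
      by (simp add: x_def mult_mat_vec[of _ n n] smult_smult_assoc det)
    define v where "v = (\<lambda>a. x $ the_inv_into {..<n} fa a)"
    have v: "v (fa i) = x $ i" if "i < n" for i
      using that inj_fa by (simp add: v_def the_inv_into_f_f)
    have "(\<Sum>a\<in>A. v a * T a b) = w b" if b: "b \<in> B" for b
    proof -
      obtain j where j: "j < n" "b = fb j" using b by (auto simp: B)
      then show ?thesis using Nv[OF j(1) x] \<open>N *\<^sub>v x = ?w\<close> by (simp add: sumA v)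
    qed
    then show "\<exists>v. \<forall>b\<in>B. (\<Sum>a\<in>A. v a * T a b) = w b" by blast
  next
    assume surj: "\<forall>w. \<exists>v. \<forall>b\<in>B. (\<Sum>a\<in>A. v a * T a b) = w b" and det0: "det M = 0"
    have "\<exists>v. \<forall>b\<in>B. (\<Sum>a\<in>A. v a * T a b) = (if b = fb k then 1 else 0)" for k
      using spec[OF surj, of "\<lambda>b. if b = fb k then 1 else 0"] by simp
    then obtain v where v: "\<And>k. \<forall>b\<in>B. (\<Sum>a\<in>A. v k a * T a b) = (if b = fb k then 1 else 0)"
      by metis
    define X where "X = mat n n (\<lambda>(i, k). v k (fa i))"
    have X: "X \<in> carrier_mat n n" by (simp add: X_def)
    have "N * X = 1\<^sub>m n"
    proof (rule eq_matI)
      fix j k assume "j < dim_row (1\<^sub>m n)" "k < dim_col (1\<^sub>m n)"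
      then have jk: "j < n" "k < n" by auto
      have "(N * X) $$ (j, k) = (\<Sum>i<n. v k (fa i) * T (fa i) (fb j))"
        using jk by (simp add: N_def M_def X_def scalar_prod_def lessThan_atLeast0 mult.commute)
      also have "\<dots> = (if fb j = fb k then 1 else 0)"
        using v[of k] jk by (simp add: sumA B)
      also have "\<dots> = 1\<^sub>m n $$ (j, k)"
        using jk inj_fb by (auto simp: inj_on_def)
      finally show "(N * X) $$ (j, k) = 1\<^sub>m n $$ (j, k)" .
    qed (use N X in auto)
    then have "det N * det X = 1" using det_mult[OF N X] by simp
    then show False using det0 by (simp add: det)
  qed
qed

corollary square_system:
  fixes T :: "'a \<Rightarrow> 'b \<Rightarrow> 'k::field"
  assumes "finite A" "finite B" "card A = card B"
  shows "(\<forall>v. (\<forall>b\<in>B. (\<Sum>a\<in>A. v a * T a b) = 0) \<longrightarrow> (\<forall>a\<in>A. v a = 0)) \<longleftrightarrow>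
         (\<forall>w. \<exists>v. \<forall>b\<in>B. (\<Sum>a\<in>A. v a * T a b) = w b)"
proof -
  obtain fa fb where "bij_betw fa {..<card A} A" "bij_betw fb {..<card A} B"
    using assms ex_bij_betw_nat_finite[of A] ex_bij_betw_nat_finite[of B]
    by (auto simp: lessThan_atLeast0)
  from square_system_det[OF this, of T] show ?thesis by simp
qed

lemma Sdeg_eq_sum_monom:
  assumes "s \<in> Sdeg (int m - 1)"
  shows "s = (\<Sum>k<m. monom (coeff s k) k)"
proof (rule poly_eqI)
  fix n
  have "coeff (\<Sum>k<m. monom (coeff s k) k) n = (if n < m then coeff s n else 0)"
    by (simp add: coeff_sum sum.delta')
  then show "coeff s n = coeff (\<Sum>k<m. monom (coeff s k) k) n"
    using assms by (auto simp: Sdeg_def)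
qed

text \<open>
  The tuples of coefficients in degree \<open>d - 1\<close> form a space of dimension \<open>\<Sum>(d - e\<^sub>i) = 4 d - 3 d = d\<close>,
  which is also the dimension of \<open>Sdeg (d - 1)\<close>.
\<close>

lemma (in line_generators) gens_inj_iff_surj:
  assumes sum_e: "(\<Sum>i<4. e i) = 3 * d"
  shows "gens_inj (int d - 1) \<longleftrightarrow> gens_surj (int d - 1)"
proof -
  define A where "A = Sigma {..<4::nat} (\<lambda>i. {..<d - e i})"
  define T where "T = (\<lambda>(i, k) b. coeff (monom 1 k * g i) b)"
  \<comment> \<open>The tuple of polynomials with the coefficient vector \<open>v\<close>.\<close>
  define P where "P = (\<lambda>v i. \<Sum>k<d - e i. monom (v (i, k) :: 'k) k)"
  have deg_eq: "int d - 1 - int (e i) = int (d - e i) - 1" if "i < 4" for i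
    using e_le[OF that] by simp
  have card: "card A = card {..<d}"
  proof -
    have "card A = (\<Sum>i<4. d - e i)" by (simp add: A_def)
    also have "\<dots> = d"
      using sum_e e_le[of 0] e_le[of 1] e_le[of 2] e_le[of 3] by (simp add: sum4)
    finally show ?thesis by simp
  qed
  have P_Sdeg: "P v i \<in> Sdeg (int d - 1 - int (e i))" if "i < 4" for v i
    using e_le[OF that] by (auto simp: P_def intro!: Sdeg_sum Sdeg_monom)
  have P_coeff: "coeff (P v i) k = v (i, k)" if "(i, k) \<in> A" for v i k
    using that by (simp add: P_def A_def coeff_sum sum.delta')
  have P_inv: "n i = P (\<lambda>(i, k). coeff (n i) k) i"
    if "n i \<in> Sdeg (int d - 1 - int (e i))" "i < 4" for n :: "nat \<Rightarrow> 'k poly" and i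
  proof -
    have "n i \<in> Sdeg (int (d - e i) - 1)" using that deg_eq[of i] by metis
    from Sdeg_eq_sum_monom[OF this] show ?thesis by (simp add: P_def)
  qed
  have P_sum: "(\<Sum>a\<in>A. v a * T a b) = coeff (\<Sum>i<4. P v i * g i) b" for v b
  proof -
    have "(\<Sum>a\<in>A. v a * T a b) = (\<Sum>i<4. \<Sum>k<d - e i. v (i, k) * T (i, k) b)"
      unfolding A_def by (subst sum.Sigma) auto
    also have "\<dots> = coeff (\<Sum>i<4. P v i * g i) b"
      unfolding P_def sum_distrib_right coeff_sum
    proof (intro sum.cong refl)
      fix i k
      have "monom (v (i, k)) k = smult (v (i, k)) (monom 1 k)" by (simp add: smult_monom)
      then show "v (i, k) * T (i, k) b = coeff (monom (v (i, k)) k * g i) b"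
        by (simp add: T_def)
    qed
    finally show ?thesis .
  qed
  have P_sum_Sdeg: "(\<Sum>i<4. P v i * g i) \<in> Sdeg (int d - 1)" for v
  proof (rule Sdeg_sum)
    fix i :: nat assume "i \<in> {..<4}"
    then show "P v i * g i \<in> Sdeg (int d - 1)"
      using Sdeg_mult[OF P_Sdeg g_Sdeg, of i i v] by simp
  qed
  have Sdeg_eq_iff: "s = t \<longleftrightarrow> (\<forall>b<d. coeff s b = coeff t b)"
    if "s \<in> Sdeg (int d - 1)" "t \<in> Sdeg (int d - 1)" for s t :: "'k poly"
  proof
    assume *: "\<forall>b<d. coeff s b = coeff t b"
    show "s = t"
    proof (rule poly_eqI)
      fix b show "coeff s b = coeff t b"
        using * that by (cases "b < d") (auto simp: Sdeg_def)
    qed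
  qed simp
  have inj: "gens_inj (int d - 1) \<longleftrightarrow>
      (\<forall>v. (\<forall>b\<in>{..<d}. (\<Sum>a\<in>A. v a * T a b) = 0) \<longrightarrow> (\<forall>a\<in>A. v a = 0))"
  proof (intro iffI allI impI ballI)
    fix v a assume inj: "gens_inj (int d - 1)" and a: "a \<in> A"
      and v: "\<forall>b\<in>{..<d}. (\<Sum>a\<in>A. v a * T a b) = 0"
    have "(\<Sum>i<4. P v i * g i) = 0"
      using v P_sum_Sdeg[of v] by (subst Sdeg_eq_iff) (auto simp: P_sum)
    then have "P v \<in> line_syz (int d - 1)" using P_Sdeg by (auto simp: line_syz_def)
    then have "\<forall>i<4. P v i = 0" using inj by (auto simp: gens_inj_def)
    moreover obtain i k where "a = (i, k)" by (cases a)
    ultimately show "v a = 0" using P_coeff[of i k v] a by (auto simp: A_def)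
  next
    assume *: "\<forall>v. (\<forall>b\<in>{..<d}. (\<Sum>a\<in>A. v a * T a b) = 0) \<longrightarrow> (\<forall>a\<in>A. v a = 0)"
    show "gens_inj (int d - 1)"
      unfolding gens_inj_def
    proof (intro ballI allI impI)
      fix n i assume n: "n \<in> line_syz (int d - 1)" and i: "i < (4::nat)"
      let ?v = "\<lambda>(i, k). coeff (n i) k"
      have n_eq: "n i = P ?v i" if "i < 4" for i
        using n that by (intro P_inv) (auto simp: line_syz_def)
      then have "(\<Sum>i<4. P ?v i * g i) = 0" using n by (simp add: line_syz_def)
      then have "\<forall>a\<in>A. ?v a = 0" using * by (simp add: P_sum)
      then have "P ?v i = 0" using i by (auto simp: P_def A_def intro!: sum.neutral)
      then show "n i = 0" using n_eq[OF i] by simp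
    qed
  qed
  have surj: "gens_surj (int d - 1) \<longleftrightarrow>
      (\<forall>w. \<exists>v. \<forall>b\<in>{..<d}. (\<Sum>a\<in>A. v a * T a b) = w b)"
  proof (intro iffI allI)
    fix w :: "nat \<Rightarrow> 'k" assume surj: "gens_surj (int d - 1)"
    define s where "s = (\<Sum>b<d. monom (w b) b)"
    have s: "s \<in> Sdeg (int d - 1)" "\<And>b. b < d \<Longrightarrow> coeff s b = w b"
      by (auto simp: s_def coeff_sum sum.delta' intro!: Sdeg_sum Sdeg_monom)
    obtain n where n: "\<And>i. i < 4 \<Longrightarrow> n i \<in> Sdeg (int d - 1 - int (e i))"
      "(\<Sum>i<4. n i * g i) = s"
      using surj s(1) unfolding gens_surj_def by blast
    let ?v = "\<lambda>(i, k). coeff (n i) k"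
    have "(\<Sum>i<4. P ?v i * g i) = s"
      using n P_inv[of n] by simp
    then have "\<forall>b\<in>{..<d}. (\<Sum>a\<in>A. ?v a * T a b) = w b" using s(2) by (simp add: P_sum)
    then show "\<exists>v. \<forall>b\<in>{..<d}. (\<Sum>a\<in>A. v a * T a b) = w b" by blast
  next
    assume *: "\<forall>w. \<exists>v. \<forall>b\<in>{..<d}. (\<Sum>a\<in>A. v a * T a b) = w b"
    show "gens_surj (int d - 1)"
      unfolding gens_surj_def
    proof
      fix s :: "'k poly" assume s: "s \<in> Sdeg (int d - 1)"
      obtain v where "\<forall>b\<in>{..<d}. (\<Sum>a\<in>A. v a * T a b) = coeff s b" using * by blast
      then have "(\<Sum>i<4. P v i * g i) = s"
        using P_sum_Sdeg[of v] s by (subst Sdeg_eq_iff) (auto simp: P_sum)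
      then show "\<exists>k. (\<forall>i<4. k i \<in> Sdeg (int d - 1 - int (e i))) \<and> (\<Sum>i<4. k i * g i) = s"
        using P_Sdeg by blast
    qed
  qed
  show ?thesis
    unfolding inj surj by (rule square_system) (use card in \<open>auto simp: A_def\<close>)
qed

section \<open>Multiplication by a linear form modulo a monomial ideal\<close>

lemma homog_linear_mult: "l \<in> homog 1 \<Longrightarrow> p \<in> homog j \<Longrightarrow> l * p \<in> homog (j + 1)"
  using homog_mult[of l 1 p j] by (simp add: add.commute)

definition mult_inj :: "'k::field poly3 set \<Rightarrow> 'k poly3 \<Rightarrow> int \<Rightarrow> bool" where
  "mult_inj I l j \<longleftrightarrow> (\<forall>p\<in>homog j. l * p \<in> I \<longrightarrow> p \<in> I)"

definition mult_surj :: "'k::field poly3 set \<Rightarrow> 'k poly3 \<Rightarrow> int \<Rightarrow> bool" where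
  "mult_surj I l j \<longleftrightarrow> (\<forall>q\<in>homog (j + 1). \<exists>p\<in>homog j. q - l * p \<in> I)"

lemma residue_eq_iff:
  "residue (monomial_ideal G) p = residue (monomial_ideal G) q \<longleftrightarrow> p - q \<in> monomial_ideal G"
proof
  assume "residue (monomial_ideal G) p = residue (monomial_ideal G) q"
  moreover have "p \<in> residue (monomial_ideal G) p" by (simp add: residue_def)
  ultimately show "p - q \<in> monomial_ideal G" by (simp add: residue_def)
next
  assume pq: "p - q \<in> monomial_ideal G"
  have "r - p \<in> monomial_ideal G \<longleftrightarrow> r - q \<in> monomial_ideal G" for r
    using monomial_ideal_add[OF _ pq, of "r - p"] monomial_ideal_diff[OF _ pq, of "r - q"]
    by auto
  then show "residue (monomial_ideal G) p = residue (monomial_ideal G) q"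
    by (simp add: residue_def)
qed

lemma quot_mult_residue:
  "quot_mult (monomial_ideal G) l (residue (monomial_ideal G) p) =
     residue (monomial_ideal G) (l * p)"
proof -
  have "residue (monomial_ideal G) (l * q) = residue (monomial_ideal G) (l * p)"
    if "q \<in> residue (monomial_ideal G) p" for q
    using that monomial_ideal_mult[of "q - p" G l]
    unfolding residue_eq_iff by (simp add: residue_def right_diff_distrib)
  moreover have "p \<in> residue (monomial_ideal G) p" by (simp add: residue_def)
  ultimately show ?thesis unfolding quot_mult_def by blast
qed

lemma quot_mult_inj_iff:
  "inj_on (quot_mult (monomial_ideal G) l) (quot_piece (monomial_ideal G) j) \<longleftrightarrow>
     mult_inj (monomial_ideal G) l j" (is "?L \<longleftrightarrow> ?R")
proof
  assume inj: ?L
  show ?R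
    unfolding mult_inj_def
  proof (intro ballI impI)
    fix p assume p: "p \<in> homog j" "l * p \<in> monomial_ideal G"
    then have "quot_mult (monomial_ideal G) l (residue (monomial_ideal G) p) =
        quot_mult (monomial_ideal G) l (residue (monomial_ideal G) 0)"
      by (simp add: quot_mult_residue residue_eq_iff)
    then have "residue (monomial_ideal G) p = residue (monomial_ideal G) 0"
      using inj p by (auto simp: quot_piece_def dest: inj_onD)
    then show "p \<in> monomial_ideal G" by (simp add: residue_eq_iff)
  qed
next
  assume R: ?R
  show ?L
  proof (rule inj_onI)
    fix C D assume "C \<in> quot_piece (monomial_ideal G) j" "D \<in> quot_piece (monomial_ideal G) j"
      and eq: "quot_mult (monomial_ideal G) l C = quot_mult (monomial_ideal G) l D"
    then obtain p q where pq: "p \<in> homog j" "q \<in> homog j"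
      "C = residue (monomial_ideal G) p" "D = residue (monomial_ideal G) q"
      by (auto simp: quot_piece_def)
    then have "l * (p - q) \<in> monomial_ideal G"
      using eq by (simp add: quot_mult_residue residue_eq_iff right_diff_distrib)
    then have "p - q \<in> monomial_ideal G"
      using R pq homog_diff unfolding mult_inj_def by blast
    then show "C = D" by (simp add: pq residue_eq_iff)
  qed
qed

lemma quot_mult_surj_iff:
  assumes "l \<in> homog 1"
  shows "quot_mult (monomial_ideal G) l ` quot_piece (monomial_ideal G) j =
      quot_piece (monomial_ideal G) (j + 1) \<longleftrightarrow> mult_surj (monomial_ideal G) l j" (is "?L \<longleftrightarrow> ?R")
proof -
  have image: "quot_mult (monomial_ideal G) l ` quot_piece (monomial_ideal G) j =
      (\<lambda>p. residue (monomial_ideal G) (l * p)) ` homog j"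
    by (simp add: quot_piece_def image_image quot_mult_residue)
  have sub: "(\<lambda>p. residue (monomial_ideal G) (l * p)) ` homog j \<subseteq>
      quot_piece (monomial_ideal G) (j + 1)"
    using homog_linear_mult[OF assms] by (auto simp: quot_piece_def)
  have "?L \<longleftrightarrow> quot_piece (monomial_ideal G) (j + 1) \<subseteq>
      (\<lambda>p. residue (monomial_ideal G) (l * p)) ` homog j"
    unfolding image using sub by blast
  also have "\<dots> \<longleftrightarrow> ?R"
    unfolding mult_surj_def quot_piece_def residue_eq_iff[symmetric] by blast
  finally show ?thesis .
qed

corollary weak_lefschetz_monomial_ideal:
  "weak_lefschetz (monomial_ideal G :: 'k::field poly3 set) \<longleftrightarrow>
     (\<exists>l\<in>homog 1 :: 'k poly3 set. \<forall>j. mult_inj (monomial_ideal G) l j \<or> mult_surj (monomial_ideal G) l j)"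
  unfolding weak_lefschetz_def
  by (rule bex_cong) (auto simp: quot_mult_inj_iff quot_mult_surj_iff)

text \<open>
  The quotient is generated in degree one: an element of degree \<open>j + 2\<close> is a combination of variables
  with coefficients of degree \<open>j + 1\<close>, all of which are multiples of \<open>l\<close>.
\<close>

lemma mult_surj_step:
  assumes surj: "mult_surj (monomial_ideal G) l j" and j: "j + 1 \<ge> 0"
  shows "mult_surj (monomial_ideal G) l (j + 1)"
  unfolding mult_surj_def
proof
  fix q :: "'a poly3" assume q: "q \<in> homog (j + 1 + 1)"
  then obtain r where r: "\<And>v. r v \<in> homog (j + 1)" "q = (\<Sum>v\<in>UNIV. Var v * r v)"
    using homog_Var_decomp[OF q] j by (metis add.commute add_diff_cancel_left' zle_add1_eq_le zless_add1_eq)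
  have "\<forall>v. \<exists>p. p \<in> homog j \<and> r v - l * p \<in> monomial_ideal G"
    using surj r(1) unfolding mult_surj_def by blast
  then have "\<exists>p. \<forall>v. p v \<in> homog j \<and> r v - l * p v \<in> monomial_ideal G"
    by (rule choice)
  then obtain p where p: "\<And>v. p v \<in> homog j" "\<And>v. r v - l * p v \<in> monomial_ideal G"
    by blast
  let ?p = "\<Sum>v\<in>UNIV. Var v * p v"
  have "q - l * ?p = (\<Sum>v\<in>UNIV. Var v * (r v - l * p v))"
    by (simp add: r(2) sum_distrib_left right_diff_distrib sum_subtractf mult.left_commute[of l])
  also have "\<dots> \<in> monomial_ideal G"
    by (intro monomial_ideal_sum monomial_ideal_mult p)
  finally have "q - l * ?p \<in> monomial_ideal G" .
  moreover have "?p \<in> homog (j + 1)"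
    using p(1) by (intro homog_sum homog_mult'[OF homog_Var]) auto
  ultimately show "\<exists>p\<in>homog (j + 1). q - l * p \<in> monomial_ideal G" by blast
qed

text \<open>
  An element of the kernel in degree \<open>j\<close> is killed by every variable once the next map is
  injective. Such an element lies in the socle, which a monomial ideal lets one test on monomials.
\<close>

lemma mult_inj_step:
  assumes inj: "mult_inj (monomial_ideal G) l (j + 1)"
    and socle: "\<And>m. int (tdeg m) = j \<Longrightarrow> \<not> (\<exists>g\<in>set G. divides g m) \<Longrightarrow>
       \<exists>v. \<not> (\<exists>g\<in>set G. divides g (Poly_Mapping.single v 1 + m))"
  shows "mult_inj (monomial_ideal G) l j"
  unfolding mult_inj_def
proof (intro ballI impI)
  fix p assume p: "p \<in> homog j" "l * p \<in> monomial_ideal G"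
  have var: "Var v * p \<in> monomial_ideal G" for v
  proof -
    have "l * (Var v * p) \<in> monomial_ideal G"
      using monomial_ideal_mult[OF p(2), of "Var v"]
      by (simp only: mult.left_commute[of l "Var v" p])
    then show ?thesis
      by (rule inj[unfolded mult_inj_def, rule_format, OF homog_linear_mult[OF homog_Var p(1)]])
  qed
  show "p \<in> monomial_ideal G"
    unfolding monomial_ideal_def
  proof (intro CollectI ballI, rule ccontr)
    fix m assume m: "m \<in> Poly_Mapping.keys p" "\<not> (\<exists>g\<in>set G. divides g m)"
    have "int (tdeg m) = j" using p(1) m(1) by (simp add: homog_def)
    from socle[OF this m(2)]
    obtain v where v: "\<not> (\<exists>g\<in>set G. divides g (Poly_Mapping.single v 1 + m))"
      by blast
    have "Poly_Mapping.lookup (Var v * p) (Poly_Mapping.single v 1 + m) = Poly_Mapping.lookup p m"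
      by (simp add: Var_def single_times_lookup)
    then have "Poly_Mapping.single v 1 + m \<in> Poly_Mapping.keys (Var v * p)"
      using m(1) by (simp add: in_keys_iff)
    then show False using var[of v] v by (auto simp: monomial_ideal_def)
  qed
qed

lemma std_monoms_eq:
  "std_monoms (monomial_ideal G :: 'k::field poly3 set) j =
     {m. int (tdeg m) = j \<and> \<not> (\<exists>g\<in>set G. divides g m)}"
  by (simp add: std_monoms_def monomial_ideal_single)

lemma finite_tdeg: "finite {m. tdeg m = n}"
proof (rule finite_subset)
  show "{m. tdeg m = n} \<subseteq> (\<lambda>(i, j, k). mon i j k) ` ({..n} \<times> {..n} \<times> {..n})"
  proof
    fix m assume m: "m \<in> {m. tdeg m = n}"
    obtain i j k where "m = mon i j k" by (rule monom3_cases)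
    then show "m \<in> (\<lambda>(i, j, k). mon i j k) ` ({..n} \<times> {..n} \<times> {..n})"
      using m by (auto intro!: image_eqI[of _ _ "(i, j, k)"])
  qed
qed auto

lemma finite_std_monoms [simp]: "finite (std_monoms I j)"
  by (rule finite_subset[OF _ finite_tdeg[of "nat j"]]) (auto simp: std_monoms_def)

text \<open>The coefficient of the monomial \<open>n\<close> in \<open>l m\<close>.\<close>

definition mult_coeff :: "'k::field poly3 \<Rightarrow> monom3 \<Rightarrow> monom3 \<Rightarrow> 'k" where
  "mult_coeff l m n =
     (if \<exists>v. n = Poly_Mapping.single v 1 + m then Poly_Mapping.lookup l (n - m) else 0)"

lemma tdeg_one_cases:
  assumes "tdeg m = 1" obtains v where "m = Poly_Mapping.single v 1"
proof -
  obtain i j k where m: "m = mon i j k" by (rule monom3_cases)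
  then have "i + j + k = 1" using assms by simp
  then consider "i = 1" "j = 0" "k = 0" | "i = 0" "j = 1" "k = 0" | "i = 0" "j = 0" "k = 1"
    by linarith
  then show thesis
    using that[of VX] that[of VY] that[of VZ] by cases (simp_all add: single_var_mon m)
qed

lemma lookup_times_single:
  assumes "l \<in> homog 1"
  shows "Poly_Mapping.lookup (l * Poly_Mapping.single m c) n = c * mult_coeff l m n"
  using assms
proof (induction l rule: homog_induct)
  case zero
  show ?case by (simp add: mult_coeff_def)
next
  case (add p q)
  then show ?case by (auto simp: mult_coeff_def algebra_simps lookup_add)
next
  case (single k b)
  then obtain v where k: "k = Poly_Mapping.single v 1"
    using tdeg_one_cases[of k] by fastforce
  show ?case
  proof (cases "n = k + m")
    case True
    then show ?thesis by (auto simp: mult_coeff_def k mult_single)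
  next
    case False
    then have "Poly_Mapping.lookup (Poly_Mapping.single k b) (n - m) = 0"
      if "n = Poly_Mapping.single v' 1 + m" for v'
      using that by (auto simp: lookup_single when_def)
    then have "mult_coeff (Poly_Mapping.single k b) m n = 0" by (auto simp: mult_coeff_def)
    then show ?thesis using False by (simp add: mult_single lookup_single)
  qed
qed

text \<open>
  Terms of \<open>p\<close> in the ideal do not contribute, as their multiples stay in the ideal.
\<close>

lemma lookup_times_std:
  assumes l: "l \<in> homog 1" and p: "p \<in> homog j"
    and n: "n \<in> std_monoms (monomial_ideal G :: 'k::field poly3 set) (j + 1)"
  shows "Poly_Mapping.lookup (l * (p :: 'k poly3)) n =
    (\<Sum>m\<in>std_monoms (monomial_ideal G :: 'k poly3 set) j.
       Poly_Mapping.lookup p m * mult_coeff l m n)"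
  using p
proof (induction p rule: homog_induct)
  case zero
  show ?case by simp
next
  case (add p q)
  then show ?case by (simp add: algebra_simps lookup_add sum.distrib)
next
  case (single m c)
  let ?S = "std_monoms (monomial_ideal G :: 'k poly3 set) j"
  have "(\<Sum>m'\<in>?S. Poly_Mapping.lookup (Poly_Mapping.single m c) m' * mult_coeff l m' n) =
      (\<Sum>m'\<in>?S. if m' = m then c * mult_coeff l m n else 0)"
    by (intro sum.cong) (auto simp: lookup_single when_def)
  also have "\<dots> = c * mult_coeff l m n"
  proof (cases "m \<in> ?S")
    case False
    then obtain g k where g: "g \<in> set G" "m = g + k"
      using single by (auto simp: std_monoms_eq divides_def)
    have "n \<noteq> Poly_Mapping.single v 1 + m" for v
    proof
      assume "n = Poly_Mapping.single v 1 + m"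
      then have "n = g + (k + Poly_Mapping.single v 1)" by (simp add: g ac_simps)
      then have "divides g n" by (auto simp: divides_def)
      then show False using n g by (auto simp: std_monoms_eq)
    qed
    then have "mult_coeff l m n = 0" by (simp add: mult_coeff_def)
    then show ?thesis using False by (simp add: sum.delta)
  qed (simp add: sum.delta)
  finally show ?case by (simp add: lookup_times_single[OF l])
qed

lemma homog_in_ideal_iff:
  assumes "p \<in> homog j"
  shows "p \<in> monomial_ideal G \<longleftrightarrow>
    (\<forall>n\<in>std_monoms (monomial_ideal G :: 'k::field poly3 set) j. Poly_Mapping.lookup (p :: 'k poly3) n = 0)"
  unfolding std_monoms_eq using assms
  by (force simp: monomial_ideal_def homog_def in_keys_iff)

lemma mult_inj_iff_system:
  fixes l :: "'k::field poly3" and G j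
  assumes l: "l \<in> homog 1"
  defines "A \<equiv> std_monoms (monomial_ideal G :: 'k poly3 set) j"
    and "B \<equiv> std_monoms (monomial_ideal G :: 'k poly3 set) (j + 1)"
  shows "mult_inj (monomial_ideal G) l j \<longleftrightarrow>
    (\<forall>v. (\<forall>b\<in>B. (\<Sum>a\<in>A. v a * mult_coeff l a b) = 0) \<longrightarrow> (\<forall>a\<in>A. v a = 0))"
proof (intro iffI allI impI ballI)
  fix v a assume inj: "mult_inj (monomial_ideal G) l j" and a: "a \<in> A"
    and v: "\<forall>b\<in>B. (\<Sum>a\<in>A. v a * mult_coeff l a b) = 0"
  define p where "p = (\<Sum>m\<in>A. Poly_Mapping.single m (v m))"
  have p: "p \<in> homog j"
    by (auto simp: p_def A_def std_monoms_def intro!: homog_sum)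
  have lookup: "Poly_Mapping.lookup p m = v m" if "m \<in> A" for m
    using that by (simp add: p_def lookup_sum lookup_single when_def sum.delta A_def)
  have "l * p \<in> homog (j + 1)" by (rule homog_linear_mult[OF l p])
  moreover have "Poly_Mapping.lookup (l * p) b = 0" if "b \<in> B" for b
    using v that lookup by (simp add: lookup_times_std[OF l p, of b G] A_def B_def)
  ultimately have "l * p \<in> monomial_ideal G" by (simp add: homog_in_ideal_iff B_def)
  then have "p \<in> monomial_ideal G" using inj p by (simp add: mult_inj_def)
  then show "v a = 0" using a p lookup by (simp add: homog_in_ideal_iff A_def)
next
  assume *: "\<forall>v. (\<forall>b\<in>B. (\<Sum>a\<in>A. v a * mult_coeff l a b) = 0) \<longrightarrow> (\<forall>a\<in>A. v a = 0)"
  show "mult_inj (monomial_ideal G) l j"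
    unfolding mult_inj_def
  proof (intro ballI impI)
    fix p :: "'k poly3" assume p: "p \<in> homog j" "l * p \<in> monomial_ideal G"
    have "l * p \<in> homog (j + 1)" by (rule homog_linear_mult[OF l p(1)])
    then have "\<forall>b\<in>B. (\<Sum>a\<in>A. Poly_Mapping.lookup p a * mult_coeff l a b) = 0"
      using p by (simp add: homog_in_ideal_iff lookup_times_std[OF l p(1)] A_def B_def)
    then have "\<forall>a\<in>A. Poly_Mapping.lookup p a = 0" using * by blast
    then show "p \<in> monomial_ideal G" using p(1) by (simp add: homog_in_ideal_iff A_def)
  qed
qed

lemma mult_surj_iff_system:
  fixes l :: "'k::field poly3" and G j
  assumes l: "l \<in> homog 1"
  defines "A \<equiv> std_monoms (monomial_ideal G :: 'k poly3 set) j"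
    and "B \<equiv> std_monoms (monomial_ideal G :: 'k poly3 set) (j + 1)"
  shows "mult_surj (monomial_ideal G) l j \<longleftrightarrow>
    (\<forall>w. \<exists>v. \<forall>b\<in>B. (\<Sum>a\<in>A. v a * mult_coeff l a b) = w b)"
proof (intro iffI allI)
  fix w :: "monom3 \<Rightarrow> 'k" assume surj: "mult_surj (monomial_ideal G) l j"
  define q where "q = (\<Sum>m\<in>B. Poly_Mapping.single m (w m))"
  have q: "q \<in> homog (j + 1)"
    by (auto simp: q_def B_def std_monoms_def intro!: homog_sum)
  have lookup: "Poly_Mapping.lookup q m = w m" if "m \<in> B" for m
    using that by (simp add: q_def lookup_sum lookup_single when_def sum.delta B_def)
  obtain p where p: "p \<in> homog j" "q - l * p \<in> monomial_ideal G"
    using surj q unfolding mult_surj_def by blast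
  have "q - l * p \<in> homog (j + 1)" by (intro homog_diff q homog_linear_mult[OF l] p)
  then have "Poly_Mapping.lookup (q - l * p) b = 0" if "b \<in> B" for b
    using p that by (simp add: homog_in_ideal_iff B_def)
  then have "\<forall>b\<in>B. (\<Sum>a\<in>A. Poly_Mapping.lookup p a * mult_coeff l a b) = w b"
    using lookup by (simp add: lookup_minus lookup_times_std[OF l p(1)] A_def B_def)
  then show "\<exists>v. \<forall>b\<in>B. (\<Sum>a\<in>A. v a * mult_coeff l a b) = w b" by blast
next
  assume *: "\<forall>w. \<exists>v. \<forall>b\<in>B. (\<Sum>a\<in>A. v a * mult_coeff l a b) = w b"
  show "mult_surj (monomial_ideal G) l j"
    unfolding mult_surj_def
  proof
    fix q :: "'k poly3" assume q: "q \<in> homog (j + 1)"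
    obtain v where v: "\<forall>b\<in>B. (\<Sum>a\<in>A. v a * mult_coeff l a b) = Poly_Mapping.lookup q b"
      using * by blast
    define p where "p = (\<Sum>m\<in>A. Poly_Mapping.single m (v m))"
    have p: "p \<in> homog j"
      by (auto simp: p_def A_def std_monoms_def intro!: homog_sum)
    have lookup: "Poly_Mapping.lookup p m = v m" if "m \<in> A" for m
      using that by (simp add: p_def lookup_sum lookup_single when_def sum.delta A_def)
    have "q - l * p \<in> homog (j + 1)" by (intro homog_diff q homog_linear_mult[OF l] p)
    moreover have "Poly_Mapping.lookup (q - l * p) b = 0" if "b \<in> B" for b
      using v that lookup by (simp add: lookup_minus lookup_times_std[OF l p, of b G] A_def B_def)
    ultimately have "q - l * p \<in> monomial_ideal G" by (simp add: homog_in_ideal_iff B_def)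
    then show "\<exists>p\<in>homog j. q - l * p \<in> monomial_ideal G" using p by blast
  qed
qed

section \<open>The determinant of the bi-adjacency matrix\<close>

lemma monom_list:
  assumes "finite S"
  shows set_monom_list: "set (monom_list S) = S" and distinct_monom_list: "distinct (monom_list S)"
proof -
  interpret L: linorder "\<lambda>m n. m = n \<or> grevlex_less n m" "\<lambda>m n. grevlex_less n m"
  proof
    fix m n k :: monom3
    show "grevlex_less n m \<longleftrightarrow> (m = n \<or> grevlex_less n m) \<and> \<not> (n = m \<or> grevlex_less m n)"
      by (auto simp: grevlex_less_def)
    show "m = n \<or> grevlex_less n m \<Longrightarrow> n = k \<or> grevlex_less k n \<Longrightarrow> m = k \<or> grevlex_less k m"
      by (auto simp: grevlex_less_def)
    show "(m = n \<or> grevlex_less n m) \<or> (n = m \<or> grevlex_less m n)"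
    proof (rule ccontr)
      assume "\<not> ?thesis"
      then have "m \<noteq> n" "tdeg m = tdeg n" "Poly_Mapping.lookup m VZ = Poly_Mapping.lookup n VZ"
        "Poly_Mapping.lookup m VY = Poly_Mapping.lookup n VY"
        by (auto simp: grevlex_less_def)
      then show False using monom3_eqI[of m n] by (simp add: tdeg_def)
    qed
  qed (auto simp: grevlex_less_def)
  have "\<exists>!ms. set ms = S \<and> sorted_wrt (\<lambda>m n. grevlex_less n m) ms"
  proof
    show "set (L.sorted_list_of_set S) = S \<and>
        sorted_wrt (\<lambda>m n. grevlex_less n m) (L.sorted_list_of_set S)"
      using assms L.strict_sorted_list_of_set by simp
  qed (use assms L.strict_sorted_equal L.strict_sorted_list_of_set in auto)
  then have "set (monom_list S) = S \<and> sorted_wrt (\<lambda>m n. grevlex_less n m) (monom_list S)"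
    unfolding monom_list_def by (rule theI')
  then show "set (monom_list S) = S" "distinct (monom_list S)"
    using L.strict_sorted_iff by auto
qed

text \<open>
  Every perfect matching uses the same number of edges in direction \<open>v\<close>: the difference of the
  total \<open>v\<close>-exponents of the columns and of the rows. Hence all terms of the determinant change by
  the same factor when the edges are weighted by the coefficients of \<open>l\<close>.
\<close>

lemma det_mult_coeff:
  fixes l :: "'k::field poly3" and ms ns :: "monom3 list" and n :: nat
  defines "E \<equiv> \<lambda>v. (\<Sum>j<n. Poly_Mapping.lookup (ns ! j) v) - (\<Sum>i<n. Poly_Mapping.lookup (ms ! i) v)"
  shows "det (mat n n (\<lambda>(i, j). mult_coeff l (ms ! i) (ns ! j))) =
    (\<Prod>v\<in>UNIV. Poly_Mapping.lookup l (Poly_Mapping.single v 1) ^ E v) *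
    det (mat n n (\<lambda>(i, j). if \<exists>v. ns ! j = Poly_Mapping.single v 1 + ms ! i then 1 else 0))"
    (is "det ?M = ?C * det ?Z")
proof -
  have "(\<Prod>i = 0..<n. ?M $$ (i, p i)) = ?C * (\<Prod>i = 0..<n. ?Z $$ (i, p i))"
    if p: "p permutes {0..<n}" for p
  proof (cases "\<forall>i<n. \<exists>v. ns ! p i = Poly_Mapping.single v 1 + ms ! i")
    case False
    then obtain i where i: "i < n" "\<nexists>v. ns ! p i = Poly_Mapping.single v 1 + ms ! i" by blast
    have pi: "p i < n" using p i(1) permutes_in_image[OF p, of i] by simp
    then have "?M $$ (i, p i) = 0" "?Z $$ (i, p i) = 0"
      using i by (auto simp: mult_coeff_def)
    then have "(\<Prod>i = 0..<n. ?M $$ (i, p i)) = 0" "(\<Prod>i = 0..<n. ?Z $$ (i, p i)) = 0"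
      using i(1) by (auto intro!: prod_zero simp del: index_mat)
    then show ?thesis by (simp only: mult_zero_right)
  next
    case True
    then obtain dir where dir: "\<And>i. i < n \<Longrightarrow> ns ! p i = Poly_Mapping.single (dir i) 1 + ms ! i"
      by metis
    have pn: "p i < n" if "i < n" for i
      using permutes_in_image[OF p, of i] that by simp
    have M: "?M $$ (i, p i) = Poly_Mapping.lookup l (Poly_Mapping.single (dir i) 1)" if "i < n" for i
      using that pn[OF that] dir[OF that] by (auto simp: mult_coeff_def)
    have Z: "?Z $$ (i, p i) = 1" if "i < n" for i
      using that pn[OF that] dir[OF that] by auto
    have E: "card {i\<in>{0..<n}. dir i = v} = E v" for v
    proof -
      have "(\<Sum>j<n. Poly_Mapping.lookup (ns ! j) v) = (\<Sum>i<n. Poly_Mapping.lookup (ns ! p i) v)"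
        using sum.permute[OF p, of "\<lambda>j. Poly_Mapping.lookup (ns ! j) v"]
        by (simp add: lessThan_atLeast0 o_def)
      also have "\<dots> = (\<Sum>i<n. (if dir i = v then 1 else 0) + Poly_Mapping.lookup (ms ! i) v)"
        by (rule sum.cong) (auto simp: dir lookup_add lookup_single when_def)
      also have "\<dots> = card {i\<in>{0..<n}. dir i = v} + (\<Sum>i<n. Poly_Mapping.lookup (ms ! i) v)"
        by (simp add: sum.distrib sum.If_cases lessThan_atLeast0 Int_def)
      finally show ?thesis by (simp add: E_def)
    qed
    have "(\<Prod>i = 0..<n. ?M $$ (i, p i)) =
        (\<Prod>i = 0..<n. Poly_Mapping.lookup l (Poly_Mapping.single (dir i) 1))"
      using M by (intro prod.cong) auto
    also have "\<dots> = (\<Prod>v\<in>UNIV. \<Prod>i\<in>{i\<in>{0..<n}. dir i = v}.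
        Poly_Mapping.lookup l (Poly_Mapping.single (dir i) 1))"
      by (rule prod.group[symmetric]) auto
    also have "\<dots> = (\<Prod>v\<in>UNIV. \<Prod>i\<in>{i\<in>{0..<n}. dir i = v}.
        Poly_Mapping.lookup l (Poly_Mapping.single v 1))"
      by (intro prod.cong) auto
    also have "\<dots> = ?C" by (simp only: prod_constant E)
    finally have "(\<Prod>i = 0..<n. ?M $$ (i, p i)) = ?C" .
    moreover have "(\<Prod>i = 0..<n. ?Z $$ (i, p i)) = 1"
      using Z by (intro prod.neutral) auto
    ultimately show ?thesis by simp
  qed
  moreover have "det ?M = (\<Sum>p\<in>{p. p permutes {0..<n}}. signof p * (\<Prod>i = 0..<n. ?M $$ (i, p i)))"
    by (rule det_def') simp
  moreover have "det ?Z = (\<Sum>p\<in>{p. p permutes {0..<n}}. signof p * (\<Prod>i = 0..<n. ?Z $$ (i, p i)))"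
    by (rule det_def') simp
  ultimately show ?thesis
    by (simp add: sum_distrib_left mult.left_commute del: index_mat)
qed

text \<open>
  The exponents \<open>E\<close> depend on the ideal and \<open>d\<close> only. A linear form with all coefficients 1 therefore
  gives \<open>det Z\<close> itself, and no linear form can be bijective when \<open>det Z\<close> vanishes in the field.
\<close>

lemma mult_inj_surj_iff_det:
  fixes G :: "monom3 list" and d :: nat
  defines "I \<equiv> monomial_ideal G :: 'k::field poly3 set"
  assumes card: "card (std_monoms I (int d - 2)) = card (std_monoms I (int d - 1))"
  shows "\<exists>E. \<forall>l\<in>homog 1.
    (let D = (\<Prod>v\<in>UNIV. Poly_Mapping.lookup l (Poly_Mapping.single v 1) ^ E v) *
           of_int (det (Zmat d I))
     in (mult_inj I l (int d - 2) \<longleftrightarrow> D \<noteq> 0) \<and> (mult_surj I l (int d - 2) \<longleftrightarrow> D \<noteq> 0))"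
proof -
  let ?A = "std_monoms I (int d - 2)" and ?B = "std_monoms I (int d - 1)"
  define ms ns n where "ms = monom_list ?A" and "ns = monom_list ?B" and "n = length ms"
  have ms: "set ms = ?A" "distinct ms" and ns: "set ns = ?B" "distinct ns"
    by (simp_all add: ms_def ns_def set_monom_list distinct_monom_list)
  have n: "length ns = n" using ms ns card by (metis distinct_card n_def)
  let ?Z = "mat n n (\<lambda>(i, j). if \<exists>v. ns ! j = Poly_Mapping.single v 1 + ms ! i then 1 else 0) :: 'k mat"
  interpret of_int: comm_ring_hom "of_int :: int \<Rightarrow> 'k"
    by unfold_locales auto
  have "of_int (det (Zmat d I)) = det (map_mat (of_int :: int \<Rightarrow> 'k) (Zmat d I))" by simp
  also have "map_mat (of_int :: int \<Rightarrow> 'k) (Zmat d I) = ?Z"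
    by (rule eq_matI) (auto simp: Zmat_def ms_def[symmetric] ns_def[symmetric] n n_def[symmetric])
  finally have Z: "of_int (det (Zmat d I)) = det ?Z" .
  have bij: "bij_betw ((!) ms) {..<n} ?A" "bij_betw ((!) ns) {..<n} ?B"
    using bij_betw_nth[of ms "{..<n}" ?A] bij_betw_nth[of ns "{..<n}" ?B] ms ns n
    by (auto simp: n_def)
  let ?E = "\<lambda>v. (\<Sum>j<n. Poly_Mapping.lookup (ns ! j) v) - (\<Sum>i<n. Poly_Mapping.lookup (ms ! i) v)"
  have "(mult_inj I l (int d - 2) \<longleftrightarrow> D \<noteq> 0) \<and> (mult_surj I l (int d - 2) \<longleftrightarrow> D \<noteq> 0)"
    if l: "l \<in> homog 1" and D: "D = (\<Prod>v\<in>UNIV. Poly_Mapping.lookup l (Poly_Mapping.single v 1) ^ ?E v) *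
           of_int (det (Zmat d I))" for l D
  proof -
    have D': "D = det (mat n n (\<lambda>(i, j). mult_coeff l (ms ! i) (ns ! j)))"
      unfolding D Z by (rule det_mult_coeff[symmetric])
    have deg: "int d - 2 + 1 = int d - 1" by simp
    show ?thesis
      using square_system_det[OF bij, of "mult_coeff l"]
        mult_inj_iff_system[OF l, of G "int d - 2"] mult_surj_iff_system[OF l, of G "int d - 2"]
      unfolding D' deg I_def by blast
  qed
  then show ?thesis by (intro exI[of _ ?E]) (simp add: Let_def)
qed

text \<open>
  As the two pieces have the same dimension, maximal rank from degree \<open>d - 2\<close> to \<open>d - 1\<close> means
  bijectivity. All other degrees follow by descent for injectivity, which the socle condition allows,
  and by ascent for surjectivity.
\<close>

proposition weak_lefschetz_iff_det:
  fixes G :: "monom3 list" and d :: nat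
  defines "I \<equiv> monomial_ideal G :: 'k::field poly3 set"
  assumes card: "card (std_monoms I (int d - 2)) = card (std_monoms I (int d - 1))"
    and d: "d \<ge> 1"
    and socle: "\<And>m. tdeg m + 2 < d \<Longrightarrow> \<not> (\<exists>g\<in>set G. divides g m) \<Longrightarrow>
       \<exists>v. \<not> (\<exists>g\<in>set G. divides g (Poly_Mapping.single v 1 + m))"
  shows "weak_lefschetz I \<longleftrightarrow> (of_int (det (Zmat d I)) :: 'k) \<noteq> 0"
proof -
  obtain E where E: "\<And>l. l \<in> homog 1 \<Longrightarrow> mult_inj I l (int d - 2) \<longleftrightarrow>
        (\<Prod>v\<in>UNIV. Poly_Mapping.lookup l (Poly_Mapping.single v 1) ^ E v) *
           of_int (det (Zmat d I)) \<noteq> 0"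
      "\<And>l. l \<in> homog 1 \<Longrightarrow> mult_surj I l (int d - 2) \<longleftrightarrow>
        (\<Prod>v\<in>UNIV. Poly_Mapping.lookup l (Poly_Mapping.single v 1) ^ E v) *
           of_int (det (Zmat d I)) \<noteq> 0"
    using mult_inj_surj_iff_det[of G d] card unfolding I_def Let_def by blast
  show ?thesis
  proof
    assume "weak_lefschetz I"
    then obtain l where "l \<in> homog 1" "mult_inj I l (int d - 2) \<or> mult_surj I l (int d - 2)"
      unfolding I_def weak_lefschetz_monomial_ideal by blast
    then show "(of_int (det (Zmat d I)) :: 'k) \<noteq> 0" using E by auto
  next
    assume det: "(of_int (det (Zmat d I)) :: 'k) \<noteq> 0"
    let ?l = "lin 1 1 1 :: 'k poly3"
    have "Poly_Mapping.lookup ?l (Poly_Mapping.single v 1) = 1" for v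
      by (cases v) (auto simp: lin_def lookup_add lookup_single when_def mon_eq_iff
          single_var_mon simp flip: One_nat_def)
    then have "mult_inj I ?l (int d - 2)" "mult_surj I ?l (int d - 2)"
      using E[of ?l] det lin_homog[of 1 1 1] by auto
    have surj: "mult_surj I ?l (int d - 2 + int k)" for k
    proof (induction k)
      case (Suc k)
      from mult_surj_step[OF this[unfolded I_def]] d show ?case
        by (auto simp: I_def algebra_simps)
    qed (use \<open>mult_surj I ?l (int d - 2)\<close> in simp)
    have inj: "mult_inj I ?l (int d - 2 - int k)" for k
    proof (induction k)
      case (Suc k)
      show ?case
        unfolding I_def
      proof (rule mult_inj_step)
        show "mult_inj (monomial_ideal G) ?l (int d - 2 - int (Suc k) + 1)"
          using Suc by (simp add: I_def algebra_simps)
        show "\<exists>v. \<not> (\<exists>g\<in>set G. divides g (Poly_Mapping.single v 1 + m))"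
          if "int (tdeg m) = int d - 2 - int (Suc k)" "\<not> (\<exists>g\<in>set G. divides g m)" for m
          using that by (intro socle) auto
      qed
    qed (use \<open>mult_inj I ?l (int d - 2)\<close> in simp)
    have "mult_inj I ?l j \<or> mult_surj I ?l j" for j
      using surj[of "nat (j - (int d - 2))"] inj[of "nat (int d - 2 - j)"]
      by (cases "j \<le> int d - 2") auto
    then show "weak_lefschetz I"
      unfolding I_def weak_lefschetz_monomial_ideal using lin_homog by blast
  qed
qed

section \<open>Counting monomials\<close>

text \<open>
  The number of monomials of degree \<open>k - 1\<close>. With this shift the count is zero for \<open>k = 0\<close>, and
  truncated subtraction gives the right number of multiples of a monomial of too large a degree.
\<close>

definition monom_count :: "nat \<Rightarrow> nat" where
  "monom_count k = card {m. tdeg m + 1 = k}"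

lemma finite_tdeg_Suc [simp]: "finite {m. tdeg m + 1 = k}" "finite {m. Suc (tdeg m) = k}"
  by (rule finite_subset[OF _ finite_tdeg[of "k - 1"]]; auto)+

lemma monom_count_0 [simp]: "monom_count 0 = 0"
  by (simp add: monom_count_def)

lemma monom_count_Suc: "monom_count (Suc k) = monom_count k + Suc k"
proof -
  let ?f = "\<lambda>m. Poly_Mapping.single VZ 1 + m" and ?g = "\<lambda>i. mon i (k - i) 0"
  have "{m. tdeg m + 1 = Suc k} = ?f ` {m. tdeg m + 1 = k} \<union> ?g ` {..k}"
  proof (intro equalityI subsetI)
    fix m assume m: "m \<in> {m. tdeg m + 1 = Suc k}"
    obtain i1 i2 i3 where mon: "m = mon i1 i2 i3" by (rule monom3_cases)
    show "m \<in> ?f ` {m. tdeg m + 1 = k} \<union> ?g ` {..k}"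
    proof (cases i3)
      case 0
      then have "m = ?g i1" "i1 \<le> k" using m mon by (auto simp: mon_eq_iff)
      then show ?thesis by blast
    next
      case (Suc i)
      then have "m = ?f (mon i1 i2 i)" "tdeg (mon i1 i2 i) + 1 = k"
        using m mon by (auto simp: single_var_mon mon_add)
      then show ?thesis by blast
    qed
  qed auto
  moreover have "?f ` {m. tdeg m + 1 = k} \<inter> ?g ` {..k} = {}"
  proof -
    have "Poly_Mapping.lookup (?f m) VZ \<noteq> Poly_Mapping.lookup (?g i) VZ" for m i
      by (simp add: lookup_add)
    then show ?thesis by (metis (no_types, lifting) disjoint_iff imageE)
  qed
  moreover have "card (?f ` {m. tdeg m + 1 = k}) = monom_count k"
    unfolding monom_count_def by (rule card_image) (simp add: inj_on_def)
  moreover have "card (?g ` {..k}) = Suc k"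
    by (subst card_image) (auto simp: inj_on_def mon_eq_iff)
  ultimately show ?thesis
    unfolding monom_count_def by (simp add: card_Un_disjoint)
qed

lemma card_multiples:
  "card {m. tdeg m + 1 = k \<and> divides g m} = monom_count (k - tdeg g)"
proof -
  have "{m. tdeg m + 1 = k \<and> divides g m} = (+) g ` {m. tdeg m + 1 = k - tdeg g}"
    by (auto simp: divides_def)
  then show ?thesis by (simp add: card_image monom_count_def)
qed

lemma card_std_plus_multiples:
  assumes "\<And>i j m. i < length G \<Longrightarrow> j < length G \<Longrightarrow> i \<noteq> j \<Longrightarrow>
      divides (G ! i) m \<Longrightarrow> divides (G ! j) m \<Longrightarrow> k \<le> tdeg m"
  shows "card {m. tdeg m + 1 = k \<and> \<not> (\<exists>g\<in>set G. divides g m)} +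
     (\<Sum>i<length G. monom_count (k - tdeg (G ! i))) = monom_count k"
proof -
  let ?S = "{m. tdeg m + 1 = k \<and> \<not> (\<exists>g\<in>set G. divides g m)}"
  let ?T = "\<lambda>i. {m. tdeg m + 1 = k \<and> divides (G ! i) m}"
  have fin: "finite (?T i)" for i by (rule finite_subset[OF _ finite_tdeg_Suc(1)[of k]]) auto
  have "card (\<Union>i<length G. ?T i) = (\<Sum>i<length G. card (?T i))"
  proof (rule card_UN_disjoint)
    show "\<forall>i\<in>{..<length G}. \<forall>j\<in>{..<length G}. i \<noteq> j \<longrightarrow> ?T i \<inter> ?T j = {}"
    proof (intro ballI impI)
      fix i j assume ij: "i \<in> {..<length G}" "j \<in> {..<length G}" "i \<noteq> j"
      have False if "tdeg m + 1 = k" "divides (G ! i) m" "divides (G ! j) m" for m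
        using assms[of i j m] ij that by simp
      then show "?T i \<inter> ?T j = {}" by blast
    qed
  qed (use fin in auto)
  moreover have "{m. tdeg m + 1 = k} = ?S \<union> (\<Union>i<length G. ?T i)"
    by (auto simp: in_set_conv_nth)
  moreover have "finite ?S" by (rule finite_subset[OF _ finite_tdeg_Suc(1)[of k]]) auto
  moreover have "?S \<inter> (\<Union>i<length G. ?T i) = {}" by auto
  ultimately have "card {m. tdeg m + 1 = k} = card ?S + (\<Sum>i<length G. card (?T i))"
    using fin by (metis (no_types, lifting) card_Un_disjoint finite_UN finite_lessThan)
  then show ?thesis
    unfolding monom_count_def[of k] card_multiples by (rule sym)
qed

text \<open>
  In degrees below \<open>d\<close> the sets of multiples of the generators are disjoint. Passing from degree
  \<open>d - 2\<close> to \<open>d - 1\<close> adds \<open>d\<close> monomials in total and \<open>d - e\<close> multiples of a generator of degree \<open>e\<close>.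
\<close>

lemma card_std_monoms_eq:
  fixes G :: "monom3 list" and d :: nat
  defines "I \<equiv> monomial_ideal G :: 'k::field poly3 set"
  assumes disj: "\<And>i j m. i < length G \<Longrightarrow> j < length G \<Longrightarrow> i \<noteq> j \<Longrightarrow>
      divides (G ! i) m \<Longrightarrow> divides (G ! j) m \<Longrightarrow> d \<le> tdeg m"
    and sum_deg: "(\<Sum>i<length G. d - tdeg (G ! i)) = d" and d: "d \<ge> 1"
  shows "card (std_monoms I (int d - 2)) = card (std_monoms I (int d - 1))"
proof -
  obtain d' where d': "d = Suc d'" using d by (cases d) auto
  let ?S = "\<lambda>k. {m. tdeg m + 1 = k \<and> \<not> (\<exists>g\<in>set G. divides g m)}"
  have "int (tdeg m) = int d - 2 \<longleftrightarrow> tdeg m + 1 = d'"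
       "int (tdeg m) = int d - 1 \<longleftrightarrow> tdeg m + 1 = d" for m
    by (auto simp: d')
  then have S: "std_monoms I (int d - 2) = ?S d'" "std_monoms I (int d - 1) = ?S d"
    by (simp_all add: std_monoms_eq I_def)
  have step: "monom_count (d - e) = monom_count (d' - e) + (d - e)" for e
    by (cases "e \<le> d'") (simp_all add: d' Suc_diff_le monom_count_Suc)
  have "card (?S d) + (\<Sum>i<length G. monom_count (d - tdeg (G ! i))) = monom_count d"
    by (rule card_std_plus_multiples) (rule disj)
  moreover have "card (?S d') + (\<Sum>i<length G. monom_count (d' - tdeg (G ! i))) = monom_count d'"
  proof (rule card_std_plus_multiples)
    fix i j m assume "i < length G" "j < length G" "i \<noteq> j" "divides (G ! i) m" "divides (G ! j) m"
    then show "d' \<le> tdeg m" using disj[of i j m] d' by simp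
  qed
  moreover have "(\<Sum>i<length G. monom_count (d - tdeg (G ! i))) =
      (\<Sum>i<length G. monom_count (d' - tdeg (G ! i))) + d"
    by (simp add: step sum.distrib sum_deg)
  ultimately show ?thesis
    unfolding S using step[of 0] by simp
qed

section \<open>Sections over a line\<close>

text \<open>
  The multiples of \<open>l\<close> in the localization of the polynomial ring at \<open>f\<close>, in all degrees at once.
  Forgetting the degrees makes this independent of how a section is written as a fraction.
\<close>

definition Van :: "'k::field poly3 \<Rightarrow> 'k poly3 \<Rightarrow> 'k poly3 fract set" where
  "Van l f = {Fract (l * g) (f ^ m) | g m. True}"

lemma VanI: "Fract (l * g) (f ^ m) \<in> Van l f"
  by (auto simp: Van_def)

lemma Van_zero [simp]: "0 \<in> Van l f"
  using VanI[of l 0 f 0] by (simp add: Zero_fract_def)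

lemma Fract_power_expand:
  "f \<noteq> 0 \<Longrightarrow> Fract g (f ^ k) = Fract (f ^ m * g) (f ^ (k + m))" for f :: "'a::idom"
  by (simp add: eq_fract power_add)

lemma Van_add:
  assumes f: "f \<noteq> 0" and "r \<in> Van l f" "s \<in> Van l f"
  shows "r + s \<in> Van l f"
proof -
  obtain g m h n where "r = Fract (l * g) (f ^ m)" "s = Fract (l * h) (f ^ n)"
    using assms by (auto simp: Van_def)
  then have "r + s = Fract (l * (g * f ^ n + h * f ^ m)) (f ^ (m + n))"
    using f by (simp add: power_add algebra_simps)
  then show ?thesis using VanI by metis
qed

lemma Van_mult:
  assumes "s \<in> Van l f"
  shows "Fract h (f ^ k) * s \<in> Van l f"
proof -
  obtain g m where "s = Fract (l * g) (f ^ m)"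
    using assms by (auto simp: Van_def)
  then have "Fract h (f ^ k) * s = Fract (l * (h * g)) (f ^ (k + m))"
    by (simp add: power_add ac_simps)
  then show ?thesis using VanI by metis
qed

lemma Van_uminus: "s \<in> Van l f \<Longrightarrow> - s \<in> Van l f"
  using Van_mult[of s l f "- 1" 0]
  by (simp add: fract_collapse flip: minus_fract)

lemma Van_diff: "f \<noteq> 0 \<Longrightarrow> r \<in> Van l f \<Longrightarrow> s \<in> Van l f \<Longrightarrow> r - s \<in> Van l f"
  using Van_add[of f r l "- s"] Van_uminus[of s l f] by simp

lemma Van_sum: "f \<noteq> 0 \<Longrightarrow> (\<And>x. x \<in> A \<Longrightarrow> h x \<in> Van l f) \<Longrightarrow> sum h A \<in> Van l f"
  by (induction A rule: infinite_finite_induct) (auto simp: Van_add)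

lemma Van_mono:
  assumes "f dvd h ^ k" "h \<noteq> 0" "s \<in> Van l f"
  shows "s \<in> Van l h"
proof -
  obtain q where q: "h ^ k = f * q" using assms(1) by (elim dvdE)
  then have fq: "f \<noteq> 0" "q \<noteq> 0" using assms(2) by (metis mult_eq_0_iff power_not_zero)+
  obtain g m where "s = Fract (l * g) (f ^ m)"
    using assms by (auto simp: Van_def)
  also have "\<dots> = Fract (l * (g * q ^ m)) (h ^ (k * m))"
    using fq assms(2) by (simp add: eq_fract power_mult q power_mult_distrib ac_simps)
  finally show ?thesis using VanI by metis
qed

definition frac_vec :: "'k::field poly3 \<Rightarrow> nat \<Rightarrow> 'k poly3 vec \<Rightarrow> 'k poly3 fract vec" where
  "frac_vec f k v = map_vec (\<lambda>g. Fract g (f ^ k)) v"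

lemma dim_frac_vec [simp]: "dim_vec (frac_vec f k v) = dim_vec v"
  by (simp add: frac_vec_def)

lemma index_frac_vec [simp]: "i < dim_vec v \<Longrightarrow> frac_vec f k v $ i = Fract (v $ i) (f ^ k)"
  by (simp add: frac_vec_def)

lemma frac_vec_expand: "f \<noteq> 0 \<Longrightarrow> frac_vec f k v = frac_vec f (k + m) (f ^ m \<cdot>\<^sub>v v)"
  by (intro eq_vecI) (auto simp: Fract_power_expand[of f _ k m])

lemma basic_nonzero: "basic f \<Longrightarrow> f \<noteq> 0"
  by (simp add: basic_def)

lemma regular_fun_Van:
  "r \<in> regular_fun f \<Longrightarrow> s \<in> Van l f \<Longrightarrow> r * s \<in> Van l f"
  by (auto simp: regular_fun_def Van_mult)

text \<open>
  Submodules of a free module with torsion-free quotient, such as kernels. Torsion-freeness is what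
  makes a section that is divisible by \<open>l\<close> in the free module divisible by \<open>l\<close> in \<open>M\<close>.
\<close>

locale saturated_module =
  fixes M :: "('k::field) graded_mod"
  assumes carrier: "v \<in> elems M \<Longrightarrow> dim_vec v = rk M"
    and add_closed: "v \<in> elems M \<Longrightarrow> w \<in> elems M \<Longrightarrow> v + w \<in> elems M"
    and smult_closed: "v \<in> elems M \<Longrightarrow> r \<cdot>\<^sub>v v \<in> elems M"
    and nonempty: "elems M \<noteq> {}"
    and saturated: "r \<noteq> 0 \<Longrightarrow> dim_vec v = rk M \<Longrightarrow> r \<cdot>\<^sub>v v \<in> elems M \<Longrightarrow> v \<in> elems M"
begin

lemma zero_elems: "0\<^sub>v (rk M) \<in> elems M"
proof -
  obtain v where v: "v \<in> elems M" using nonempty by blast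
  have "0 \<cdot>\<^sub>v v = 0\<^sub>v (rk M)" using carrier[OF v] by auto
  then show ?thesis using smult_closed[OF v] by metis
qed

lemma piece_zero: "0\<^sub>v (rk M) \<in> piece M j"
  by (simp add: piece_def zero_elems)

lemma piece_add: "v \<in> piece M j \<Longrightarrow> w \<in> piece M j \<Longrightarrow> v + w \<in> piece M j"
  by (simp add: piece_def add_closed homog_add)

lemma piece_smult:
  assumes "g \<in> homog i" "v \<in> piece M j" "n = i + j"
  shows "g \<cdot>\<^sub>v v \<in> piece M n"
  using assms by (auto simp: piece_def smult_closed add.assoc intro!: homog_mult)

lemma sectionsI: "f \<in> homog e \<Longrightarrow> v \<in> piece M (int k * e) \<Longrightarrow> frac_vec f k v \<in> sections M f"
  by (auto simp: sections_def frac_vec_def)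

lemma sectionsE:
  assumes "s \<in> sections M f" "f \<noteq> 0" "f \<in> homog e"
  obtains k v where "v \<in> piece M (int k * e)" "s = frac_vec f k v"
proof -
  obtain v k e' where v: "f \<in> homog e'" "v \<in> piece M (int k * e')" "s = frac_vec f k v"
    using assms(1) by (auto simp: sections_def frac_vec_def)
  moreover have "e' = e" using homog_unique v(1) assms by blast
  ultimately show thesis using that by blast
qed

lemma sections_dim: "s \<in> sections M f \<Longrightarrow> dim_vec s = rk M"
  by (auto simp: sections_def piece_def)

lemma sections_zero:
  assumes "basic f"
  shows "0\<^sub>v (rk M) \<in> sections M f"
proof -
  obtain e where e: "f \<in> homog e" using assms by (auto simp: basic_def)
  have "frac_vec f 0 (0\<^sub>v (rk M)) = 0\<^sub>v (rk M)"
    by (intro eq_vecI) (auto simp: fract_collapse)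
  then show ?thesis using sectionsI[OF e, of "0\<^sub>v (rk M)" 0] piece_zero by simp
qed

lemma sections_add:
  assumes "basic f" "s \<in> sections M f" "t \<in> sections M f"
  shows "s + t \<in> sections M f"
proof -
  obtain e where e: "f \<in> homog e" "f \<noteq> 0" using assms by (auto simp: basic_def)
  obtain k v where v: "v \<in> piece M (int k * e)" "s = frac_vec f k v"
    using assms e by (auto elim: sectionsE)
  obtain m w where w: "w \<in> piece M (int m * e)" "t = frac_vec f m w"
    using assms e by (auto elim: sectionsE)
  let ?u = "f ^ m \<cdot>\<^sub>v v + f ^ k \<cdot>\<^sub>v w"
  have "?u \<in> piece M (int (k + m) * e)"
    by (intro piece_add piece_smult[OF homog_power[OF e(1)] v(1)]
        piece_smult[OF homog_power[OF e(1)] w(1)]) (auto simp: algebra_simps)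
  moreover have "s + t = frac_vec f (k + m) ?u"
    using v w e(2) by (intro eq_vecI) (auto simp: piece_def power_add algebra_simps)
  ultimately show ?thesis using sectionsI[OF e(1)] by simp
qed

lemma sections_smult:
  assumes "basic f" "r \<in> regular_fun f" "s \<in> sections M f"
  shows "r \<cdot>\<^sub>v s \<in> sections M f"
proof -
  obtain g m e where r: "f \<in> homog e" "g \<in> homog (int m * e)" "r = Fract g (f ^ m)"
    using assms by (auto simp: regular_fun_def)
  obtain k v where v: "v \<in> piece M (int k * e)" "s = frac_vec f k v"
    using assms r basic_nonzero by (metis sectionsE)
  have "g \<cdot>\<^sub>v v \<in> piece M (int (m + k) * e)"
    using piece_smult[OF r(2) v(1)] by (simp add: algebra_simps)
  moreover have "r \<cdot>\<^sub>v s = frac_vec f (m + k) (g \<cdot>\<^sub>v v)"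
    using v r by (intro eq_vecI) (auto simp: power_add)
  ultimately show ?thesis using sectionsI[OF r(1)] by simp
qed

lemma sections_mono:
  assumes "basic f" "basic h" "f dvd h ^ n" "s \<in> sections M f"
  shows "s \<in> sections M h"
proof -
  obtain e e' where e: "f \<in> homog e" "f \<noteq> 0" "h \<in> homog e'" "h \<noteq> 0"
    using assms by (auto simp: basic_def)
  obtain q0 where q0: "h ^ n = f * q0" using assms(3) by (elim dvdE)
  \<comment> \<open>The cofactor may be taken homogeneous.\<close>
  define q where "q = hcomp (int n * e' - e) q0"
  have "h ^ n = hcomp (e + (int n * e' - e)) (f * q0)"
    using hcomp_id[OF homog_power[OF e(3), of n]] q0 by simp
  then have q: "h ^ n = f * q" by (simp only: q_def hcomp_mult[OF e(1)])
  obtain k v where v: "v \<in> piece M (int k * e)" "s = frac_vec f k v"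
    using assms e by (auto elim: sectionsE)
  have h_power: "h ^ (n * k) = q ^ k * f ^ k"
    unfolding power_mult q power_mult_distrib by (rule mult.commute)
  have "q \<noteq> 0" using q e(4) by (metis mult_zero_right power_not_zero)
  have "q ^ k \<in> homog (int k * (int n * e' - e))"
    unfolding q_def by (intro homog_power hcomp_homog)
  then have "q ^ k \<cdot>\<^sub>v v \<in> piece M (int (n * k) * e')"
    using v(1) by (rule piece_smult) (simp add: algebra_simps)
  moreover have "s = frac_vec h (n * k) (q ^ k \<cdot>\<^sub>v v)"
    using v \<open>q \<noteq> 0\<close> by (intro eq_vecI) (auto simp: h_power mult_fract_cancel)
  ultimately show ?thesis using sectionsI[OF e(3)] by simp
qed

text \<open>
  A section \<open>l v / f\<^sup>k\<close> need not be a single product of a section of the ideal sheaf with a section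
  of \<open>M\<close>, because \<open>v / f\<^sup>k\<close> has degree \<open>-1\<close>. It is a sum of three of them: with \<open>f = \<Sum> x\<^sub>i f\<^sub>i\<close>
  over the variables \<open>x\<^sub>i\<close>, it equals \<open>\<Sum> (l f\<^sub>i / f) (x\<^sub>i v / f\<^sup>k)\<close>.
\<close>

lemma line_part_iff:
  assumes f: "basic f" and l: "l \<in> homog 1" "l \<noteq> 0"
  shows "s \<in> line_part l M f \<longleftrightarrow> s \<in> sections M f \<and> (\<forall>i<rk M. s $ i \<in> Van l f)"
proof
  have f0: "f \<noteq> 0" using f by (simp add: basic_def)
  assume "s \<in> line_part l M f"
  then show "s \<in> sections M f \<and> (\<forall>i<rk M. s $ i \<in> Van l f)"
  proof induction
    case zero
    show ?case using sections_zero[OF f] by simp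
  next
    case (add r s t)
    have "r \<in> regular_fun f" using add(1) by (auto simp: line_ideal_def regular_fun_def)
    then have "r \<cdot>\<^sub>v s + t \<in> sections M f"
      using add sections_smult[OF f] sections_add[OF f] by blast
    moreover have "(r \<cdot>\<^sub>v s + t) $ i \<in> Van l f" if i: "i < rk M" for i
    proof -
      obtain g k where r: "r = Fract (l * g) (f ^ k)" using add(1) by (auto simp: line_ideal_def)
      obtain h m where s: "s $ i = Fract h (f ^ m)"
        using add(2) i by (auto simp: sections_def piece_def)
      have "r * s $ i = Fract h (f ^ m) * r" by (simp add: s mult.commute)
      also have "\<dots> \<in> Van l f" unfolding r by (intro Van_mult VanI)
      finally show ?thesis
        using add i sections_dim[OF add(2)] sections_dim[of t]
        by (auto intro!: Van_add[OF f0])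
    qed
    ultimately show ?case by blast
  qed
next
  assume s: "s \<in> sections M f \<and> (\<forall>i<rk M. s $ i \<in> Van l f)"
  obtain e where e: "f \<in> homog e" "e > 0" "f \<noteq> 0" using f by (auto simp: basic_def)
  obtain k v where v: "v \<in> piece M (int k * e)" "s = frac_vec f k v"
    using s e by (auto elim: sectionsE)
  have dim_v: "dim_vec v = rk M" using v(1) by (simp add: piece_def)
  have "\<exists>g m. f ^ m * v $ i = l * g" if "i < rk M" for i
  proof -
    have "Fract (v $ i) (f ^ k) \<in> Van l f" using s that v dim_v by auto
    then obtain g m where "Fract (v $ i) (f ^ k) = Fract (l * g) (f ^ m)"
      by (auto simp: Van_def)
    then have "f ^ m * v $ i = l * (g * f ^ k)" using e(3) by (simp add: eq_fract ac_simps)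
    then show ?thesis by blast
  qed
  then obtain g m where gm: "\<And>i. i < rk M \<Longrightarrow> f ^ m i * v $ i = l * g i" by metis
  \<comment> \<open>An exponent that serves for all entries at once.\<close>
  define n where "n = (\<Sum>i<rk M. m i)"
  have "\<exists>g. f ^ n * v $ i = l * g \<and> g \<in> homog (int (k + n) * e - 1 + shifts M ! i)"
    if i: "i < rk M" for i
  proof -
    have "m i \<le> n" unfolding n_def using i by (intro member_le_sum) auto
    then have "f ^ n = f ^ (n - m i) * f ^ m i" by (simp flip: power_add)
    then have eq: "f ^ n * v $ i = l * (f ^ (n - m i) * g i)"
      using gm[OF i] by (simp add: ac_simps)
    let ?j = "int (k + n) * e - 1 + shifts M ! i"
    have "f ^ n * v $ i \<in> homog (1 + ?j)"
      using homog_power[OF e(1), of n] v(1) i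
      by (intro homog_mult'[of _ "int n * e" _ "int k * e + shifts M ! i"])
         (auto simp: piece_def algebra_simps)
    then have "f ^ n * v $ i = hcomp (1 + ?j) (l * (f ^ (n - m i) * g i))"
      using eq hcomp_id by metis
    also have "\<dots> = l * hcomp ?j (f ^ (n - m i) * g i)" by (rule hcomp_mult[OF l(1)])
    finally show ?thesis using hcomp_homog by blast
  qed
  then obtain q where q: "\<And>i. i < rk M \<Longrightarrow> f ^ n * v $ i = l * q i"
    "\<And>i. i < rk M \<Longrightarrow> q i \<in> homog (int (k + n) * e - 1 + shifts M ! i)" by metis
  define u where "u = vec (rk M) q"
  have lu: "f ^ n \<cdot>\<^sub>v v = l \<cdot>\<^sub>v u"
    using q(1) dim_v by (intro eq_vecI) (auto simp: u_def)
  moreover have "f ^ n \<cdot>\<^sub>v v \<in> elems M" using v(1) by (simp add: piece_def smult_closed)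
  ultimately have "u \<in> elems M" using saturated[OF l(2), of u] by (simp add: u_def)
  then have u: "u \<in> piece M (int (k + n) * e - 1)"
    using q(2) by (simp add: piece_def u_def)
  obtain c where c: "\<And>x. c x \<in> homog (e - 1)" "f = (\<Sum>x\<in>UNIV. Var x * c x)"
    using homog_Var_decomp[OF e(1,2)] by blast
  have term_in: "Fract (l * c x) (f ^ 1) \<cdot>\<^sub>v frac_vec f (k + n) (Var x \<cdot>\<^sub>v u) + t \<in> line_part l M f"
    if "t \<in> line_part l M f" for x t
  proof (rule line_part.add[OF _ _ that])
    show "Fract (l * c x) (f ^ 1) \<in> line_ideal l f"
      unfolding line_ideal_def using e(1) homog_mult'[OF l(1) c(1), of e x]
      by (intro CollectI exI[of _ "c x"] exI[of _ 1] exI[of _ e]) auto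
    show "frac_vec f (k + n) (Var x \<cdot>\<^sub>v u) \<in> sections M f"
      using piece_smult[OF homog_Var u] by (intro sectionsI[OF e(1)]) auto
  qed
  let ?w = "\<lambda>x. Fract (l * c x) (f ^ 1) \<cdot>\<^sub>v frac_vec f (k + n) (Var x \<cdot>\<^sub>v u)"
  have "?w VX + (?w VY + (?w VZ + 0\<^sub>v (rk M))) \<in> line_part l M f"
    by (intro term_in line_part.zero)
  also have "?w VX + (?w VY + (?w VZ + 0\<^sub>v (rk M))) = s"
  proof (rule eq_vecI)
    fix i assume "i < dim_vec s"
    then have i: "i < rk M" using v dim_v by simp
    have "?w x $ i = Fract (l * (Var x * c x) * u $ i) (f ^ (k + n + 1))" for x
      using i by (simp add: u_def ac_simps)
    then have "(?w VX + (?w VY + (?w VZ + 0\<^sub>v (rk M)))) $ i =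
        Fract (l * (Var VX * c VX) * u $ i) (f ^ (k + n + 1)) +
        (Fract (l * (Var VY * c VY) * u $ i) (f ^ (k + n + 1)) +
         Fract (l * (Var VZ * c VZ) * u $ i) (f ^ (k + n + 1)))"
      using i by (simp add: u_def)
    also have "\<dots> = Fract (l * (Var VX * c VX + Var VY * c VY + Var VZ * c VZ) * u $ i)
        (f ^ (k + n + 1))"
      using e(3) by (simp add: eq_fract algebra_simps)
    also have "Var VX * c VX + Var VY * c VY + Var VZ * c VZ = f"
      using c(2) by (simp add: UNIV_var add.assoc)
    also have "Fract (l * f * u $ i) (f ^ (k + n + 1)) = Fract (f ^ n * v $ i) (f ^ (k + n))"
      using e(3) q(1)[OF i] i by (simp add: eq_fract u_def ac_simps)
    also have "\<dots> = s $ i"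
      using v(2) i dim_v Fract_power_expand[OF e(3), of "v $ i" k n] by simp
    finally show "(?w VX + (?w VY + (?w VZ + 0\<^sub>v (rk M)))) $ i = s $ i" .
  qed (use v dim_v in \<open>auto simp: u_def\<close>)
  finally show "s \<in> line_part l M f" .
qed

end

locale line_module = saturated_module M for M :: "('k::field) graded_mod" +
  fixes l :: "'k poly3"
  assumes l_homog: "l \<in> homog 1" and l_nonzero: "l \<noteq> 0"
begin

abbreviation N :: "'k poly3 \<Rightarrow> 'k poly3 fract vec set" where
  "N f \<equiv> line_part l M f"

lemmas N_iff = line_part_iff[OF _ l_homog l_nonzero]

lemma N_dim: "basic f \<Longrightarrow> s \<in> N f \<Longrightarrow> dim_vec s = rk M"
  using N_iff sections_dim by blast

lemma N_add: "basic f \<Longrightarrow> s \<in> N f \<Longrightarrow> t \<in> N f \<Longrightarrow> s + t \<in> N f"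
  using sections_dim[of s f] sections_dim[of t f]
  by (auto simp: N_iff sections_add Van_add basic_nonzero)

lemma N_smult: "basic f \<Longrightarrow> r \<in> regular_fun f \<Longrightarrow> s \<in> N f \<Longrightarrow> r \<cdot>\<^sub>v s \<in> N f"
  using sections_dim[of s f] by (auto simp: N_iff sections_smult regular_fun_Van)

lemma minus_one_regular: "basic f \<Longrightarrow> - 1 \<in> regular_fun f"
proof -
  assume "basic f"
  then obtain e where "f \<in> homog e" by (auto simp: basic_def)
  moreover have "- 1 \<in> homog (int 0 * e)" using homog_uminus[OF homog_one] by simp
  moreover have "- 1 = Fract (- 1) (f ^ 0)"
    by (simp add: fract_collapse flip: minus_fract)
  ultimately show ?thesis unfolding regular_fun_def by blast
qed

lemma diff_eq: "dim_vec s = dim_vec t \<Longrightarrow> s - t = s + (- 1) \<cdot>\<^sub>v (t :: 'k poly3 fract vec)"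
  by (intro eq_vecI) auto

lemma sections_diff:
  "basic f \<Longrightarrow> s \<in> sections M f \<Longrightarrow> t \<in> sections M f \<Longrightarrow> s - t \<in> sections M f"
  using diff_eq[of s t] sections_dim[of s f] sections_dim[of t f]
  by (simp add: sections_add sections_smult minus_one_regular)

lemma N_diff: "basic f \<Longrightarrow> s \<in> N f \<Longrightarrow> t \<in> N f \<Longrightarrow> s - t \<in> N f"
  using diff_eq[of s t] N_dim[of f s] N_dim[of f t]
  by (simp add: N_add N_smult minus_one_regular)

lemma N_zero: "0\<^sub>v (rk M) \<in> N f"
  by (rule line_part.zero)

lemma N_mono: "basic f \<Longrightarrow> basic h \<Longrightarrow> f dvd h ^ n \<Longrightarrow> s \<in> N f \<Longrightarrow> s \<in> N h"
  using Van_mono[of f h n _ l] by (auto simp: N_iff basic_nonzero intro: sections_mono)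

lemma in_coset_iff:
  assumes "basic f" "s \<in> sections M f"
  shows "t \<in> coset (N f) s \<longleftrightarrow> dim_vec t = rk M \<and> t - s \<in> N f"
proof
  assume "t \<in> coset (N f) s"
  then obtain n where n: "n \<in> N f" "t = s + n" by (auto simp: coset_def)
  then have "t - s = n" "dim_vec t = rk M"
    using assms N_dim[of f n] sections_dim[of s f] by (auto intro!: eq_vecI)
  then show "dim_vec t = rk M \<and> t - s \<in> N f" using n by simp
next
  assume "dim_vec t = rk M \<and> t - s \<in> N f"
  moreover from this have "t = s + (t - s)"
    using assms sections_dim[of s f] by (intro eq_vecI) auto
  ultimately show "t \<in> coset (N f) s" unfolding coset_def by blast
qed

lemma coset_eq_iff:
  assumes f: "basic f" and s: "s \<in> sections M f" and t: "t \<in> sections M f"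
  shows "coset (N f) s = coset (N f) t \<longleftrightarrow> s - t \<in> N f"
proof
  assume eq: "coset (N f) s = coset (N f) t"
  have "s \<in> coset (N f) s"
  proof -
    have "s - s = 0\<^sub>v (rk M)" using sections_dim[OF s] by auto
    then show ?thesis using f s sections_dim[OF s] N_zero by (simp add: in_coset_iff)
  qed
  then show "s - t \<in> N f" using eq f t by (simp add: in_coset_iff)
next
  assume st: "s - t \<in> N f"
  have "r - s \<in> N f \<longleftrightarrow> r - t \<in> N f" if r: "dim_vec r = rk M" for r
  proof -
    have "r - t = (r - s) + (s - t)" "r - s = (r - t) - (s - t)"
      using r sections_dim[OF s] sections_dim[OF t] by (auto intro!: eq_vecI)
    then show ?thesis using N_add[OF f _ st] N_diff[OF f _ st] by metis
  qed
  then show "coset (N f) s = coset (N f) t"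
    using f s t by (auto simp: in_coset_iff)
qed

lemma coset_add_coset:
  assumes f: "basic f" and s: "s \<in> sections M f" and t: "t \<in> sections M f"
  shows "coset_add (coset (N f) s) (coset (N f) t) = coset (N f) (s + t)"
proof (intro equalityI subsetI)
  fix r assume "r \<in> coset_add (coset (N f) s) (coset (N f) t)"
  then obtain m n where mn: "m \<in> N f" "n \<in> N f" "r = (s + m) + (t + n)"
    by (auto simp: coset_add_def coset_def)
  then have "r = (s + t) + (m + n)"
    using N_dim[OF f mn(1)] N_dim[OF f mn(2)] sections_dim[OF s] sections_dim[OF t]
    by (auto intro!: eq_vecI)
  then show "r \<in> coset (N f) (s + t)"
    using N_add[OF f mn(1,2)] by (auto simp: coset_def)
next
  fix r assume "r \<in> coset (N f) (s + t)"
  then obtain n where n: "n \<in> N f" "r = (s + t) + n" by (auto simp: coset_def)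
  then have "r = (s + 0\<^sub>v (rk M)) + (t + n)"
    using N_dim[OF f n(1)] sections_dim[OF s] sections_dim[OF t] by (auto intro!: eq_vecI)
  then show "r \<in> coset_add (coset (N f) s) (coset (N f) t)"
    using n N_zero unfolding coset_add_def coset_def by blast
qed

lemma coset_smult_coset:
  assumes f: "basic f" and r: "r \<in> regular_fun f" and s: "s \<in> sections M f"
  shows "coset_smult (N f) r (coset (N f) s) = coset (N f) (r \<cdot>\<^sub>v s)"
proof (intro equalityI subsetI)
  fix t assume "t \<in> coset_smult (N f) r (coset (N f) s)"
  then obtain m n where mn: "m \<in> N f" "n \<in> N f" "t = r \<cdot>\<^sub>v (s + m) + n"
    by (auto simp: coset_smult_def coset_def)
  then have "t = r \<cdot>\<^sub>v s + (r \<cdot>\<^sub>v m + n)"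
    using N_dim[OF f mn(1)] N_dim[OF f mn(2)] sections_dim[OF s]
    by (auto intro!: eq_vecI simp: algebra_simps)
  then show "t \<in> coset (N f) (r \<cdot>\<^sub>v s)"
    using N_add[OF f N_smult[OF f r mn(1)] mn(2)] by (auto simp: coset_def)
next
  fix t assume "t \<in> coset (N f) (r \<cdot>\<^sub>v s)"
  then obtain n where n: "n \<in> N f" "t = r \<cdot>\<^sub>v s + n" by (auto simp: coset_def)
  then have "t = r \<cdot>\<^sub>v (s + 0\<^sub>v (rk M)) + n"
    using N_dim[OF f n(1)] sections_dim[OF s] by (auto intro!: eq_vecI)
  then show "t \<in> coset_smult (N f) r (coset (N f) s)"
    using n N_zero unfolding coset_smult_def coset_def by blast
qed

lemma line_res_coset:
  assumes f: "basic f" and h: "basic h" and fh: "f dvd h ^ n" and s: "s \<in> sections M f"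
  shows "line_res l M h (coset (N f) s) = coset (N h) s"
proof (intro equalityI subsetI)
  fix r assume "r \<in> line_res l M h (coset (N f) s)"
  then obtain m n' where mn: "m \<in> N f" "n' \<in> N h" "r = (s + m) + n'"
    by (auto simp: line_res_def coset_add_def coset_def)
  then have "r = s + (m + n')"
    using N_dim[OF f mn(1)] N_dim[OF h mn(2)] sections_dim[OF s] by (auto intro!: eq_vecI)
  then show "r \<in> coset (N h) s"
    using N_add[OF h N_mono[OF f h fh mn(1)] mn(2)] by (auto simp: coset_def)
next
  fix r assume "r \<in> coset (N h) s"
  then obtain n' where n': "n' \<in> N h" "r = s + n'" by (auto simp: coset_def)
  then have "r = (s + 0\<^sub>v (rk M)) + n'"
    using N_dim[OF h n'(1)] sections_dim[OF s] by (auto intro!: eq_vecI)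
  then show "r \<in> line_res l M h (coset (N f) s)"
    using n' N_zero unfolding line_res_def coset_add_def coset_def by blast
qed

lemma line_sectionsI: "s \<in> sections M f \<Longrightarrow> coset (N f) s \<in> line_sections l M f"
  by (simp add: line_sections_def)

end

text \<open>
  An isomorphism over the line may be given by a relation between sections that is linear, total on
  both sides, local, and relates exactly the sections vanishing on the line to each other.
\<close>

lemma line_iso_of_relation:
  fixes M M' :: "('k::field) graded_mod" and l :: "'k poly3"
    and Rel :: "'k poly3 \<Rightarrow> 'k poly3 fract vec \<Rightarrow> 'k poly3 fract vec \<Rightarrow> bool"
  assumes "line_module M l" "line_module M' l"
    and sub: "\<And>f s t. basic f \<Longrightarrow> Rel f s t \<Longrightarrow> s \<in> sections M f \<and> t \<in> sections M' f"
    and left_total: "\<And>f s. basic f \<Longrightarrow> s \<in> sections M f \<Longrightarrow> \<exists>t. Rel f s t"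
    and right_total: "\<And>f t. basic f \<Longrightarrow> t \<in> sections M' f \<Longrightarrow> \<exists>s. Rel f s t"
    and add: "\<And>f s t s' t'. basic f \<Longrightarrow> Rel f s t \<Longrightarrow> Rel f s' t' \<Longrightarrow> Rel f (s + s') (t + t')"
    and smult: "\<And>f r s t. basic f \<Longrightarrow> r \<in> regular_fun f \<Longrightarrow> Rel f s t \<Longrightarrow>
        Rel f (r \<cdot>\<^sub>v s) (r \<cdot>\<^sub>v t)"
    and ker: "\<And>f s t. basic f \<Longrightarrow> Rel f s t \<Longrightarrow> s \<in> line_part l M f \<longleftrightarrow> t \<in> line_part l M' f"
    and triv: "\<And>f s t. basic f \<Longrightarrow> s \<in> line_part l M f \<Longrightarrow> t \<in> line_part l M' f \<Longrightarrow> Rel f s t"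
    and res: "\<And>f h n s t. basic f \<Longrightarrow> basic h \<Longrightarrow> f dvd h ^ n \<Longrightarrow> Rel f s t \<Longrightarrow> Rel h s t"
  shows "line_iso l M M'"
proof -
  interpret M: line_module M l by fact
  interpret M': line_module M' l by fact
  define \<phi> where "\<phi> = (\<lambda>f A. {t. \<exists>s\<in>A. Rel f s t})"
  have diff: "Rel f (s - s') (t - t')" if f: "basic f" and R: "Rel f s t" "Rel f s' t'" for f s s' t t'
  proof -
    have "dim_vec s = rk M" "dim_vec s' = rk M" "dim_vec t = rk M'" "dim_vec t' = rk M'"
      using sub[OF f R(1)] sub[OF f R(2)] M.sections_dim M'.sections_dim by auto
    then show ?thesis
      using add[OF f R(1) smult[OF f M.minus_one_regular[OF f] R(2)]]
      by (simp add: M.diff_eq)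
  qed
  have \<phi>: "\<phi> f (coset (M.N f) s) = coset (M'.N f) t" if f: "basic f" and R: "Rel f s t" for f s t
  proof (intro equalityI subsetI)
    have st: "s \<in> sections M f" "t \<in> sections M' f" using sub[OF f R] by auto
    note dims = M.sections_dim[OF st(1)] M'.sections_dim[OF st(2)]
    {
      fix t' assume "t' \<in> \<phi> f (coset (M.N f) s)"
      then obtain n where n: "n \<in> M.N f" "Rel f (s + n) t'" by (auto simp: \<phi>_def coset_def)
      have "(s + n) - s = n" using dims M.N_dim[OF f n(1)] by (auto intro!: eq_vecI)
      then have "t' - t \<in> M'.N f" using ker[OF f diff[OF f n(2) R]] n(1) by simp
      moreover have "dim_vec t' = rk M'"
        using sub[OF f n(2)] M'.sections_dim by blast
      ultimately show "t' \<in> coset (M'.N f) t" using f st by (simp add: M'.in_coset_iff)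
    next
      fix t' assume "t' \<in> coset (M'.N f) t"
      then obtain n where n: "n \<in> M'.N f" "t' = t + n" by (auto simp: coset_def)
      have "Rel f (s + 0\<^sub>v (rk M)) t'"
        unfolding n(2) by (intro add[OF f R] triv[OF f] M.N_zero n(1))
      then show "t' \<in> \<phi> f (coset (M.N f) s)"
        using M.N_zero unfolding \<phi>_def coset_def by blast
    }
  qed
  have sec: "\<exists>s t. A = coset (M.N f) s \<and> Rel f s t" if "basic f" "A \<in> line_sections l M f" for f A
    using that left_total by (auto simp: line_sections_def)
  show ?thesis
    unfolding line_iso_def
  proof (intro exI[of _ \<phi>] conjI allI impI)
    fix f :: "'k poly3" assume f: "basic f"
    show "bij_betw (\<phi> f) (line_sections l M f) (line_sections l M' f)"
      unfolding bij_betw_def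
    proof
      show "inj_on (\<phi> f) (line_sections l M f)"
      proof (rule inj_onI)
        fix A B assume "A \<in> line_sections l M f" "B \<in> line_sections l M f" and eq: "\<phi> f A = \<phi> f B"
        then obtain s t s' t' where R: "A = coset (M.N f) s" "Rel f s t"
          "B = coset (M.N f) s'" "Rel f s' t'" using sec[OF f] by meson
        have "t - t' \<in> M'.N f"
          using eq R \<phi>[OF f] M'.coset_eq_iff[OF f] sub[OF f] by metis
        then have "s - s' \<in> M.N f" using ker[OF f diff[OF f R(2) R(4)]] by simp
        then show "A = B" using R M.coset_eq_iff[OF f] sub[OF f] by metis
      qed
      show "\<phi> f ` line_sections l M f = line_sections l M' f"
      proof (intro equalityI subsetI)
        fix B assume "B \<in> \<phi> f ` line_sections l M f"
        then obtain s t where "B = \<phi> f (coset (M.N f) s)" "Rel f s t" using sec[OF f] by blast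
        then show "B \<in> line_sections l M' f"
          using \<phi>[OF f] sub[OF f] M'.line_sectionsI by metis
      next
        fix B assume "B \<in> line_sections l M' f"
        then obtain s t where "B = coset (M'.N f) t" "Rel f s t"
          using right_total[OF f] unfolding line_sections_def by blast
        then show "B \<in> \<phi> f ` line_sections l M f"
          using \<phi>[OF f] sub[OF f] M.line_sectionsI by blast
      qed
    qed
    show "\<forall>A\<in>line_sections l M f. \<forall>B\<in>line_sections l M f.
        \<phi> f (coset_add A B) = coset_add (\<phi> f A) (\<phi> f B)"
    proof (intro ballI)
      fix A B assume "A \<in> line_sections l M f" "B \<in> line_sections l M f"
      then obtain s t s' t' where R: "A = coset (M.N f) s" "Rel f s t"
          "B = coset (M.N f) s'" "Rel f s' t'" using sec[OF f] by meson
      note st = sub[OF f R(2)] sub[OF f R(4)]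
      have "\<phi> f (coset_add A B) = \<phi> f (coset (M.N f) (s + s'))"
        using st by (simp add: R M.coset_add_coset[OF f])
      also have "\<dots> = coset (M'.N f) (t + t')" using \<phi>[OF f add[OF f R(2) R(4)]] .
      also have "\<dots> = coset_add (\<phi> f A) (\<phi> f B)"
        using st by (simp add: R(1,3) \<phi>[OF f R(2)] \<phi>[OF f R(4)] M'.coset_add_coset[OF f])
      finally show "\<phi> f (coset_add A B) = coset_add (\<phi> f A) (\<phi> f B)" .
    qed
    show "\<forall>r\<in>regular_fun f. \<forall>A\<in>line_sections l M f.
        \<phi> f (coset_smult (line_part l M f) r A) = coset_smult (line_part l M' f) r (\<phi> f A)"
    proof (intro ballI)
      fix r A assume r: "r \<in> regular_fun f" and "A \<in> line_sections l M f"
      then obtain s t where R: "A = coset (M.N f) s" "Rel f s t" using sec[OF f] by meson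
      note st = sub[OF f R(2)]
      have "\<phi> f (coset_smult (M.N f) r A) = \<phi> f (coset (M.N f) (r \<cdot>\<^sub>v s))"
        using st by (simp add: R(1) M.coset_smult_coset[OF f r])
      also have "\<dots> = coset (M'.N f) (r \<cdot>\<^sub>v t)" using \<phi>[OF f smult[OF f r R(2)]] .
      also have "\<dots> = coset_smult (M'.N f) r (\<phi> f A)"
        using st by (simp add: R(1) \<phi>[OF f R(2)] M'.coset_smult_coset[OF f r])
      finally show "\<phi> f (coset_smult (M.N f) r A) = coset_smult (M'.N f) r (\<phi> f A)" .
    qed
  next
    fix f h :: "'k poly3" assume fh: "basic f \<and> basic h \<and> (\<exists>k. f dvd h ^ k)"
    then obtain k where f: "basic f" and h: "basic h" and k: "f dvd h ^ k" by blast
    show "\<forall>A\<in>line_sections l M f. \<phi> h (line_res l M h A) = line_res l M' h (\<phi> f A)"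
    proof
      fix A assume "A \<in> line_sections l M f"
      then obtain s t where R: "A = coset (M.N f) s" "Rel f s t" using sec[OF f] by meson
      note st = sub[OF f R(2)]
      have "\<phi> h (line_res l M h A) = \<phi> h (coset (M.N h) s)"
        using st by (simp add: R(1) M.line_res_coset[OF f h k])
      also have "\<dots> = coset (M'.N h) t" using \<phi>[OF h res[OF f h k R(2)]] .
      also have "\<dots> = line_res l M' h (\<phi> f A)"
        using st by (simp add: R(1) \<phi>[OF f R(2)] M'.line_res_coset[OF f h k])
      finally show "\<phi> h (line_res l M h A) = line_res l M' h (\<phi> f A)" .
    qed
  qed
qed

section \<open>The syzygy bundle on a line\<close>

definition gen_monoms :: "nat \<Rightarrow> nat \<Rightarrow> nat \<Rightarrow> nat \<Rightarrow> nat \<Rightarrow> nat \<Rightarrow> monom3 list" where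
  "gen_monoms a b c \<alpha> \<beta> \<gamma> = [mon \<alpha> \<beta> \<gamma>, mon a 0 0, mon 0 b 0, mon 0 0 c]"

lemma lin_nonzero: "w \<noteq> 0 \<Longrightarrow> lin u v w \<noteq> 0"
proof
  assume w: "w \<noteq> 0" and "lin u v w = 0"
  then have "Poly_Mapping.lookup (lin u v w) (mon 0 0 1) = 0" by simp
  then show False using w by (simp add: lin_def lookup_add lookup_single mon_eq_iff)
qed

text \<open>
  The bundle \<open>M\<close> of syzygies of the four monomials, the sum \<open>F\<close> of three copies of \<open>\<O>(-d)\<close>, and a line
  on which \<open>x\<close> and \<open>y\<close> are coordinates.
\<close>

locale four_forms = line_coordinates u v w for u v w :: "'k::field" +
  fixes a b c \<alpha> \<beta> \<gamma> d :: nat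
  assumes deg_le: "\<alpha> + \<beta> + \<gamma> \<le> d" "a \<le> d" "b \<le> d" "c \<le> d"
    and sum_deg: "3 * d = a + b + c + \<alpha> + \<beta> + \<gamma>"
    and d_pos: "d \<ge> 1"
begin

abbreviation G :: "monom3 list" where "G \<equiv> gen_monoms a b c \<alpha> \<beta> \<gamma>"
abbreviation I :: "'k poly3 set" where "I \<equiv> monomial_ideal G"

definition gen :: "nat \<Rightarrow> 'k poly3" where "gen i = Poly_Mapping.single (G ! i) 1"
definition e :: "nat \<Rightarrow> nat" where "e i = tdeg (G ! i)"
abbreviation gbar :: "nat \<Rightarrow> 'k poly" where "gbar i \<equiv> rho (gen i)"

definition M :: "'k graded_mod" where "M = syz (map (\<lambda>m. (tdeg m, Poly_Mapping.single m 1)) G)"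
definition F :: "'k graded_mod" where "F = free_mod [- int d, - int d, - int d]"

lemma length_G [simp]: "length G = 4"
  by (simp add: gen_monoms_def)

lemma e_simps: "e 0 = \<alpha> + \<beta> + \<gamma>" "e 1 = a" "e (Suc 0) = a" "e 2 = b" "e 3 = c"
  by (simp_all add: e_def gen_monoms_def)

lemma gen_homog: "gen i \<in> homog (int (e i))"
  by (simp add: gen_def e_def)

lemma gen_1: "gen 1 = Var VX ^ a" and gen_2: "gen 2 = Var VY ^ b"
  by (simp_all add: gen_def gen_monoms_def Var_power single_var_mon)

sublocale gens: line_generators gbar e d
proof
  show "gbar i \<in> Sdeg (int (e i))" for i by (rule rho_homog[OF gen_homog])
  have "\<forall>i<4. e i \<le> d" using deg_le by (simp add: all4 e_simps)
  then show "i < 4 \<Longrightarrow> e i \<le> d" for i by blast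
  show "gbar 2 = 1" by (simp add: gen_2 rho_power)
qed

lemma l_homog: "l \<in> homog 1"
  by (rule lin_homog)

lemma mult_surj_iff_gens_surj: "mult_surj I l (int d - 2) \<longleftrightarrow> gens.gens_surj (int d - 1)"
proof
  assume surj: "mult_surj I l (int d - 2)"
  show "gens.gens_surj (int d - 1)"
    unfolding gens.gens_surj_def
  proof
    fix s :: "'k poly" assume s: "s \<in> Sdeg (int d - 1)"
    let ?p = "lift (int d - 1) s"
    have p: "?p \<in> homog (int d - 2 + 1)" using lift_homog[of "int d - 1" s] by simp
    obtain q where q: "q \<in> homog (int d - 2)" "?p - l * q \<in> I"
      using surj p unfolding mult_surj_def by blast
    have "?p - l * q \<in> homog (int d - 2 + 1)"
      by (rule homog_diff[OF p homog_linear_mult[OF l_homog q(1)]])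
    then obtain k where k: "\<And>i. i < 4 \<Longrightarrow> k i \<in> homog (int d - 1 - int (e i))"
      "?p - l * q = (\<Sum>i<4. k i * gen i)"
      using monomial_ideal_homog_decomp[OF _ q(2), of "int d - 1"] by (auto simp: gen_def e_def)
    have "s = rho (?p - l * q)" using rho_lift[OF s] by (simp add: rho_diff rho_mult)
    also have "\<dots> = (\<Sum>i<4. rho (k i) * gbar i)" by (simp add: k(2) rho_sum rho_mult)
    finally show "\<exists>k. (\<forall>i<4. k i \<in> Sdeg (int d - 1 - int (e i))) \<and> (\<Sum>i<4. k i * gbar i) = s"
      using k(1) rho_homog by (intro exI[of _ "\<lambda>i. rho (k i)"]) auto
  qed
next
  assume surj: "gens.gens_surj (int d - 1)"
  show "mult_surj I l (int d - 2)"
    unfolding mult_surj_def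
  proof
    fix p :: "'k poly3" assume "p \<in> homog (int d - 2 + 1)"
    then have p: "p \<in> homog (int d - 1)" by simp
    then obtain n where n: "\<And>i. i < 4 \<Longrightarrow> n i \<in> Sdeg (int d - 1 - int (e i))"
      "(\<Sum>i<4. n i * gbar i) = rho p"
      using surj rho_homog[OF p] unfolding gens.gens_surj_def by blast
    define k where "k i = lift (int d - 1 - int (e i)) (n i)" for i
    have "p - (\<Sum>i<4. k i * gen i) \<in> homog (int d - 1)"
      unfolding k_def by (intro homog_diff p homog_sum homog_mult'[OF lift_homog gen_homog]) simp
    moreover have "rho (p - (\<Sum>i<4. k i * gen i)) = 0"
      using n by (simp add: rho_diff rho_sum rho_mult k_def rho_lift)
    ultimately obtain q where "q \<in> homog (int d - 1 - 1)" "p - (\<Sum>i<4. k i * gen i) = l * q"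
      using rho_kernel by blast
    moreover have "(\<Sum>i<4. k i * gen i) \<in> I"
    proof (intro monomial_ideal_sum monomial_ideal_mult)
      fix i :: nat assume "i \<in> {..<4}"
      then show "gen i \<in> I"
        unfolding gen_def monomial_ideal_single
        by (auto simp: divides_def intro!: bexI[of _ "G ! i"] exI[of _ 0])
    qed
    moreover have "p - l * q = (\<Sum>i<4. k i * gen i)"
      using \<open>p - (\<Sum>i<4. k i * gen i) = l * q\<close> by (simp add: algebra_simps)
    ultimately show "\<exists>q\<in>homog (int d - 2). p - l * q \<in> I"
      by (intro bexI[of _ q]) auto
  qed
qed

lemma rk_M [simp]: "rk M = 4"
  by (simp add: rk_def M_def syz_def)

lemma shifts_M: "i < 4 \<Longrightarrow> shifts M ! i = - int (e i)"
  by (simp add: M_def syz_def e_def)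

lemma elems_M: "x \<in> elems M \<longleftrightarrow> dim_vec x = 4 \<and> (\<Sum>i<4. x $ i * gen i) = 0"
proof -
  have "x \<bullet> vec_of_list (map snd (map (\<lambda>m. (tdeg m, Poly_Mapping.single m (1::'k))) G)) =
      (\<Sum>i<4. x $ i * gen i)"
    by (simp add: scalar_prod_def gen_def lessThan_atLeast0 vec_of_list_index)
  then show ?thesis by (simp add: M_def syz_def carrier_dim_vec del: carrier_vecD)
qed

lemma rk_F [simp]: "rk F = 3"
  by (simp add: rk_def F_def free_mod_def)

lemma shifts_F: "i < 3 \<Longrightarrow> shifts F ! i = - int d"
  by (auto simp: F_def free_mod_def less_Suc_eq numeral_eq_Suc)

lemma elems_F: "x \<in> elems F \<longleftrightarrow> dim_vec x = 3"
  by (simp add: F_def free_mod_def carrier_dim_vec numeral_3_eq_3 del: carrier_vecD)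

sublocale M: line_module M l
proof
  show "dim_vec x = rk M" if "x \<in> elems M" for x using that by (simp add: elems_M)
  show "x + y \<in> elems M" if "x \<in> elems M" "y \<in> elems M" for x y
    using that by (simp add: elems_M distrib_right sum.distrib)
  have scale: "(\<Sum>i<4. (r \<cdot>\<^sub>v x) $ i * gen i) = r * (\<Sum>i<4. x $ i * gen i)"
    if "dim_vec x = 4" for r x
    using that by (simp add: sum_distrib_left mult.assoc)
  show "r \<cdot>\<^sub>v x \<in> elems M" if "x \<in> elems M" for r x
    using that scale by (simp add: elems_M)
  show "elems M \<noteq> {}" using elems_M[of "0\<^sub>v 4"] by auto
  show "x \<in> elems M" if "r \<noteq> 0" "dim_vec x = rk M" "r \<cdot>\<^sub>v x \<in> elems M" for r x
    using that scale[of x r] by (simp add: elems_M)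
  show "l \<in> homog 1" by (rule lin_homog)
  show "l \<noteq> 0" using w_nonzero by (rule lin_nonzero)
qed

sublocale F: line_module F l
proof
  show "elems F \<noteq> {}" using elems_F[of "0\<^sub>v 3"] by auto
  show "l \<in> homog 1" by (rule lin_homog)
  show "l \<noteq> 0" using w_nonzero by (rule lin_nonzero)
qed (simp_all add: elems_F)

lemma piece_M: "x \<in> piece M j \<longleftrightarrow>
    dim_vec x = 4 \<and> (\<Sum>i<4. x $ i * gen i) = 0 \<and> (\<forall>i<4. x $ i \<in> homog (j - int (e i)))"
  by (auto simp: piece_def elems_M shifts_M)

lemma piece_F: "x \<in> piece F j \<longleftrightarrow> dim_vec x = 3 \<and> (\<forall>i<3. x $ i \<in> homog (j - int d))"
  by (auto simp: piece_def elems_F shifts_F)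

lemma Van_imp_rho:
  assumes "Fract p q \<in> Van l f" "q \<noteq> 0" "f \<noteq> 0"
  shows "rho f = 0 \<or> rho p = 0"
proof -
  obtain g m where "Fract p q = Fract (l * g) (f ^ m)" using assms by (auto simp: Van_def)
  then have "p * f ^ m = l * g * q" using assms by (simp add: eq_fract)
  then have "rho (p * f ^ m) = rho (l * g * q)" by simp
  then show ?thesis by (auto simp: rho_mult rho_power)
qed

text \<open>
  Vanishing on the line is tested on numerators. If \<open>f\<close> itself vanishes on the line, the chart misses
  the line and every section vanishes.
\<close>

lemma Van_iff_rho:
  assumes f: "basic f" and p: "p \<in> homog j"
  shows "Fract p (f ^ k) \<in> Van l f \<longleftrightarrow> rho f = 0 \<or> rho p = 0"
proof
  assume "Fract p (f ^ k) \<in> Van l f"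
  then show "rho f = 0 \<or> rho p = 0"
    using Van_imp_rho basic_nonzero[OF f] by simp
next
  obtain n where n: "f \<in> homog n" using f by (auto simp: basic_def)
  assume "rho f = 0 \<or> rho p = 0"
  then show "Fract p (f ^ k) \<in> Van l f"
  proof
    assume "rho p = 0"
    then obtain g where "p = l * g" using rho_kernel[OF p] by blast
    then show ?thesis by (simp add: VanI)
  next
    assume "rho f = 0"
    then obtain g where g: "f = l * g" using rho_kernel[OF n] by blast
    have "Fract p (f ^ k) = Fract (f ^ 1 * p) (f ^ (k + 1))"
      by (rule Fract_power_expand[OF basic_nonzero[OF f]])
    also have "f ^ 1 * p = l * (g * p)" using g by (simp add: mult.assoc)
    finally show ?thesis by (simp only: VanI)
  qed
qed

text \<open>
  Since \<open>I\<close> contains powers of all variables. In particular, a power of any form of positive degree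
  lies in \<open>I\<close>.
\<close>

lemma high_degree_in_ideal:
  assumes "p \<in> homog j" "int (a + b + c) \<le> j"
  shows "p \<in> I"
  unfolding monomial_ideal_def
proof (intro CollectI ballI)
  fix m assume m: "m \<in> Poly_Mapping.keys p"
  obtain i1 i2 i3 where mon: "m = mon i1 i2 i3" by (rule monom3_cases)
  have "int (i1 + i2 + i3) = j" using assms(1) m by (auto simp: homog_def mon)
  then have "a \<le> i1 \<or> b \<le> i2 \<or> c \<le> i3" using assms(2) by linarith
  then show "\<exists>g\<in>set G. divides g m" by (auto simp: gen_monoms_def mon divides_mon)
qed

lemma common_denominator:
  assumes f: "basic f" "f \<in> homog n" and s: "s \<in> sections M f" and t: "t \<in> sections F f"
  obtains k x p where "x \<in> piece M (int k * n)" "s = frac_vec f k x"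
    "p \<in> piece F (int k * n)" "t = frac_vec f k p"
proof -
  note f0 = basic_nonzero[OF f(1)]
  obtain k x where x: "x \<in> piece M (int k * n)" "s = frac_vec f k x"
    using M.sectionsE[OF s f0 f(2)] by blast
  obtain m p where p: "p \<in> piece F (int m * n)" "t = frac_vec f m p"
    using F.sectionsE[OF t f0 f(2)] by blast
  show thesis
  proof
    show "f ^ m \<cdot>\<^sub>v x \<in> piece M (int (k + m) * n)"
      by (rule M.piece_smult[OF homog_power[OF f(2)] x(1)]) (simp add: algebra_simps)
    show "f ^ k \<cdot>\<^sub>v p \<in> piece F (int (k + m) * n)"
      by (rule F.piece_smult[OF homog_power[OF f(2)] p(1)]) (simp add: algebra_simps)
    show "s = frac_vec f (k + m) (f ^ m \<cdot>\<^sub>v x)" unfolding x(2) by (rule frac_vec_expand[OF f0])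
    show "t = frac_vec f (k + m) (f ^ k \<cdot>\<^sub>v p)"
      unfolding p(2) by (subst add.commute) (rule frac_vec_expand[OF f0])
  qed
qed

lemma frac_vec_in_N_iff:
  assumes f: "basic f" "f \<in> homog n"
  shows "x \<in> piece M (int k * n) \<Longrightarrow>
      frac_vec f k x \<in> M.N f \<longleftrightarrow> rho f = 0 \<or> (\<forall>i<4. rho (x $ i) = 0)"
    and "p \<in> piece F (int k * n) \<Longrightarrow>
      frac_vec f k p \<in> F.N f \<longleftrightarrow> rho f = 0 \<or> (\<forall>i<3. rho (p $ i) = 0)"
proof -
  assume x: "x \<in> piece M (int k * n)"
  have "frac_vec f k x $ i \<in> Van l f \<longleftrightarrow> rho f = 0 \<or> rho (x $ i) = 0" if "i < 4" for i
    using Van_iff_rho[OF f(1)] x that by (auto simp: piece_M)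
  then show "frac_vec f k x \<in> M.N f \<longleftrightarrow> rho f = 0 \<or> (\<forall>i<4. rho (x $ i) = 0)"
    using M.sectionsI[OF f(2) x] by (auto simp: M.N_iff[OF f(1)])
next
  assume p: "p \<in> piece F (int k * n)"
  have "frac_vec f k p $ i \<in> Van l f \<longleftrightarrow> rho f = 0 \<or> rho (p $ i) = 0" if "i < 3" for i
    using Van_iff_rho[OF f(1)] p that by (auto simp: piece_F)
  then show "frac_vec f k p \<in> F.N f \<longleftrightarrow> rho f = 0 \<or> (\<forall>i<3. rho (p $ i) = 0)"
    using F.sectionsI[OF f(2) p] by (auto simp: F.N_iff[OF f(1)])
qed

text \<open>
  A section of \<open>M\<close> restricts to a relation between the restricted generators, and its coordinates in
  the basis \<open>U\<close> are the corresponding section of \<open>F\<close>. In general the basis elements do not lift to global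
  syzygies, so the isomorphism is given by the relation that \<open>s - V t\<close> vanishes on the line, where the
  matrix \<open>V\<close> lifts \<open>U\<close>.
\<close>

proposition line_iso_of_gens_bij:
  assumes inj: "gens.gens_inj (int d - 1)" and surj: "gens.gens_surj (int d - 1)"
  shows "line_iso l M F"
proof -
  obtain U where U: "gens.syz_basis U" using gens.syz_basis_exists[OF surj] by blast
  have U_syz: "U k \<in> gens.line_syz (int d)" if "k < 3" for k
    using U that by (auto simp: gens.syz_basis_def)
  define V where "V k i = lift (int d - int (e i)) (U k i)" for k i
  have V_homog: "V k i \<in> homog (int d - int (e i))" for k i
    by (simp add: V_def lift_homog)
  have rho_V: "rho (V k i) = U k i" if "k < 3" "i < 4" for k i
    using U_syz[OF that(1)] that(2) unfolding V_def gens.line_syz_def by (intro rho_lift) auto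
  define err where "err s t i = s $ i - (\<Sum>k<3. Fract (V k i) 1 * t $ k)"
    for s t :: "'k poly3 fract vec" and i
  define Rel where "Rel f s t \<longleftrightarrow> s \<in> sections M f \<and> t \<in> sections F f \<and>
      (\<forall>i<4. err s t i \<in> Van l f)" for f s t
  have err_frac: "err (frac_vec f k x) (frac_vec f k p) i =
      Fract (x $ i - (\<Sum>j<3. V j i * p $ j)) (f ^ k)"
    if "f \<noteq> 0" "dim_vec x = 4" "dim_vec p = 3" "i < 4" for f k x p i
    using that by (simp add: err_def sum3 eq_fract algebra_simps)
  have Rel_frac: "Rel f (frac_vec f k x) (frac_vec f k p) \<longleftrightarrow>
      rho f = 0 \<or> (\<forall>i<4. rho (x $ i) = (\<Sum>j<3. rho (p $ j) * U j i))"
    if f: "basic f" "f \<in> homog n" and x: "x \<in> piece M (int k * n)" and p: "p \<in> piece F (int k * n)"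
    for f k n x p
  proof -
    have "err (frac_vec f k x) (frac_vec f k p) i \<in> Van l f \<longleftrightarrow>
        rho f = 0 \<or> rho (x $ i) = (\<Sum>j<3. rho (p $ j) * U j i)" if i: "i < 4" for i
    proof -
      have "V j i * p $ j \<in> homog (int k * n - int (e i))" if "j < 3" for j
        using p that by (intro homog_mult'[OF V_homog, of "p $ j" "int k * n - int d"])
          (auto simp: piece_F)
      then have "x $ i - (\<Sum>j<3. V j i * p $ j) \<in> homog (int k * n - int (e i))"
        using x i by (intro homog_diff homog_sum) (auto simp: piece_M)
      moreover have "rho (x $ i - (\<Sum>j<3. V j i * p $ j)) =
          rho (x $ i) - (\<Sum>j<3. rho (p $ j) * U j i)"
        using i by (simp add: rho_diff rho_sum rho_mult rho_V mult.commute)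
      ultimately show ?thesis
        using x p i basic_nonzero[OF f(1)] Van_iff_rho[OF f(1)]
        by (simp add: err_frac piece_M piece_F)
    qed
    then show ?thesis
      using M.sectionsI[OF f(2) x] F.sectionsI[OF f(2) p] by (auto simp: Rel_def)
  qed
  show ?thesis
  proof (rule line_iso_of_relation[where Rel = Rel])
    show "line_module M l" "line_module F l" by unfold_locales
  next
    fix f s t assume "basic f" "Rel f s t"
    then show "s \<in> sections M f \<and> t \<in> sections F f" by (simp add: Rel_def)
  next
    fix f s assume f: "basic f" and s: "s \<in> sections M f"
    obtain n where n: "f \<in> homog n" using f by (auto simp: basic_def)
    obtain k x where x: "x \<in> piece M (int k * n)" "s = frac_vec f k x"
      using M.sectionsE[OF s basic_nonzero[OF f] n] by blast
    have "(\<Sum>i<4. rho (x $ i) * gbar i) = rho (\<Sum>i<4. x $ i * gen i)"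
      by (simp add: rho_sum rho_mult)
    then have "(\<lambda>i. rho (x $ i)) \<in> gens.line_syz (int k * n)"
      using x(1) by (auto simp: gens.line_syz_def piece_M intro!: rho_homog)
    then obtain p where p: "\<forall>j<3. p j \<in> Sdeg (int k * n - int d)"
      "\<forall>i<4. rho (x $ i) = (\<Sum>j<3. p j * U j i)"
      using gens.syz_basis_generates[OF U inj] by blast
    define y where "y = vec 3 (\<lambda>j. lift (int k * n - int d) (p j))"
    have y: "y \<in> piece F (int k * n)" by (simp add: y_def piece_F lift_homog)
    have "Rel f s (frac_vec f k y)"
      unfolding x(2) Rel_frac[OF f n x(1) y] using p by (simp add: y_def rho_lift)
    then show "\<exists>t. Rel f s t" by blast
  next
    fix f t assume f: "basic f" and t: "t \<in> sections F f"
    obtain n where n: "f \<in> homog n" "n > 0"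
      using f homog_unique by (auto simp: basic_def)
    obtain k p where p: "p \<in> piece F (int k * n)" "t = frac_vec f k p"
      using F.sectionsE[OF t basic_nonzero[OF f] n(1)] by blast
    define y where "y i = (\<Sum>j<3. V j i * p $ j)" for i
    have y: "y i \<in> homog (int k * n - int (e i))" for i
      unfolding y_def using p(1)
      by (intro homog_sum homog_mult'[OF V_homog, of _ "int k * n - int d"]) (auto simp: piece_F)
    have rho_y: "rho (y i) = (\<Sum>j<3. rho (p $ j) * U j i)" if "i < 4" for i
      using that by (simp add: y_def rho_sum rho_mult rho_V mult.commute)
    let ?h = "\<Sum>i<4. y i * gen i"
    have "?h \<in> homog (int k * n)"
      by (intro homog_sum homog_mult'[OF y gen_homog]) simp
    moreover have "rho ?h = 0"
    proof -
      have "rho ?h = (\<Sum>i<4. \<Sum>j<3. rho (p $ j) * (U j i * gbar i))"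
        by (simp add: rho_sum rho_mult rho_y sum_distrib_right mult.assoc)
      also have "\<dots> = (\<Sum>j<3. rho (p $ j) * (\<Sum>i<4. U j i * gbar i))"
        by (subst sum.swap) (simp add: sum_distrib_left)
      also have "\<dots> = 0" using U_syz by (auto simp: gens.line_syz_def intro!: sum.neutral)
      finally show ?thesis .
    qed
    ultimately obtain H where H: "H \<in> homog (int k * n - 1)" "?h = l * H"
      using rho_kernel by blast
    \<comment> \<open>The combination of the \<open>V j\<close> is a syzygy only modulo \<open>l\<close>; the defect \<open>l H\<close> is removed after
      multiplying by a power of \<open>f\<close> that brings \<open>H\<close> into the ideal.\<close>
    define m where "m = a + b + c + 1"
    have fH: "f ^ m * H \<in> homog (int (k + m) * n - 1)"
      by (rule homog_mult'[OF homog_power[OF n(1)] H(1)]) (simp add: algebra_simps)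
    have "f ^ m * H \<in> I"
    proof (cases "H = 0")
      case False
      then have "int k * n - 1 \<ge> 0" using H(1) homog_neg[of "int k * n - 1" H] by force
      moreover have "int m * 1 \<le> int m * n" using n(2) by (intro mult_left_mono) auto
      ultimately have "int (a + b + c) \<le> int (k + m) * n - 1"
        by (simp add: m_def algebra_simps)
      then show ?thesis by (rule high_degree_in_ideal[OF fH])
    qed simp
    then obtain q where q: "\<And>i. i < 4 \<Longrightarrow> q i \<in> homog (int (k + m) * n - 1 - int (e i))"
      "f ^ m * H = (\<Sum>i<4. q i * gen i)"
      using monomial_ideal_homog_decomp[OF fH \<open>f ^ m * H \<in> I\<close>] by (auto simp: gen_def e_def)
    define x where "x = vec 4 (\<lambda>i. f ^ m * y i - l * q i)"
    have "(\<Sum>i<4. x $ i * gen i) = f ^ m * ?h - l * (\<Sum>i<4. q i * gen i)"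
      by (simp add: x_def sum_subtractf left_diff_distrib sum_distrib_left mult.assoc)
    also have "\<dots> = 0" by (simp add: H(2) flip: q(2))
    finally have "(\<Sum>i<4. x $ i * gen i) = 0" .
    moreover have "f ^ m * y i - l * q i \<in> homog (int (k + m) * n - int (e i))" if "i < 4" for i
      by (intro homog_diff homog_mult'[OF homog_power[OF n(1)] y]
          homog_mult'[OF l_homog q(1)[OF that]]) (simp_all add: algebra_simps)
    ultimately have "x \<in> piece M (int (k + m) * n)" by (simp add: x_def piece_M)
    moreover have "f ^ m \<cdot>\<^sub>v p \<in> piece F (int (k + m) * n)"
      by (rule F.piece_smult[OF homog_power[OF n(1)] p(1)]) (simp add: algebra_simps)
    ultimately have "Rel f (frac_vec f (k + m) x) (frac_vec f (k + m) (f ^ m \<cdot>\<^sub>v p))"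
      using p(1) by (subst Rel_frac[OF f n(1)])
        (auto simp: x_def piece_F rho_diff rho_mult rho_y sum_distrib_left mult.assoc)
    then show "\<exists>s. Rel f s t"
      unfolding p(2) frac_vec_expand[OF basic_nonzero[OF f], of k p m] by blast
  next
    fix f s t s' t' assume f: "basic f" and R: "Rel f s t" "Rel f s' t'"
    then have "dim_vec s = 4" "dim_vec s' = 4" "dim_vec t = 3" "dim_vec t' = 3"
      using M.sections_dim F.sections_dim by (auto simp: Rel_def)
    then have "err (s + s') (t + t') i = err s t i + err s' t' i" if "i < 4" for i
      using that by (simp add: err_def sum3 algebra_simps)
    then show "Rel f (s + s') (t + t')"
      using R M.sections_add[OF f] F.sections_add[OF f] Van_add[OF basic_nonzero[OF f]]
      by (auto simp: Rel_def)
  next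
    fix f r s t assume f: "basic f" and r: "r \<in> regular_fun f" and R: "Rel f s t"
    then have "dim_vec s = 4" "dim_vec t = 3"
      using M.sections_dim F.sections_dim by (auto simp: Rel_def)
    then have "err (r \<cdot>\<^sub>v s) (r \<cdot>\<^sub>v t) i = r * err s t i" if "i < 4" for i
      using that by (simp add: err_def sum3 algebra_simps)
    then show "Rel f (r \<cdot>\<^sub>v s) (r \<cdot>\<^sub>v t)"
      using R M.sections_smult[OF f r] F.sections_smult[OF f r] regular_fun_Van[OF r]
      by (auto simp: Rel_def)
  next
    fix f s t assume f: "basic f" and R: "Rel f s t"
    obtain n where n: "f \<in> homog n" using f by (auto simp: basic_def)
    obtain k x p where x: "x \<in> piece M (int k * n)" "s = frac_vec f k x"
      and p: "p \<in> piece F (int k * n)" "t = frac_vec f k p"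
      using common_denominator[OF f n] R unfolding Rel_def by metis
    have R': "rho f = 0 \<or> (\<forall>i<4. rho (x $ i) = (\<Sum>j<3. rho (p $ j) * U j i))"
      using R unfolding x(2) p(2) Rel_frac[OF f n x(1) p(1)] .
    show "s \<in> M.N f \<longleftrightarrow> t \<in> F.N f"
      unfolding x(2) p(2) frac_vec_in_N_iff(1)[OF f n x(1)] frac_vec_in_N_iff(2)[OF f n p(1)]
    proof (cases "rho f = 0")
      case False
      then have "\<forall>i<4. rho (x $ i) = (\<Sum>j<3. rho (p $ j) * U j i)" using R' by blast
      moreover have "\<forall>j<3. rho (p $ j) = 0"
        if "\<And>i. i < 4 \<Longrightarrow> (\<Sum>j<3. rho (p $ j) * U j i) = 0"
        using gens.syz_basis_independent[OF U that] by blast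
      ultimately show "(rho f = 0 \<or> (\<forall>i<4. rho (x $ i) = 0)) \<longleftrightarrow>
          (rho f = 0 \<or> (\<forall>i<3. rho (p $ i) = 0))"
        using False by auto
    qed simp
  next
    fix f s t assume f: "basic f" and s: "s \<in> M.N f" and t: "t \<in> F.N f"
    have "Fract (V k i) (f ^ 0) * t $ k \<in> Van l f" if "k < 3" for k i
      using t that by (intro Van_mult) (simp add: F.N_iff[OF f])
    then show "Rel f s t"
      using s t by (auto simp: Rel_def err_def M.N_iff[OF f] F.N_iff[OF f]
          intro!: Van_diff Van_sum basic_nonzero[OF f])
  next
    fix f h k s t assume f: "basic f" and h: "basic h" and fh: "f dvd h ^ k" and R: "Rel f s t"
    show "Rel h s t"
      using R M.sections_mono[OF f h fh] F.sections_mono[OF f h fh]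
        Van_mono[OF fh basic_nonzero[OF h]]
      by (auto simp: Rel_def)
  qed
qed

text \<open>
  A tuple \<open>x\<close> that is a relation modulo \<open>l\<close>, say \<open>\<Sum> x\<^sub>i g\<^sub>i = l h\<close>, is a syzygy after subtracting \<open>l h / g\<^sub>q\<close>
  from its entry \<open>q\<close>, on the chart where \<open>g\<^sub>q\<close> is invertible. Here \<open>g\<^sub>q\<close> is the power \<open>z\<^sup>A\<close> of a
  variable, and the denominator is cleared.
\<close>

definition chart_vec :: "var \<Rightarrow> nat \<Rightarrow> nat \<Rightarrow> (nat \<Rightarrow> 'k poly3) \<Rightarrow> 'k poly3 \<Rightarrow> 'k poly3 vec" where
  "chart_vec z q A x h = vec 4 (\<lambda>i. Var z ^ A * x i - (if i = q then l * h else 0))"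

lemma chart_vec_piece:
  assumes q: "q < 4" and gen_q: "gen q = Var z ^ A" and e_q: "e q = A"
    and x: "\<And>i. i < 4 \<Longrightarrow> x i \<in> homog (int d - 1 - int (e i))"
    and h: "h \<in> homog (int d - 2)" and rel: "(\<Sum>i<4. x i * gen i) = l * h"
  shows "chart_vec z q A x h \<in> piece M (int (A + d - 1))"
proof -
  have "(\<Sum>i<4. chart_vec z q A x h $ i * gen i) =
      Var z ^ A * (\<Sum>i<4. x i * gen i) - (\<Sum>i<4. if i = q then l * h * gen i else 0)"
  proof -
    have "chart_vec z q A x h $ i * gen i =
        Var z ^ A * (x i * gen i) - (if i = q then l * h * gen i else 0)" if "i < 4" for i
      using that by (simp add: chart_vec_def left_diff_distrib mult.assoc)
    then show ?thesis by (simp add: sum_subtractf sum_distrib_left)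
  qed
  also have "\<dots> = 0" using q by (simp add: rel gen_q sum.delta mult.commute)
  finally have "(\<Sum>i<4. chart_vec z q A x h $ i * gen i) = 0" .
  moreover have "chart_vec z q A x h $ i \<in> homog (int (A + d - 1) - int (e i))" if i: "i < 4" for i
  proof -
    have "Var z ^ A * x i \<in> homog (int (A + d - 1) - int (e i))"
      using d_pos by (intro homog_mult'[OF homog_power[OF homog_Var] x[OF i]]) auto
    moreover have "l * h \<in> homog (int (A + d - 1) - int (e q))"
      using d_pos by (intro homog_mult'[OF l_homog h]) (auto simp: e_q)
    ultimately show ?thesis using i by (auto simp: chart_vec_def intro: homog_diff)
  qed
  ultimately show ?thesis by (simp add: piece_M chart_vec_def)
qed

lemma Var_nonzero: "Var z \<noteq> (0 :: 'k poly3)"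
  unfolding Var_def by (metis lookup_single_eq lookup_zero zero_neq_one)

lemma chart_vec_entry:
  assumes "i < 4"
  shows "frac_vec (Var z) (A + d - 1) (chart_vec z q A x h) $ i =
    Fract (x i) (Var z ^ (d - 1)) -
      (if i = q then Fract (l * h) (Var z ^ (A + d - 1)) else 0)"
proof -
  have "Var z \<noteq> (0 :: 'k poly3)" by (rule Var_nonzero)
  moreover have "A + d - 1 = A + (d - 1)" using d_pos by simp
  ultimately have "Fract (x i) (Var z ^ (d - 1)) = Fract (Var z ^ A * x i) (Var z ^ (A + d - 1))"
    by (simp add: eq_fract power_add)
  then show ?thesis
    using assms \<open>Var z \<noteq> 0\<close> by (auto simp: chart_vec_def eq_fract algebra_simps)
qed

lemma basic_Var: "basic (Var z :: 'k poly3)"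
proof -
  have "Var z \<noteq> (0 :: 'k poly3)" by (rule Var_nonzero)
  then show ?thesis unfolding basic_def by (intro conjI exI[of _ 1]) simp_all
qed

text \<open>
  The charts of \<open>x\<close> and \<open>y\<close> cover the line. A relation \<open>n\<close> in degree \<open>d - 1\<close> gives sections \<open>n / x\<^bsup>d-1\<^esup>\<close>
  and \<open>n / y\<^bsup>d-1\<^esup>\<close> of \<open>M\<close> on them that differ by the factor \<open>(y/x)\<^bsup>d-1\<^esup>\<close>, and so do their images in
  \<open>F\<close>. These form a global section of three copies of \<open>\<O>(-1)\<close>, hence vanish.
\<close>

proposition gens_inj_of_line_iso:
  assumes "line_iso l M F"
  shows "gens.gens_inj (int d - 1)"
  unfolding gens.gens_inj_def
proof (intro ballI allI impI)
  fix n and i0 :: nat assume n: "n \<in> gens.line_syz (int d - 1)" and i0: "i0 < 4"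
  define x where "x i = lift (int d - 1 - int (e i)) (n i)" for i
  have x: "x i \<in> homog (int d - 1 - int (e i))" for i by (simp add: x_def lift_homog)
  have rho_x: "rho (x i) = n i" if "i < 4" for i
    using n that by (simp add: x_def gens.line_syz_def rho_lift)
  have "(\<Sum>i<4. x i * gen i) \<in> homog (int d - 1)"
    by (intro homog_sum homog_mult'[OF x gen_homog]) simp
  moreover have "rho (\<Sum>i<4. x i * gen i) = 0"
    using n by (simp add: rho_sum rho_mult rho_x gens.line_syz_def)
  ultimately obtain h where h: "h \<in> homog (int d - 2)" "(\<Sum>i<4. x i * gen i) = l * h"
    using rho_kernel by fastforce
  define X Y where "X = (Var VX :: 'k poly3)" and "Y = (Var VY :: 'k poly3)"
  have XY: "X \<noteq> 0" "Y \<noteq> 0" "basic X" "basic Y" "X \<in> homog 1" "Y \<in> homog 1"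
    using basic_Var basic_nonzero by (auto simp: X_def Y_def)
  have XY_homog: "X * Y \<in> homog 2" using homog_mult[OF XY(5,6)] by simp
  have bXY: "basic (X * Y)" using XY(1,2) XY_homog unfolding basic_def
    by (intro conjI exI[of _ 2]) simp_all
  have dvd: "X dvd (X * Y) ^ 1" "Y dvd (X * Y) ^ 1" by auto
  define sx where "sx = frac_vec X (a + d - 1) (chart_vec VX 1 a x h)"
  define sy where "sy = frac_vec Y (b + d - 1) (chart_vec VY 2 b x h)"
  have sx: "sx \<in> sections M X"
    unfolding sx_def by (rule M.sectionsI[OF XY(5)])
      (use chart_vec_piece[OF _ gen_1 e_simps(2) x h] in simp)
  have sy: "sy \<in> sections M Y"
    unfolding sy_def by (rule M.sectionsI[OF XY(6)])
      (use chart_vec_piece[OF _ gen_2 e_simps(4) x h] in simp)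
  \<comment> \<open>The transition function \<open>(y/x)\<^bsup>d-1\<^esup>\<close>, written with denominator a power of \<open>x y\<close>.\<close>
  define r where "r = Fract (Y ^ (2 * (d - 1))) ((X * Y) ^ (d - 1))"
  have r: "r \<in> regular_fun (X * Y)"
    unfolding regular_fun_def r_def
    using XY_homog homog_power[OF XY(6), of "2 * (d - 1)"]
    by (intro CollectI exI[of _ "Y ^ (2 * (d - 1))"] exI[of _ "d - 1"] exI[of _ 2])
      (auto simp: mult.commute)
  note sx' = M.sections_mono[OF XY(3) bXY dvd(1) sx]
  note sy' = M.sections_mono[OF XY(4) bXY dvd(2) sy]
  have diff_N: "sx - r \<cdot>\<^sub>v sy \<in> M.N (X * Y)"
    unfolding M.N_iff[OF bXY]
  proof (intro conjI allI impI)
    show "sx - r \<cdot>\<^sub>v sy \<in> sections M (X * Y)"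
      by (intro M.sections_diff[OF bXY] M.sections_smult[OF bXY r] sx' sy')
    fix i assume "i < rk M"
    then have i: "i < 4" by simp
    let ?dx = "if i = 1 then Fract (l * h) (X ^ (a + d - 1)) else 0"
    let ?dy = "if i = 2 then Fract (l * h) (Y ^ (b + d - 1)) else 0"
    have r_eq: "Fract (x i) (X ^ (d - 1)) = r * Fract (x i) (Y ^ (d - 1))"
      using XY by (simp add: r_def eq_fract power_mult_distrib mult_2 power_add ac_simps)
    have entries: "sx $ i = Fract (x i) (X ^ (d - 1)) - ?dx" "sy $ i = Fract (x i) (Y ^ (d - 1)) - ?dy"
      using chart_vec_entry[OF i] by (simp_all add: sx_def sy_def X_def Y_def)
    have "(sx - r \<cdot>\<^sub>v sy) $ i = sx $ i - r * sy $ i"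
      using i M.sections_dim[OF sx] M.sections_dim[OF sy] by simp
    also have "\<dots> = r * ?dy - ?dx"
      unfolding entries r_eq by (simp add: right_diff_distrib)
    finally have "(sx - r \<cdot>\<^sub>v sy) $ i = r * ?dy - ?dx" .
    moreover have "?dx \<in> Van l (X * Y)"
      using Van_mono[OF dvd(1) basic_nonzero[OF bXY] VanI] by auto
    moreover have "?dy \<in> Van l (X * Y)"
      using Van_mono[OF dvd(2) basic_nonzero[OF bXY] VanI] by auto
    ultimately show "(sx - r \<cdot>\<^sub>v sy) $ i \<in> Van l (X * Y)"
      by (simp only: Van_diff[OF basic_nonzero[OF bXY]] regular_fun_Van[OF r])
  qed
  obtain \<phi> where
    bij: "\<And>f. basic f \<Longrightarrow> bij_betw (\<phi> f) (line_sections l M f) (line_sections l F f)" and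
    smult: "\<And>f r A. basic f \<Longrightarrow> r \<in> regular_fun f \<Longrightarrow> A \<in> line_sections l M f \<Longrightarrow>
      \<phi> f (coset_smult (M.N f) r A) = coset_smult (F.N f) r (\<phi> f A)" and
    res: "\<And>f h k A. basic f \<Longrightarrow> basic h \<Longrightarrow> f dvd h ^ k \<Longrightarrow> A \<in> line_sections l M f \<Longrightarrow>
      \<phi> h (line_res l M h A) = line_res l F h (\<phi> f A)"
    using assms unfolding line_iso_def
  proof (elim exE conjE, goal_cases)
    case (1 \<phi>)
    show ?case
    proof (rule 1(1)[of \<phi>])
      show "bij_betw (\<phi> f) (line_sections l M f) (line_sections l F f)" if "basic f" for f
        using 1(2) that by blast
      show "\<phi> f (coset_smult (M.N f) r A) = coset_smult (F.N f) r (\<phi> f A)"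
        if "basic f" "r \<in> regular_fun f" "A \<in> line_sections l M f" for f r A
        using 1(2)[rule_format, OF that(1), THEN conjunct2, THEN conjunct2] that(2,3) by blast
      show "\<phi> h (line_res l M h A) = line_res l F h (\<phi> f A)"
        if "basic f" "basic h" "f dvd h ^ k" "A \<in> line_sections l M f" for f h k A
        using 1(3) that by blast
    qed
  qed
  have image: "\<exists>t\<in>sections F f. \<phi> f (coset (M.N f) s) = coset (F.N f) t"
    if "basic f" "s \<in> sections M f" for f s
    using bij_betw_apply[OF bij[OF that(1)] M.line_sectionsI[OF that(2)]]
    by (auto simp: line_sections_def)
  obtain tx where tx: "tx \<in> sections F X" "\<phi> X (coset (M.N X) sx) = coset (F.N X) tx"
    using image[OF XY(3) sx] by blast
  obtain ty where ty: "ty \<in> sections F Y" "\<phi> Y (coset (M.N Y) sy) = coset (F.N Y) ty"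
    using image[OF XY(4) sy] by blast
  note tx' = F.sections_mono[OF XY(3) bXY dvd(1) tx(1)]
  note ty' = F.sections_mono[OF XY(4) bXY dvd(2) ty(1)]
  have "coset (F.N (X * Y)) tx = \<phi> (X * Y) (coset (M.N (X * Y)) sx)"
    using res[OF XY(3) bXY dvd(1) M.line_sectionsI[OF sx]]
    by (simp add: tx(2) M.line_res_coset[OF XY(3) bXY dvd(1) sx]
        F.line_res_coset[OF XY(3) bXY dvd(1) tx(1)])
  also have "coset (M.N (X * Y)) sx = coset (M.N (X * Y)) (r \<cdot>\<^sub>v sy)"
    using diff_N by (simp add: M.coset_eq_iff[OF bXY sx' M.sections_smult[OF bXY r sy']])
  also have "\<phi> (X * Y) \<dots> = coset_smult (F.N (X * Y)) r (\<phi> (X * Y) (coset (M.N (X * Y)) sy))"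
    using smult[OF bXY r M.line_sectionsI[OF sy']] by (simp add: M.coset_smult_coset[OF bXY r sy'])
  also have "\<phi> (X * Y) (coset (M.N (X * Y)) sy) = coset (F.N (X * Y)) ty"
    using res[OF XY(4) bXY dvd(2) M.line_sectionsI[OF sy]]
    by (simp add: ty(2) M.line_res_coset[OF XY(4) bXY dvd(2) sy]
        F.line_res_coset[OF XY(4) bXY dvd(2) ty(1)])
  also have "coset_smult (F.N (X * Y)) r \<dots> = coset (F.N (X * Y)) (r \<cdot>\<^sub>v ty)"
    by (rule F.coset_smult_coset[OF bXY r ty'])
  finally have glue: "tx - r \<cdot>\<^sub>v ty \<in> F.N (X * Y)"
    by (simp add: F.coset_eq_iff[OF bXY tx' F.sections_smult[OF bXY r ty']])
  obtain k p where p: "p \<in> piece F (int k * 1)" "tx = frac_vec X k p"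
    using F.sectionsE[OF tx(1) XY(1,5)] by blast
  obtain m p' where p': "p' \<in> piece F (int m * 1)" "ty = frac_vec Y m p'"
    using F.sectionsE[OF ty(1) XY(2,6)] by blast
  have rho_p: "rho (p $ j) = 0" if j: "j < 3" for j
  proof -
    let ?q = "p $ j * ((X * Y) ^ (d - 1) * Y ^ m) - Y ^ (2 * (d - 1)) * p' $ j * X ^ k"
    have "(tx - r \<cdot>\<^sub>v ty) $ j = Fract ?q (X ^ k * ((X * Y) ^ (d - 1) * Y ^ m))"
      using j p p' XY by (simp add: piece_F r_def)
    moreover have "(tx - r \<cdot>\<^sub>v ty) $ j \<in> Van l (X * Y)"
      using glue j by (simp add: F.N_iff[OF bXY])
    ultimately have "rho (X * Y) = 0 \<or> rho ?q = 0"
      using Van_imp_rho XY by (metis mult_eq_0_iff power_not_zero)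
    moreover have "rho X = monom 1 1" "rho Y = 1" by (simp_all add: X_def Y_def)
    ultimately have eq: "monom 1 (d - 1) * rho (p $ j) = monom 1 k * rho (p' $ j)"
      by (simp add: rho_mult rho_diff rho_power monom_power mult.commute)
    \<comment> \<open>The left side has degree less than \<open>k\<close> and the right side is divisible by \<open>X\<^sup>k\<close>.\<close>
    have "rho (p $ j) \<in> Sdeg (int k - int d)"
      using p(1) j by (intro rho_homog) (simp add: piece_F)
    then have "monom 1 (d - 1) * rho (p $ j) \<in> Sdeg (int (d - 1) + (int k - int d))"
      by (intro Sdeg_mult Sdeg_monom) auto
    then have "monom 1 k * rho (p' $ j) \<in> Sdeg (int k - 1)"
      unfolding eq using d_pos by (simp add: of_nat_diff)
    then have "coeff (monom 1 k * rho (p' $ j)) (k + i) = 0" for i by (simp add: Sdeg_def)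
    then have "rho (p' $ j) = 0"
      by (intro poly_eqI) (simp add: coeff_monom_mult)
    then have "monom 1 (d - 1) * rho (p $ j) = 0" using eq by simp
    then show ?thesis by (simp add: monom_eq_0_iff)
  qed
  have zero_regular: "0 \<in> regular_fun X"
    unfolding regular_fun_def using XY(5)
    by (intro CollectI exI[of _ "0 :: 'k poly3"] exI[of _ "0 :: nat"] exI[of _ "1 :: int"]) (auto simp: fract_collapse)
  have "\<phi> X (coset (M.N X) (0 \<cdot>\<^sub>v sx)) = coset (F.N X) (0 \<cdot>\<^sub>v tx)"
    using smult[OF XY(3) zero_regular M.line_sectionsI[OF sx]]
    by (simp add: tx M.coset_smult_coset[OF XY(3) zero_regular sx]
        F.coset_smult_coset[OF XY(3) zero_regular tx(1)])
  also have "\<dots> = coset (F.N X) tx"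
  proof -
    have "tx \<in> F.N X"
      unfolding p(2) using frac_vec_in_N_iff(2)[OF XY(3,5) p(1)] rho_p by simp
    then have "0 \<cdot>\<^sub>v tx - tx \<in> F.N X"
      by (intro F.N_diff[OF XY(3)] F.N_smult[OF XY(3) zero_regular])
    then show ?thesis
      by (simp add: F.coset_eq_iff[OF XY(3) F.sections_smult[OF XY(3) zero_regular tx(1)] tx(1)])
  qed
  finally have "\<phi> X (coset (M.N X) (0 \<cdot>\<^sub>v sx)) = \<phi> X (coset (M.N X) sx)" by (simp add: tx)
  note sx0 = M.sections_smult[OF XY(3) zero_regular sx]
  have "coset (M.N X) sx = coset (M.N X) (0 \<cdot>\<^sub>v sx)"
    using inj_onD[OF bij_betw_imp_inj_on[OF bij[OF XY(3)]]] M.line_sectionsI[OF sx]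
      M.line_sectionsI[OF sx0] \<open>\<phi> X (coset (M.N X) (0 \<cdot>\<^sub>v sx)) = \<phi> X (coset (M.N X) sx)\<close>
    by metis
  then have "sx - 0 \<cdot>\<^sub>v sx \<in> M.N X" by (simp add: M.coset_eq_iff[OF XY(3) sx sx0])
  then have "(sx - 0 \<cdot>\<^sub>v sx) $ i0 \<in> Van l X" using i0 by (simp add: M.N_iff[OF XY(3)])
  moreover have "(sx - 0 \<cdot>\<^sub>v sx) $ i0 = Fract (chart_vec VX 1 a x h $ i0) (X ^ (a + d - 1))"
    using i0 M.sections_dim[OF sx] by (simp add: sx_def chart_vec_def)
  ultimately have "rho X = 0 \<or> rho (chart_vec VX 1 a x h $ i0) = 0"
    using Van_imp_rho XY(1) by (metis power_not_zero)
  then have "monom 1 a * n i0 = 0"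
    using i0 by (auto simp: X_def chart_vec_def rho_diff rho_mult rho_power rho_x monom_power
        monom_eq_0_iff split: if_splits)
  then show "n i0 = 0" by (simp add: monom_eq_0_iff)
qed

proposition line_iso_iff_mult_surj: "line_iso l M F \<longleftrightarrow> mult_surj I l (int d - 2)"
proof -
  have "(\<Sum>i<4. e i) = 3 * d" by (simp add: sum4 e_simps sum_deg)
  then show ?thesis
    using gens.gens_inj_iff_surj line_iso_of_gens_bij gens_inj_of_line_iso
    unfolding mult_surj_iff_gens_surj by blast
qed

end

section \<open>Generic lines\<close>

lemma lookup_lin:
  "Poly_Mapping.lookup (lin u v w) (Poly_Mapping.single VX 1) = u"
  "Poly_Mapping.lookup (lin u v w) (Poly_Mapping.single VY 1) = v"
  "Poly_Mapping.lookup (lin u v w) (Poly_Mapping.single VZ 1) = w"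
  unfolding single_var_mon by (simp_all add: lin_def lookup_add lookup_single mon_eq_iff)

lemma linear_form_eq_lin:
  assumes "l \<in> homog 1"
  shows "l = lin (Poly_Mapping.lookup l (Poly_Mapping.single VX 1))
    (Poly_Mapping.lookup l (Poly_Mapping.single VY 1))
    (Poly_Mapping.lookup l (Poly_Mapping.single VZ 1))"
    (is "l = ?l")
proof (rule poly_mapping_eqI)
  fix m
  show "Poly_Mapping.lookup l m = Poly_Mapping.lookup ?l m"
  proof (cases "tdeg m = 1")
    case True
    then obtain v where "m = Poly_Mapping.single v 1" by (rule tdeg_one_cases)
    then show ?thesis by (cases v) (simp_all only: lookup_lin)
  next
    case False
    then have "Poly_Mapping.lookup p m = 0" if "p \<in> homog 1" for p :: "'a poly3"
      using that by (auto simp: homog_def in_keys_iff)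
    then show ?thesis using assms lin_homog by metis
  qed
qed

text \<open>
  Kronecker substitution: on the curve \<open>(t, t\<^sup>B, t\<^sup>C)\<close> with \<open>C = B\<^sup>2\<close> and \<open>B\<close> above all exponents,
  distinct monomials restrict to distinct powers of \<open>t\<close>.
\<close>

lemma poly3_eval_nonzero:
  fixes P :: "'k::field poly3"
  assumes inf: "infinite (UNIV :: 'k set)" and P: "P \<noteq> 0"
  shows "\<exists>U. (\<forall>v. U v \<noteq> 0) \<and> poly3_eval P U \<noteq> 0"
proof -
  define B where "B = Suc (\<Sum>m\<in>Poly_Mapping.keys P. tdeg m)"
  define E where "E m = Poly_Mapping.lookup m VX +
    (Poly_Mapping.lookup m VY + Poly_Mapping.lookup m VZ * B) * B" for m :: monom3
  have small: "Poly_Mapping.lookup m v < B" if "m \<in> Poly_Mapping.keys P" for m v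
  proof -
    have "Poly_Mapping.lookup m v \<le> tdeg m" by (cases v) (auto simp: tdeg_def)
    also have "tdeg m \<le> (\<Sum>m\<in>Poly_Mapping.keys P. tdeg m)"
      using that by (intro member_le_sum) auto
    finally show ?thesis by (simp add: B_def)
  qed
  have inj: "m = n" if mn: "m \<in> Poly_Mapping.keys P" "n \<in> Poly_Mapping.keys P" "E m = E n" for m n
  proof -
    have "B > 0" by (simp add: B_def)
    have "E m mod B = Poly_Mapping.lookup m VX" "E n mod B = Poly_Mapping.lookup n VX"
      using small[OF mn(1), of VX] small[OF mn(2), of VX] by (simp_all add: E_def)
    then have x: "Poly_Mapping.lookup m VX = Poly_Mapping.lookup n VX" using mn(3) by simp
    have "E m div B = Poly_Mapping.lookup m VY + Poly_Mapping.lookup m VZ * B"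
      "E n div B = Poly_Mapping.lookup n VY + Poly_Mapping.lookup n VZ * B"
      using small[OF mn(1), of VX] small[OF mn(2), of VX] \<open>B > 0\<close> by (simp_all add: E_def)
    then have yz: "Poly_Mapping.lookup m VY + Poly_Mapping.lookup m VZ * B =
        Poly_Mapping.lookup n VY + Poly_Mapping.lookup n VZ * B" using mn(3) by simp
    have y: "Poly_Mapping.lookup m VY = Poly_Mapping.lookup n VY"
      using arg_cong[OF yz, of "\<lambda>k. k mod B"] small[OF mn(1), of VY] small[OF mn(2), of VY] by simp
    then have "Poly_Mapping.lookup m VZ = Poly_Mapping.lookup n VZ" using yz \<open>B > 0\<close> by simp
    then show ?thesis using x y by (intro monom3_eqI)
  qed
  define Q where "Q = (\<Sum>m\<in>Poly_Mapping.keys P. monom (Poly_Mapping.lookup P m) (E m))"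
  obtain m where m: "m \<in> Poly_Mapping.keys P" using P by (metis ex_in_conv keys_eq_empty)
  have "coeff Q (E m) = (\<Sum>n\<in>Poly_Mapping.keys P. if n = m then Poly_Mapping.lookup P m else 0)"
    unfolding Q_def coeff_sum using inj m by (intro sum.cong) auto
  also have "\<dots> = Poly_Mapping.lookup P m" using m by (simp add: sum.delta)
  finally have "Q \<noteq> 0" using m by (auto simp: in_keys_iff)
  then have "finite (insert 0 {t. poly Q t = 0})" by (simp add: poly_roots_finite)
  then obtain t where t: "t \<noteq> 0" "poly Q t \<noteq> 0" using inf ex_new_if_finite by blast
  define U where "U v = (case v of VX \<Rightarrow> t | VY \<Rightarrow> t ^ B | VZ \<Rightarrow> t ^ (B * B))" for v
  have "poly3_eval P U = poly Q t"
    unfolding poly3_eval_def Q_def poly_sum poly_monom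
    by (intro sum.cong) (auto simp: U_def E_def power_add power_mult[symmetric] algebra_simps)
  moreover have "U v \<noteq> 0" for v using t(1) by (cases v) (auto simp: U_def)
  ultimately show ?thesis using t(2) by (intro exI[of _ U]) auto
qed

section \<open>The equivalence\<close>

text \<open>
  Each lower bound is the degree of the least common multiple of two of the four monomials.
\<close>

lemma gen_monoms_pairwise:
  assumes "d \<le> \<alpha> + \<beta> + c" "d \<le> \<alpha> + b + \<gamma>" "d \<le> a + \<beta> + \<gamma>"
    and "d \<le> a + b" "d \<le> a + c" "d \<le> b + c"
    and ij: "i < 4" "j < 4" "i \<noteq> j"
    and div: "divides (gen_monoms a b c \<alpha> \<beta> \<gamma> ! i) m" "divides (gen_monoms a b c \<alpha> \<beta> \<gamma> ! j) m"
  shows "d \<le> tdeg m"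
proof -
  obtain i1 i2 i3 where m: "m = mon i1 i2 i3" by (rule monom3_cases)
  have cases4: "k = 0 \<or> k = 1 \<or> k = 2 \<or> k = 3" if "k < 4" for k :: nat
    using that by linarith
  show ?thesis
    using cases4[OF ij(1)] cases4[OF ij(2)] ij(3) div assms(1-6)
    by (elim disjE) (simp_all add: gen_monoms_def m divides_mon)
qed

text \<open>
  A monomial outside the ideal all of whose multiples by variables lie in it is one of three: for
  instance its exponents of \<open>x\<close>, \<open>y\<close>, \<open>z\<close> may be \<open>\<alpha> - 1\<close>, \<open>b - 1\<close>, \<open>c - 1\<close>. Its degree \<open>\<alpha> + b + c - 3\<close> is at
  least \<open>d - 2\<close>, by \<open>\<alpha> + b + \<gamma> \<ge> d\<close> and \<open>\<gamma> < c\<close>.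
\<close>

lemma gen_monoms_socle:
  assumes "\<alpha> < a" "\<beta> < b" "\<gamma> < c"
    and "d \<le> \<alpha> + \<beta> + c" "d \<le> \<alpha> + b + \<gamma>" "d \<le> a + \<beta> + \<gamma>"
    and m: "tdeg m + 2 < d" "\<not> (\<exists>g\<in>set (gen_monoms a b c \<alpha> \<beta> \<gamma>). divides g m)"
  shows "\<exists>v. \<not> (\<exists>g\<in>set (gen_monoms a b c \<alpha> \<beta> \<gamma>). divides g (Poly_Mapping.single v 1 + m))"
proof (rule ccontr)
  assume *: "\<not> ?thesis"
  obtain i j k where mon: "m = mon i j k" by (rule monom3_cases)
  have deg: "i + j + k + 2 < d" and out: "\<not> (\<alpha> \<le> i \<and> \<beta> \<le> j \<and> \<gamma> \<le> k)" "i < a" "j < b" "k < c"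
    using m by (auto simp: mon gen_monoms_def divides_mon)
  have next_in: "\<exists>g\<in>set (gen_monoms a b c \<alpha> \<beta> \<gamma>). divides g (Poly_Mapping.single v 1 + m)" for v
    using * by blast
  have "\<alpha> \<le> i + 1 \<and> \<beta> \<le> j \<and> \<gamma> \<le> k \<or> a \<le> i + 1"
    using next_in[of VX] out unfolding mon single_var_mon mon_add
    by (simp add: gen_monoms_def divides_mon)
  moreover have "\<alpha> \<le> i \<and> \<beta> \<le> j + 1 \<and> \<gamma> \<le> k \<or> b \<le> j + 1"
    using next_in[of VY] out unfolding mon single_var_mon mon_add
    by (simp add: gen_monoms_def divides_mon)
  moreover have "\<alpha> \<le> i \<and> \<beta> \<le> j \<and> \<gamma> \<le> k + 1 \<or> c \<le> k + 1"
    using next_in[of VZ] out unfolding mon single_var_mon mon_add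
    by (simp add: gen_monoms_def divides_mon)
  ultimately show False using deg out assms(1-6) by (elim disjE conjE) linarith+
qed

lemma ideal_gen_eq_monomial_ideal:
  "ideal_gen {Var VX ^ a, Var VY ^ b, Var VZ ^ c, Var VX ^ \<alpha> * Var VY ^ \<beta> * Var VZ ^ \<gamma>} =
     (monomial_ideal (gen_monoms a b c \<alpha> \<beta> \<gamma>) :: 'k::field poly3 set)"
proof -
  have "{Var VX ^ a, Var VY ^ b, Var VZ ^ c, Var VX ^ \<alpha> * Var VY ^ \<beta> * Var VZ ^ \<gamma>} =
      (\<lambda>g. Poly_Mapping.single g (1 :: 'k)) ` set (gen_monoms a b c \<alpha> \<beta> \<gamma>)"
    unfolding Var_power_mult by (auto simp: gen_monoms_def Var_power single_var_mon)
  then show ?thesis by (simp only: ideal_gen_monomials)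
qed

lemma syz_arg_eq:
  "[(\<alpha> + \<beta> + \<gamma>, Var VX ^ \<alpha> * Var VY ^ \<beta> * Var VZ ^ \<gamma> :: 'k::field poly3),
    (a, Var VX ^ a), (b, Var VY ^ b), (c, Var VZ ^ c)] =
   map (\<lambda>m. (tdeg m, Poly_Mapping.single m 1)) (gen_monoms a b c \<alpha> \<beta> \<gamma>)"
  unfolding Var_power_mult by (simp add: gen_monoms_def Var_power single_var_mon)

theorem theorem4p23:
  fixes a b c \<alpha> \<beta> \<gamma> d :: nat
    and I :: "'k::field poly3 set"
  assumes "infinite (UNIV :: 'k set)"
    and "0 < \<alpha>" "\<alpha> < a" "0 < \<beta>" "\<beta> < b" "0 < \<gamma>" "\<gamma> < c"
    and "I = ideal_gen {Var VX ^ a, Var VY ^ b, Var VZ ^ c,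
                        Var VX ^ \<alpha> * Var VY ^ \<beta> * Var VZ ^ \<gamma>}"
    and "3 * d = a + b + c + \<alpha> + \<beta> + \<gamma>"
    and "Max {a, b, c, \<alpha> + \<beta> + \<gamma>} \<le> d"
    and "Min {\<alpha> + \<beta> + c, \<alpha> + b + \<gamma>, a + \<beta> + \<gamma>} \<ge> d"
    and "Min {a + b, a + c, b + c} \<ge> d"
  shows "(weak_lefschetz I \<longleftrightarrow> (of_int (det (Zmat d I)) :: 'k) \<noteq> 0) \<and>
         ((of_int (det (Zmat d I)) :: 'k) \<noteq> 0 \<longleftrightarrow>
          generic_splitting_type
            (syz [(\<alpha> + \<beta> + \<gamma>, Var VX ^ \<alpha> * Var VY ^ \<beta> * Var VZ ^ \<gamma> :: 'k poly3),
                  (a, Var VX ^ a), (b, Var VY ^ b), (c, Var VZ ^ c)])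
            [- int d, - int d, - int d])"
proof -
  let ?G = "gen_monoms a b c \<alpha> \<beta> \<gamma>"
  let ?det = "of_int (det (Zmat d I)) :: 'k"
  have I: "I = monomial_ideal ?G"
    using assms(8) by (simp only: ideal_gen_eq_monomial_ideal)
  have le: "\<alpha> + \<beta> + \<gamma> \<le> d" "a \<le> d" "b \<le> d" "c \<le> d" using assms(10) by auto
  have ge: "d \<le> \<alpha> + \<beta> + c" "d \<le> \<alpha> + b + \<gamma>" "d \<le> a + \<beta> + \<gamma>" "d \<le> a + b" "d \<le> a + c" "d \<le> b + c"
    using assms(11,12) by auto
  have d: "d \<ge> 1" using le assms(2) by linarith
  have length: "length ?G = 4" by (simp add: gen_monoms_def)
  have card: "card (std_monoms I (int d - 2)) = card (std_monoms I (int d - 1))"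
    unfolding I
  proof (rule card_std_monoms_eq)
    show "d \<le> tdeg m"
      if "i < length ?G" "j < length ?G" "i \<noteq> j" "divides (?G ! i) m" "divides (?G ! j) m" for i j m
      using gen_monoms_pairwise[OF ge] that length by metis
    show "(\<Sum>i<length ?G. d - tdeg (?G ! i)) = d"
      unfolding length using le assms(9) by (simp add: sum4 gen_monoms_def)
  qed (rule d)
  have "weak_lefschetz I \<longleftrightarrow> ?det \<noteq> 0"
    unfolding I
  proof (rule weak_lefschetz_iff_det[OF card[unfolded I] d])
    show "\<exists>v. \<not> (\<exists>g\<in>set ?G. divides g (Poly_Mapping.single v 1 + m))"
      if "tdeg m + 2 < d" "\<not> (\<exists>g\<in>set ?G. divides g m)" for m
      using gen_monoms_socle[OF assms(3,5,7) ge(1-3) that] .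
  qed
  moreover have "?det \<noteq> 0 \<longleftrightarrow>
      generic_splitting_type (syz (map (\<lambda>m. (tdeg m, Poly_Mapping.single m (1 :: 'k))) ?G))
        [- int d, - int d, - int d]"
    (is "_ \<longleftrightarrow> generic_splitting_type ?S ?ds")
  proof -
    obtain E where E: "\<And>l. l \<in> homog 1 \<Longrightarrow> mult_surj I l (int d - 2) \<longleftrightarrow>
        (\<Prod>v\<in>UNIV. Poly_Mapping.lookup l (Poly_Mapping.single v 1) ^ E v) * ?det \<noteq> 0"
      using mult_inj_surj_iff_det[of ?G d] card unfolding I Let_def by blast
    have iso: "line_iso (lin u v w) ?S (free_mod ?ds) \<longleftrightarrow> ?det \<noteq> 0"
      if "u \<noteq> 0" "v \<noteq> 0" "w \<noteq> 0" for u v w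
    proof -
      interpret L: four_forms u v w a b c \<alpha> \<beta> \<gamma> d
        by unfold_locales (use that le d assms(9) in auto)
      have "Poly_Mapping.lookup (lin u v w) (Poly_Mapping.single x 1) \<noteq> 0" for x
        using that by (cases x) (simp_all only: lookup_lin not_False_eq_True)
      then show ?thesis
        using L.line_iso_iff_mult_surj E[OF lin_homog] by (simp add: L.M_def L.F_def I)
    qed
    show ?thesis
    proof
      assume det: "?det \<noteq> 0"
      let ?P = "Poly_Mapping.single (mon 1 1 1) (1 :: 'k)"
      have P: "?P \<noteq> 0" by (metis lookup_single_eq lookup_zero zero_neq_one)
      have "line_iso l ?S (free_mod ?ds)"
        if l: "l \<in> homog 1" and Pl: "poly3_eval ?P (\<lambda>v. Poly_Mapping.lookup l (Poly_Mapping.single v 1)) \<noteq> 0" for l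
      proof -
        have "Poly_Mapping.lookup l (Poly_Mapping.single VX 1) \<noteq> 0"
          "Poly_Mapping.lookup l (Poly_Mapping.single VY 1) \<noteq> 0"
          "Poly_Mapping.lookup l (Poly_Mapping.single VZ 1) \<noteq> 0"
          using Pl by (auto simp: poly3_eval_def)
        from iso[OF this] show ?thesis
          unfolding linear_form_eq_lin[OF l, symmetric] using det by simp
      qed
      then show "generic_splitting_type ?S ?ds"
        unfolding generic_splitting_type_def
        by (intro exI[of _ ?P] exI[of _ "3 :: int"] conjI P ballI impI homog_singleI) simp_all
    next
      assume "generic_splitting_type ?S ?ds"
      then obtain P where P: "P \<noteq> 0" and gst: "\<And>l. l \<in> homog 1 \<Longrightarrow> l \<noteq> 0 \<Longrightarrow>
          poly3_eval P (\<lambda>v. Poly_Mapping.lookup l (Poly_Mapping.single v 1)) \<noteq> 0 \<Longrightarrow>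
          line_iso l ?S (free_mod ?ds)"
        unfolding generic_splitting_type_def by blast
      obtain U where U: "\<And>v. U v \<noteq> 0" "poly3_eval P U \<noteq> 0"
        using poly3_eval_nonzero[OF assms(1) P] by blast
      let ?l = "lin (U VX) (U VY) (U VZ)"
      have "(\<lambda>v. Poly_Mapping.lookup ?l (Poly_Mapping.single v 1)) = U"
      proof
        show "Poly_Mapping.lookup ?l (Poly_Mapping.single v 1) = U v" for v
          by (cases v) (simp_all only: lookup_lin)
      qed
      then have "line_iso ?l ?S (free_mod ?ds)"
        using U by (intro gst lin_homog lin_nonzero) simp_all
      then show "?det \<noteq> 0" by (rule iso[OF U(1) U(1) U(1), THEN iffD1])
    qed
  qed
  ultimately show ?thesis unfolding syz_arg_eq by blast
qed

end
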